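(* For all integers $1\le s\leq t$ there is a constant $c(s,t)$, depending only on $s$ and $t$, such that for every $p\geq 3$ and every sufficiently large $n$ (depending on $s,t,p$), $$\mathrm{ex}(n,K_{s,t}^{p+1})=\binom{s-1}{2}+(s-1)(n-s+1)+t_p(n-s+1)+c(s,t).$$
   Context: Graphs are finite and simple. For a graph $H$, $\mathrm{ex}(n,H)$ is the maximum number of edges of an $n$-vertex graph containing no copy of $H$ as a (not necessarily induced) subgraph. $K_{s,t}$ is the complete bipartite graph with part sizes $s$ and $t$. $t_p(n)$ is the number of edges of the balanced complete $p$-partite graph $T_p(n)$ on $n$ vertices (part sizes differ by at most one). The edge blow-up $H^{p+1}$ of a graph $H$ is obtained from $H$ by replacing each edge of $H$ by a clique of order $p+1$ containing that edge, where the $p-1$ new vertices of the different cliques are all distinct. *)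

theory Defs
  imports Complex_Main "HOL-Library.Ramsey"
begin

text \<open>A graph is a pair of a vertex set and an edge set; edges are two-element sets of vertices.
  The term \<open>nsets V 2\<close> from the Ramsey theory is the set of two-element subsets of \<open>V\<close>.\<close>

type_synonym 'a graph = "'a set \<times> 'a set set"

abbreviation verts :: "'a graph \<Rightarrow> 'a set" where
  "verts G \<equiv> fst G"

abbreviation edges :: "'a graph \<Rightarrow> 'a set set" where
  "edges G \<equiv> snd G"

definition fin_simple_graph :: "'a graph \<Rightarrow> bool" where
  "fin_simple_graph G \<longleftrightarrow> finite (verts G) \<and> edges G \<subseteq> nsets (verts G) 2"

definition contains_copy :: "'a graph \<Rightarrow> 'b graph \<Rightarrow> bool" where
  "contains_copy G H \<longleftrightarrow>
     (\<exists>f. inj_on f (verts H) \<and> f ` verts H \<subseteq> verts G \<and> (\<forall>e \<in> edges H. f ` e \<in> edges G))"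

text \<open>Every finite graph is isomorphic to one with vertices in \<open>nat\<close>, so it suffices to let the
  host graph range over these. If \<open>H\<close> has an edge, the maximum is taken over a finite nonempty
  set, as shown in \<open>ex_candidates\<close> below.\<close>

definition ex_num :: "nat \<Rightarrow> 'b graph \<Rightarrow> nat" where
  "ex_num n H = Max {card (edges G) | G :: nat graph.
     fin_simple_graph G \<and> card (verts G) = n \<and> \<not> contains_copy G H}"

definition complete_bipartite :: "nat \<Rightarrow> nat \<Rightarrow> (nat + nat) graph" where
  "complete_bipartite s t =
     (Inl ` {..<s} \<union> Inr ` {..<t}, {{Inl i, Inr j} | i j. i < s \<and> j < t})"

text \<open>The parts of the Turan graph \<open>T\<^sub>p(n)\<close> are the residue classes modulo \<open>p\<close>; their sizes
  differ by at most one (\<open>turan_graph_balanced\<close> below).\<close>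

definition turan_graph :: "nat \<Rightarrow> nat \<Rightarrow> nat graph" where
  "turan_graph p n = ({..<n}, {{u, v} | u v. u < n \<and> v < n \<and> u mod p \<noteq> v mod p})"

definition turan_edges :: "nat \<Rightarrow> nat \<Rightarrow> nat" where
  "turan_edges p n = card (edges (turan_graph p n))"

text \<open>\<open>edge_blowup r H\<close> is \<open>H\<^sup>r\<close>, for \<open>r \<ge> 2\<close>: each edge \<open>e\<close> becomes a clique of order \<open>r\<close> on
  the two ends of \<open>e\<close> and the \<open>r - 2\<close> new vertices \<open>Inr (e, i)\<close>, which carry \<open>e\<close> as a tag so
  that those of different cliques are distinct.\<close>

definition blowup_clique :: "nat \<Rightarrow> 'a set \<Rightarrow> ('a + 'a set \<times> nat) set" where
  "blowup_clique r e = Inl ` e \<union> Inr ` ({e} \<times> {..<r - 2})"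

definition edge_blowup :: "nat \<Rightarrow> 'a graph \<Rightarrow> ('a + 'a set \<times> nat) graph" where
  "edge_blowup r H =
     (Inl ` verts H \<union> (\<Union>e \<in> edges H. blowup_clique r e),
      \<Union>e \<in> edges H. nsets (blowup_clique r e) 2)"

lemma ex_candidates:
  fixes n :: nat and H :: "'b graph"
  assumes "edges H \<noteq> {}"
  defines "A \<equiv> {card (edges G) | G :: nat graph.
     fin_simple_graph G \<and> card (verts G) = n \<and> \<not> contains_copy G H}"
  shows "finite A" and "A \<noteq> {}"
proof -
  have "A \<subseteq> {..n choose 2}"
  proof
    fix k assume "k \<in> A"
    then obtain G :: "nat graph" where G: "k = card (edges G)" "finite (verts G)"
        "edges G \<subseteq> nsets (verts G) 2" "card (verts G) = n"
      unfolding A_def fin_simple_graph_def by blast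
    have "k \<le> card (nsets (verts G) 2)"
      unfolding G(1) by (rule card_mono[OF finite_imp_finite_nsets[OF G(2)] G(3)])
    also have "nsets (verts G) 2 = {B. B \<subseteq> verts G \<and> card B = 2}"
      using G(2) by (auto simp: nsets_def finite_subset)
    also have "card \<dots> = n choose 2" using n_subsets G(2,4) by blast
    finally show "k \<in> {..n choose 2}" by simp
  qed
  then show "finite A" by (rule finite_subset) simp
  have "fin_simple_graph ({..<n}, {}) \<and> card (verts ({..<n}, {} :: nat set set)) = n
      \<and> \<not> contains_copy ({..<n}, {}) H"
    using assms(1) by (auto simp: fin_simple_graph_def contains_copy_def)
  then show "A \<noteq> {}" unfolding A_def by blast
qed

lemma card_residue_class:
  assumes "i < p"
  shows "card {v. v < n \<and> v mod p = i} = n div p + (if i < n mod p then 1 else 0)"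
proof -
  have "{v. v < n \<and> v mod p = i} = (\<lambda>k. k * p + i) ` {..<n div p + (if i < n mod p then 1 else 0)}"
    (is "?L = ?f ` {..<?m}")
  proof -
    have lt: "k * p + i < n \<longleftrightarrow> k < ?m" for k
    proof -
      have n: "n = (n div p) * p + n mod p" by simp
      have r: "n mod p < p" using assms by simp
      consider "k < n div p" | "k = n div p" | "k > n div p" by linarith
      then show ?thesis
      proof cases
        case 1
        then have "Suc k * p \<le> (n div p) * p" by (intro mult_right_mono) auto
        then have "k * p + i < n" using assms n unfolding mult_Suc by linarith
        then show ?thesis using 1 by simp
      next
        case 2
        have "k * p + i < n \<longleftrightarrow> i < n mod p" unfolding 2 using n by linarith
        then show ?thesis using 2 by simp
      next
        case 3
        then have "Suc (n div p) * p \<le> k * p" by (intro mult_right_mono) auto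
        then have "\<not> k * p + i < n" using r n unfolding mult_Suc by linarith
        then show ?thesis using 3 by simp
      qed
    qed
    show ?thesis
    proof (intro set_eqI iffI)
      fix v assume "v \<in> ?L"
      then have v: "v < n" "v = ?f (v div p)"
        using div_mult_mod_eq[of v p] by auto
      from v have "v div p \<in> {..<?m}" using lt[of "v div p"] by (metis lessThan_iff)
      with v(2) show "v \<in> ?f ` {..<?m}" by (rule image_eqI)
    next
      fix v assume "v \<in> ?f ` {..<?m}"
      then obtain k where "k < ?m" and v: "v = k * p + i" by blast
      then have "v < n" using lt by blast
      moreover have "v mod p = i" using v assms by simp
      ultimately show "v \<in> ?L" by simp
    qed
  qed
  moreover have "inj_on ?f {..<?m}" using assms by (auto simp: inj_on_def)
  ultimately show ?thesis by (simp add: card_image)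
qed

lemma turan_graph_balanced:
  assumes "i < p" "j < p"
  shows "card {v \<in> verts (turan_graph p n). v mod p = i}
    \<le> card {v \<in> verts (turan_graph p n). v mod p = j} + 1"
  using assms by (simp add: turan_graph_def card_residue_class)

end

theory Submission
  imports Defs
begin

text \<open>Write \<open>k = t - 1\<close>. A copy of the blow-up of \<open>K\<^sub>s\<^sub>,\<^sub>t\<close> is a system of cliques that meet only in the
  images of the common ends of their edges. If a graph consists of a complete \<open>p\<close>-partite graph and
  a graph \<open>B\<close> inside one part, then every clique contains an edge of \<open>B\<close>, and for \<open>p \<ge> 3\<close> a copy
  exists if and only if \<open>B\<close> contains a vertex split of \<open>K\<^sub>s\<^sub>,\<^sub>t\<close>, a condition that does not mention \<open>p\<close>.
  The constant \<open>c\<close> is the largest gain of a split-free \<open>B\<close> formed by \<open>s - 1\<close> vertices of (almost)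
  full degree and finitely many further edges. It is at least \<open>k\<^sup>2\<close>, by \<open>K\<^sub>t \<union> K\<^sub>t\<^sub>-\<^sub>1\<close>.

  For the upper bound, deleting vertices of small degree reduces to graphs in which every vertex
  has at most \<open>n/p + 1\<close> non-neighbours. There a large complete \<open>p\<close>-partite subgraph is found and
  extended to a partition of all but \<open>s - 1\<close> vertices into \<open>p\<close> nearly independent parts, nearly
  completely joined to each other and to the remaining vertices. A vertex of degree \<open>d\<close> inside its
  part and a matching of size \<open>r\<close> formed by edges inside the other parts, all of whose ends are
  adjacent to that vertex, satisfy \<open>d + r \<le> k\<close>. A graph with matching number \<open>\<nu>\<close> and maximum degree
  \<open>\<Delta>\<close> has at most \<open>\<nu> (\<Delta> + 1)\<close> edges, so edges inside two or more parts gain at most \<open>k\<^sup>2\<close>,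
  while edges inside a single part gain at most \<open>c\<close> by the choice of \<open>c\<close>.\<close>

subsection \<open>Clique systems and vertex splits\<close>

text \<open>The condition \<open>p >= 3\<close> enters because a vertex of \<open>K_{s,t}\<close>
  that is split in \<open>B\<close> must itself sit in another part, and both ends of an edge may be
  split; they then need two different parts besides the one containing \<open>B\<close>. A spare
  part is used once more when exactly two parts contain edges: seen from a third part, their
  matchings together have size at most \<open>k\<close>. The maximum defining \<open>c\<close> is
  taken over a finite window only, from \<open>k * k\<close> to \<open>k * (k + 1)\<close>. The
  upper end is matching number at most \<open>k\<close> times maximum degree at most
  \<open>k\<close> plus one, so any graph beating the formula with edges in a single part produces a
  value in the window. Neither the window nor the values depend on \<open>p\<close>. The obstacle in
  the upper bound is that an absent edge between parts, or at one of the \<open>s - 1\<close>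
  special vertices, relaxes the constraint \<open>d + r <= k\<close>. Hence edges inside parts are
  always weighed against absent pairs, and no absent pair may be charged twice. There is no room for
  a constant factor in the edge bound, which is why the sharp form
  \<open>\<nu> * (\<Delta> + 1)\<close> from Gallai's lemma is used.\<close>

definition bip_verts :: "nat \<Rightarrow> nat \<Rightarrow> (nat + nat) set" where
  "bip_verts s t = Inl ` {..<s} \<union> Inr ` {..<t}"

text \<open>\<open>Inl i\<close> and \<open>Inr j\<close> are the vertices of \<open>K\<^sub>s\<^sub>,\<^sub>t\<close> and \<open>K i j\<close> is assigned to the edge joining them.
  The vertices in \<open>S\<close> are placed by \<open>x\<close>; those outside \<open>S\<close> are split into one copy for each edge.\<close>

definition spread ::
  "nat \<Rightarrow> nat \<Rightarrow> (nat + nat) set \<Rightarrow> (nat + nat \<Rightarrow> 'a) \<Rightarrow> (nat \<Rightarrow> nat \<Rightarrow> 'a set) \<Rightarrow> bool" where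
  "spread s t S x K \<longleftrightarrow> inj_on x S \<and>
     (\<forall>i<s. \<forall>j<t. x ` ({Inl i, Inr j} \<inter> S) \<subseteq> K i j) \<and>
     (\<forall>i<s. \<forall>j<t. \<forall>i'<s. \<forall>j'<t. (i, j) \<noteq> (i', j') \<longrightarrow>
        K i j \<inter> K i' j' \<subseteq> x ` ({Inl i, Inr j} \<inter> {Inl i', Inr j'} \<inter> S))"

text \<open>Vertex splits of \<open>K_{s,t}\<close>, where \<open>b i j\<close> is the image of the
  edge joining \<open>Inl i\<close> and \<open>Inr j\<close>. For a graph \<open>B\<close> the
  extreme choices of \<open>S\<close> are \<open>bip_verts s t\<close>, which gives a copy of
  \<open>K_{s,t}\<close> itself, and \<open>{}\<close>, which gives a matching of
  \<open>s * t\<close> edges.\<close>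

definition split_in :: "nat \<Rightarrow> nat \<Rightarrow> 'a set set \<Rightarrow> bool" where
  "split_in s t B \<longleftrightarrow> (\<exists>S x b. S \<subseteq> bip_verts s t \<and> spread s t S x b \<and> (\<forall>i<s. \<forall>j<t. b i j \<in> B))"

text \<open>A copy of the edge blow-up described by its cliques alone: all vertices of
  \<open>K_{s,t}\<close> are placed, and the new vertices of each clique stay anonymous. This spares
  the later constructions the tagged vertices of \<open>edge_blowup\<close>.\<close>

definition clique_system :: "nat \<Rightarrow> nat \<Rightarrow> nat \<Rightarrow> 'a set set \<Rightarrow> bool" where
  "clique_system r s t E \<longleftrightarrow> (\<exists>x K. spread s t (bip_verts s t) x K \<and>
     (\<forall>i<s. \<forall>j<t. card (K i j) = r \<and> nsets (K i j) 2 \<subseteq> E))"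

lemma spreadD:
  assumes "spread s t S x K"
  shows "inj_on x S"
    and "\<And>i j. i < s \<Longrightarrow> j < t \<Longrightarrow> x ` ({Inl i, Inr j} \<inter> S) \<subseteq> K i j"
    and "\<And>i j i' j'. \<lbrakk>i < s; j < t; i' < s; j' < t; (i, j) \<noteq> (i', j')\<rbrakk> \<Longrightarrow>
        K i j \<inter> K i' j' \<subseteq> x ` ({Inl i, Inr j} \<inter> {Inl i', Inr j'} \<inter> S)"
  using assms unfolding spread_def by simp_all

lemma mem_bip_verts [simp]: "Inl i \<in> bip_verts s t \<longleftrightarrow> i < s" "Inr j \<in> bip_verts s t \<longleftrightarrow> j < t"
  by (auto simp: bip_verts_def)

lemma finite_bip_verts [simp]: "finite (bip_verts s t)"
  by (simp add: bip_verts_def)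

lemma card_bip_verts: "card (bip_verts s t) \<le> s + t"
proof -
  have "card (bip_verts s t) \<le> card (Inl ` {..<s} :: (nat+nat) set) + card (Inr ` {..<t} :: (nat+nat) set)"
    unfolding bip_verts_def by (rule card_Un_le)
  then show ?thesis by (simp add: card_image)
qed

text \<open>A placed vertex lies on some edge of \<open>K_{s,t}\<close>, so \<open>x u\<close>
  belongs to the clique of that edge. If this clique is a different one, the intersection rule gives
  \<open>x u = x u'\<close> for a common end \<open>u'\<close>, and injectivity of \<open>x\<close>
  identifies \<open>u\<close> with \<open>u'\<close>.\<close>

lemma spread_placed_mem:
  assumes sp: "spread s t S x K" and S: "S \<subseteq> bip_verts s t" and ij: "i < s" "j < t"
    and u: "u \<in> S" and mem: "x u \<in> K i j"
  shows "u \<in> {Inl i, Inr j}"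
proof (rule ccontr)
  assume n: "u \<notin> {Inl i, Inr j}"
  obtain i' j' where e: "i' < s" "j' < t" "u \<in> {Inl i', Inr j'}"
    using u S ij by (cases u) auto
  have ne: "(i, j) \<noteq> (i', j')" using n e by auto
  have "x u \<in> K i' j'" using spreadD(2)[OF sp e(1,2)] u e(3) by blast
  then have "x u \<in> x ` ({Inl i, Inr j} \<inter> {Inl i', Inr j'} \<inter> S)"
    using spreadD(3)[OF sp ij e(1,2) ne] mem by blast
  then obtain u' where "x u = x u'" and "u' \<in> {Inl i, Inr j} \<inter> {Inl i', Inr j'} \<inter> S"
    by (rule imageE)
  then have "u' \<in> {Inl i, Inr j}" "u' \<in> S" "x u' = x u" by simp_all
  then have "u' = u" using inj_onD[OF spreadD(1)[OF sp], of u' u] u by simp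
  then show False using n \<open>u' \<in> {Inl i, Inr j}\<close> by simp
qed

lemma image_nsets_2_subset:
  assumes "inj_on f A" "nsets (f ` A) 2 \<subseteq> E" "e \<in> nsets A 2"
  shows "f ` e \<in> E"
proof -
  have "f ` e \<in> nsets (f ` A) 2"
    using assms(1,3) unfolding nsets_def by (auto simp: card_image inj_on_subset)
  then show ?thesis using assms(2) by blast
qed

section \<open>Copies of the blow-up and clique systems\<close>

lemma edges_complete_bipartite:
  "edges (complete_bipartite s t) = (\<Union>i<s. \<Union>j<t. {{Inl i, Inr j}})"
  unfolding complete_bipartite_def snd_conv by blast

lemma verts_edge_blowup:
  "verts (edge_blowup r (complete_bipartite s t)) =
     Inl ` bip_verts s t \<union> (\<Union>i<s. \<Union>j<t. blowup_clique r {Inl i, Inr j})"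
proof -
  have "verts (complete_bipartite s t) = bip_verts s t"
    by (simp add: complete_bipartite_def bip_verts_def)
  then show ?thesis unfolding edge_blowup_def edges_complete_bipartite by simp
qed

lemma edges_edge_blowup:
  "edges (edge_blowup r (complete_bipartite s t)) =
     (\<Union>i<s. \<Union>j<t. nsets (blowup_clique r {Inl i, Inr j}) 2)"
  unfolding edge_blowup_def edges_complete_bipartite by simp

text \<open>The \<open>p - 1\<close> vertices of \<open>K i j\<close> other than its two placed ends
  receive the new vertices of the corresponding edge. Injectivity holds because a vertex shared by
  two cliques is a placed one, and \<open>K i j\<close> contains no placed vertices except its own
  ends.\<close>

lemma clique_system_imp_copy:
  fixes E :: "'a set set"
  assumes E: "E \<subseteq> nsets V 2" and st: "1 \<le> s" "1 \<le> t" and p: "1 \<le> p"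
    and cs: "clique_system (p + 1) s t E"
  shows "contains_copy (V, E) (edge_blowup (p + 1) (complete_bipartite s t))"
proof -
  let ?H = "complete_bipartite s t"
  obtain x K where sp: "spread s t (bip_verts s t) x K"
    and K: "\<And>i j. i < s \<Longrightarrow> j < t \<Longrightarrow> card (K i j) = p + 1 \<and> nsets (K i j) 2 \<subseteq> E"
    using cs unfolding clique_system_def by blast
  have finK: "finite (K i j)" if "i < s" "j < t" for i j
    using K[OF that] by (intro card_ge_0_finite) simp
  have xK: "x (Inl i) \<in> K i j" "x (Inr j) \<in> K i j" if "i < s" "j < t" for i j
    using spreadD(2)[OF sp that] that by auto
  have xne: "x (Inl i) \<noteq> x (Inr j)" if "i < s" "j < t" for i j
    using inj_onD[OF spreadD(1)[OF sp], of "Inl i" "Inr j"] that by auto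
  define R where "R i j = K i j - {x (Inl i), x (Inr j)}" for i j
  have cR: "card (R i j) = p - 1 \<and> finite (R i j)" if "i < s" "j < t" for i j
    using K[OF that] finK[OF that] xK[OF that] xne[OF that]
    unfolding R_def by (simp_all add: card_Diff_subset)
  have "\<exists>g. bij_betw g {..<p - 1} (R i j)" if "i < s" "j < t" for i j
    using cR[OF that] by (metis card_lessThan finite_lessThan finite_same_card_bij)
  then obtain g where g: "\<And>i j. i < s \<Longrightarrow> j < t \<Longrightarrow> bij_betw (g i j) {..<p - 1} (R i j)"
    by metis
  \<comment> \<open>New vertices are tagged by an edge, that is, by an unordered set;
    \<open>ii\<close> and \<open>jj\<close> recover its two indices.\<close>
  define ii where "ii e = (THE i. Inl i \<in> e)" for e :: "(nat+nat) set"
  define jj where "jj e = (THE j. Inr j \<in> e)" for e :: "(nat+nat) set"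
  have [simp]: "ii {Inl i, Inr j} = i" "jj {Inl i, Inr j} = j" for i j
    unfolding ii_def jj_def by auto
  define f where "f v = (case v of Inl u \<Rightarrow> x u | Inr (e, l) \<Rightarrow> g (ii e) (jj e) l)" for v
  have f_simps [simp]: "f (Inl u) = x u" "f (Inr ({Inl i, Inr j}, l)) = g i j l" for u i j l
    unfolding f_def by auto
  let ?Q = "\<lambda>i j. blowup_clique (p + 1) {Inl i, Inr j :: nat + nat}"
  have img: "f ` ?Q i j = K i j" if "i < s" "j < t" for i j
  proof -
    have "f ` ?Q i j = {x (Inl i), x (Inr j)} \<union> g i j ` {..<p - 1}"
      unfolding blowup_clique_def by (auto simp: image_Un image_iff)
    also have "g i j ` {..<p - 1} = R i j" using g[OF that] by (simp add: bij_betw_def)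
    finally show ?thesis using xK[OF that] unfolding R_def by auto
  qed
  have gR: "g i j l \<in> R i j" if "i < s" "j < t" "l < p - 1" for i j l
    using g[OF that(1,2)] that(3) by (auto simp: bij_betw_def)
  have gx: "g i j l \<noteq> x u" if "i < s" "j < t" "l < p - 1" "u \<in> bip_verts s t" for i j l u
  proof
    assume eq: "g i j l = x u"
    then have "x u \<in> K i j" using gR[OF that(1-3)] unfolding R_def by auto
    then have "u \<in> {Inl i, Inr j}"
      using spread_placed_mem[OF sp order_refl that(1,2,4)] by blast
    then show False using gR[OF that(1-3)] eq unfolding R_def by auto
  qed
  have gg: "(i, j, l) = (i', j', l')" if "i < s" "j < t" "l < p - 1" "i' < s" "j' < t" "l' < p - 1"
      "g i j l = g i' j' l'" for i j l i' j' l'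
  proof -
    have "(i, j) = (i', j')"
    proof (rule ccontr)
      assume ne: "(i, j) \<noteq> (i', j')"
      have "g i j l \<in> K i j \<inter> K i' j'" using gR[OF that(1-3)] gR[OF that(4-6)] that(7) unfolding R_def by simp
      then have "\<exists>u\<in>bip_verts s t. g i j l = x u"
        using spreadD(3)[OF sp that(1,2,4,5) ne] by blast
      then show False using gx[OF that(1-3)] by blast
    qed
    moreover have "l = l'"
      using inj_onD[OF bij_betw_imp_inj_on[OF g[OF that(1,2)]], of l l'] that calculation by simp
    ultimately show ?thesis by simp
  qed
  let ?F = "edge_blowup (p + 1) ?H"
  have vF: "v \<in> verts ?F \<longleftrightarrow> (\<exists>u\<in>bip_verts s t. v = Inl u) \<or>
     (\<exists>i<s. \<exists>j<t. \<exists>l<p - 1. v = Inr ({Inl i, Inr j}, l))" for v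
  proof -
    have "v \<in> verts ?F \<longleftrightarrow> v \<in> Inl ` bip_verts s t \<or> (\<exists>i<s. \<exists>j<t. v \<in> ?Q i j)"
      unfolding verts_edge_blowup by blast
    also have "\<dots> \<longleftrightarrow> (\<exists>u\<in>bip_verts s t. v = Inl u) \<or>
       (\<exists>i<s. \<exists>j<t. \<exists>l<p - 1. v = Inr ({Inl i, Inr j}, l))"
      unfolding blowup_clique_def by (cases v) auto
    finally show ?thesis .
  qed
  have inj: "inj_on f (verts ?F)"
  proof (rule inj_onI)
    fix v w assume v: "v \<in> verts ?F" and w: "w \<in> verts ?F" and eq: "f v = f w"
    from v consider (a) u where "u \<in> bip_verts s t" "v = Inl u"
      | (b) i j l where "i < s" "j < t" "l < p - 1" "v = Inr ({Inl i, Inr j}, l)"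
      unfolding vF by blast
    then show "v = w"
    proof cases
      case a
      from w consider (a') u' where "u' \<in> bip_verts s t" "w = Inl u'"
        | (b') i j l where "i < s" "j < t" "l < p - 1" "w = Inr ({Inl i, Inr j}, l)"
        unfolding vF by blast
      then show ?thesis
      proof cases
        case a' then show ?thesis using a eq inj_onD[OF spreadD(1)[OF sp], of u u'] by simp
      next
        case b' then show ?thesis using gx[OF b'(1-3) a(1)] a eq by simp
      qed
    next
      case b
      from w consider (a') u' where "u' \<in> bip_verts s t" "w = Inl u'"
        | (b') i j l where "i < s" "j < t" "l < p - 1" "w = Inr ({Inl i, Inr j}, l)"
        unfolding vF by blast
      then show ?thesis
      proof cases
        case a' then show ?thesis using gx[OF b(1-3) a'(1)] b eq by simp
      next
        case b' then show ?thesis using gg[OF b(1-3) b'(1-3)] b eq by simp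
      qed
    qed
  qed
  \<comment> \<open>A clique has two distinct placed ends, so each of its vertices forms an edge of
    \<open>E\<close> with one of them and therefore lies in \<open>V\<close>.\<close>
  have KV: "K i j \<subseteq> V" if ij: "i < s" "j < t" for i j
  proof
    fix y assume y: "y \<in> K i j"
    obtain z where "z \<in> K i j" "z \<noteq> y" using xK[OF ij] xne[OF ij] by metis
    then have "{y, z} \<in> nsets (K i j) 2" using y by auto
    then have "{y, z} \<in> nsets V 2" using K[OF ij] E by blast
    then show "y \<in> V" by simp
  qed
  have Qsub: "?Q i j \<subseteq> verts ?F" if "i < s" "j < t" for i j
    unfolding verts_edge_blowup using that by blast
  have "f v \<in> V" if vv: "v \<in> verts ?F" for v
  proof -
    have "\<exists>i<s. \<exists>j<t. v \<in> ?Q i j"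
    proof (cases v)
      case (Inl u)
      then have u: "u \<in> bip_verts s t" using that unfolding vF by auto
      show ?thesis
      proof (cases u)
        case (Inl i) with u \<open>v = Inl u\<close> st show ?thesis
          by (intro exI[of _ i] conjI exI[of _ 0]) (auto simp: blowup_clique_def)
      next
        case (Inr j) with u \<open>v = Inl u\<close> st show ?thesis
          by (intro exI[of _ 0] conjI exI[of _ j]) (auto simp: blowup_clique_def)
      qed
    next
      case (Inr q)
      then obtain i j l where "i < s" "j < t" "l < p - 1" "v = Inr ({Inl i, Inr j}, l)"
        using vv unfolding vF by auto
      then show ?thesis by (auto simp: blowup_clique_def)
    qed
    then show ?thesis using img KV by blast
  qed
  moreover have "f ` e \<in> E" if e: "e \<in> edges ?F" for e
  proof -
    obtain i j where ij: "i < s" "j < t" and e': "e \<in> nsets (?Q i j) 2"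
      using e unfolding edges_edge_blowup by blast
    have "inj_on f (?Q i j)" using inj Qsub[OF ij] by (rule inj_on_subset)
    then show ?thesis using image_nsets_2_subset[of f "?Q i j" E e] img[OF ij] K[OF ij] e' by simp
  qed
  ultimately show ?thesis unfolding contains_copy_def using inj by (intro exI[of _ f]) auto
qed

text \<open>The images of the cliques of the blow-up form the system: two of these cliques share
  only old vertices, since their new vertices carry different tags.\<close>

lemma copy_imp_clique_system:
  assumes st: "1 \<le> s" "1 \<le> t" and p: "1 \<le> p"
    and cc: "contains_copy (V, E) (edge_blowup (p + 1) (complete_bipartite s t))"
  shows "clique_system (p + 1) s t E"
proof -
  let ?H = "complete_bipartite s t"
  let ?F = "edge_blowup (p + 1) ?H"
  let ?Q = "\<lambda>i j. blowup_clique (p + 1) {Inl i, Inr j :: nat + nat}"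
  obtain f where inj: "inj_on f (verts ?F)" and fe: "\<And>e. e \<in> edges ?F \<Longrightarrow> f ` e \<in> E"
    using cc unfolding contains_copy_def by auto
  have bv: "Inl ` bip_verts s t \<subseteq> verts ?F" unfolding verts_edge_blowup by blast
  have Qsub: "?Q i j \<subseteq> verts ?F" if "i < s" "j < t" for i j
    unfolding verts_edge_blowup using that by blast
  have Qint: "?Q i j \<inter> ?Q i' j' \<subseteq> Inl ` ({Inl i, Inr j} \<inter> {Inl i', Inr j'})"
    if "(i, j) \<noteq> (i', j')" for i j i' j'
    using that unfolding blowup_clique_def by (auto simp: doubleton_eq_iff)
  define x where "x = f \<circ> Inl"
  define K where "K i j = f ` ?Q i j" for i j
  have "spread s t (bip_verts s t) x K"
    unfolding spread_def
  proof (intro conjI allI impI)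
    show "inj_on x (bip_verts s t)" unfolding x_def
      using inj bv by (intro comp_inj_on) (auto intro: inj_on_subset)
    show "x ` ({Inl i, Inr j} \<inter> bip_verts s t) \<subseteq> K i j" for i j
      unfolding x_def K_def blowup_clique_def by auto
    fix i j i' j' assume ij: "i < s" "j < t" "i' < s" "j' < t" and ne: "(i, j) \<noteq> (i', j')"
    have "K i j \<inter> K i' j' = f ` (?Q i j \<inter> ?Q i' j')"
      unfolding K_def using inj_on_image_Int[OF inj Qsub[OF ij(1,2)] Qsub[OF ij(3,4)]] by simp
    also have "\<dots> \<subseteq> f ` Inl ` ({Inl i, Inr j} \<inter> {Inl i', Inr j'})"
      using Qint[OF ne] by blast
    also have "\<dots> \<subseteq> x ` ({Inl i, Inr j} \<inter> {Inl i', Inr j'} \<inter> bip_verts s t)"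
      unfolding x_def using ij by (auto simp: image_iff)
    finally show "K i j \<inter> K i' j' \<subseteq> x ` ({Inl i, Inr j} \<inter> {Inl i', Inr j'} \<inter> bip_verts s t)" .
  qed
  moreover have "card (K i j) = p + 1 \<and> nsets (K i j) 2 \<subseteq> E" if ij: "i < s" "j < t" for i j
  proof
    have injQ: "inj_on f (?Q i j)" using inj Qsub[OF ij] by (rule inj_on_subset)
    have "card (?Q i j) = card (Inl ` {Inl i, Inr j :: nat + nat} :: ((nat+nat) + (nat+nat) set \<times> nat) set)
       + card (Inr ` ({{Inl i, Inr j}} \<times> {..<p - 1}) :: ((nat+nat) + (nat+nat) set \<times> nat) set)"
      unfolding blowup_clique_def by (subst card_Un_disjoint) auto
    also have "\<dots> = 2 + (p - 1)" by (subst (1 2) card_image) (auto simp: card_cartesian_product)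
    finally show "card (K i j) = p + 1" unfolding K_def using injQ p by (simp add: card_image)
    show "nsets (K i j) 2 \<subseteq> E"
    proof
      fix e assume e: "e \<in> nsets (K i j) 2"
      then obtain u v where uv: "e = {u, v}" "u \<noteq> v" "u \<in> K i j" "v \<in> K i j"
        unfolding nsets_def card_2_iff by auto
      then obtain a b where ab: "a \<in> ?Q i j" "b \<in> ?Q i j" and eab: "u = f a" "v = f b"
        unfolding K_def by blast
      then have "a \<noteq> b" using uv(2) by auto
      with ab have "{a, b} \<in> edges ?F"
        unfolding edges_edge_blowup using ij by force
      then show "e \<in> E" using fe[of "{a, b}"] eab uv(1) by simp
    qed
  qed
  ultimately show ?thesis unfolding clique_system_def by blast
qed

subsection \<open>Greedy embedding\<close>

text \<open>The slots are filled one at a time. A vertex already chosen excludes itself and at most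
  \<open>m\<close> non-neighbours in another part, so fewer than
  \<open>card \<Sigma> * (m + 1)\<close> candidates are lost on top of \<open>X\<close>. Slots with
  equal labels are served by the same part and are not asked to be adjacent.\<close>

lemma greedy_transversal:
  fixes Y :: "nat \<Rightarrow> 'a set" and lab :: "'s \<Rightarrow> nat"
  assumes fin: "finite \<Sigma>" "finite X"
    and cand: "\<And>\<sigma>. \<sigma> \<in> \<Sigma> \<Longrightarrow> Cand \<sigma> \<subseteq> Y (lab \<sigma>)"
    and big: "\<And>\<sigma>. \<sigma> \<in> \<Sigma> \<Longrightarrow> card (Cand \<sigma>) \<ge> card X + card \<Sigma> * (m + 1)"
    and finY: "\<And>\<sigma>. \<sigma> \<in> \<Sigma> \<Longrightarrow> finite (Y (lab \<sigma>))"
    and miss: "\<And>\<sigma> \<tau> y. \<lbrakk>\<sigma> \<in> \<Sigma>; \<tau> \<in> \<Sigma>; lab \<sigma> \<noteq> lab \<tau>; y \<in> Y (lab \<sigma>)\<rbrakk> \<Longrightarrow>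
        card {z \<in> Y (lab \<tau>). {y, z} \<notin> E} \<le> m"
  shows "\<exists>g. inj_on g \<Sigma> \<and> (\<forall>\<sigma>\<in>\<Sigma>. g \<sigma> \<in> Cand \<sigma> - X) \<and>
     (\<forall>\<sigma>\<in>\<Sigma>. \<forall>\<tau>\<in>\<Sigma>. lab \<sigma> \<noteq> lab \<tau> \<longrightarrow> {g \<sigma>, g \<tau>} \<in> E)"
proof -
  have "\<exists>g. inj_on g T \<and> (\<forall>\<sigma>\<in>T. g \<sigma> \<in> Cand \<sigma> - X) \<and>
     (\<forall>\<sigma>\<in>T. \<forall>\<tau>\<in>T. lab \<sigma> \<noteq> lab \<tau> \<longrightarrow> {g \<sigma>, g \<tau>} \<in> E)" if "T \<subseteq> \<Sigma>" for T
    using finite_subset[OF that fin(1)] that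
  proof (induction T rule: finite_induct)
    case empty
    then show ?case by simp
  next
    case (insert \<sigma> T)
    then obtain g where g: "inj_on g T" "\<And>\<tau>. \<tau> \<in> T \<Longrightarrow> g \<tau> \<in> Cand \<tau> - X"
      "\<And>\<rho> \<tau>. \<lbrakk>\<rho> \<in> T; \<tau> \<in> T; lab \<rho> \<noteq> lab \<tau>\<rbrakk> \<Longrightarrow> {g \<rho>, g \<tau>} \<in> E" by auto
    have \<sigma>: "\<sigma> \<in> \<Sigma>" and T: "T \<subseteq> \<Sigma>" using insert.prems by auto
    define D where "D \<tau> = (if lab \<tau> = lab \<sigma> then {} else {z \<in> Y (lab \<sigma>). {g \<tau>, z} \<notin> E})" for \<tau>
    have D: "card (D \<tau>) \<le> m" if "\<tau> \<in> T" for \<tau>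
      using miss[of \<tau> \<sigma> "g \<tau>"] cand[of \<tau>] g(2)[OF that] that T \<sigma> unfolding D_def by auto
    have finD: "finite (D \<tau>)" for \<tau> using finY[OF \<sigma>] unfolding D_def by auto
    let ?bad = "X \<union> (g ` T \<union> (\<Union>\<tau>\<in>T. D \<tau>))"
    have "card ?bad \<le> card X + (card (g ` T) + card (\<Union>\<tau>\<in>T. D \<tau>))"
      by (meson add_left_mono card_Un_le order_trans)
    also have "\<dots> \<le> card X + (card T + card T * m)"
    proof -
      have "card (\<Union>\<tau>\<in>T. D \<tau>) \<le> (\<Sum>\<tau>\<in>T. card (D \<tau>))" by (rule card_UN_le[OF insert.hyps(1)])
      also have "\<dots> \<le> (\<Sum>\<tau>\<in>T. m)" using D by (intro sum_mono)
      finally show ?thesis using card_image_le[OF insert.hyps(1), of g] by simp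
    qed
    also have "\<dots> < card X + card \<Sigma> * (m + 1)"
    proof -
      have "card T < card \<Sigma>" using \<sigma> T insert.hyps(2) fin(1) by (intro psubset_card_mono) auto
      then have "card T * (m + 1) < card \<Sigma> * (m + 1)" by (intro mult_strict_right_mono) auto
      then show ?thesis by simp
    qed
    also have "\<dots> \<le> card (Cand \<sigma>)" by (rule big[OF \<sigma>])
    finally have "\<not> Cand \<sigma> \<subseteq> ?bad"
      using card_mono[of ?bad "Cand \<sigma>"] fin(2) insert.hyps(1) finD by (meson finite_Un finite_UN finite_imageI not_le)
    then obtain z where z: "z \<in> Cand \<sigma>" "z \<notin> X" "z \<notin> g ` T" "\<And>\<tau>. \<tau> \<in> T \<Longrightarrow> z \<notin> D \<tau>" by blast
    have adj: "{g \<tau>, z} \<in> E" if "\<tau> \<in> T" "lab \<tau> \<noteq> lab \<sigma>" for \<tau>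
      using z(4)[OF that(1)] that(2) z(1) cand[OF \<sigma>] unfolding D_def by auto
    let ?g = "g(\<sigma> := z)"
    have eq: "?g \<tau> = g \<tau>" if "\<tau> \<in> T" for \<tau> using that insert.hyps(2) by auto
    have "inj_on ?g (insert \<sigma> T)"
    proof -
      have "inj_on ?g T" using g(1) eq by (simp add: inj_on_def)
      moreover have "?g \<sigma> \<notin> ?g ` (T - {\<sigma>})" using z(3) eq by auto
      ultimately show ?thesis by simp
    qed
    moreover have "\<forall>\<tau>\<in>insert \<sigma> T. ?g \<tau> \<in> Cand \<tau> - X" using g(2) z eq by auto
    moreover have "\<forall>\<rho>\<in>insert \<sigma> T. \<forall>\<tau>\<in>insert \<sigma> T. lab \<rho> \<noteq> lab \<tau> \<longrightarrow> {?g \<rho>, ?g \<tau>} \<in> E"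
    proof (intro ballI impI)
      fix \<rho> \<tau> assume a: "\<rho> \<in> insert \<sigma> T" "\<tau> \<in> insert \<sigma> T" "lab \<rho> \<noteq> lab \<tau>"
      then consider "\<rho> = \<sigma>" "\<tau> \<in> T" | "\<rho> \<in> T" "\<tau> = \<sigma>" | "\<rho> \<in> T" "\<tau> \<in> T" by auto
      then show "{?g \<rho>, ?g \<tau>} \<in> E"
      proof cases
        case 1
        then have "{g \<tau>, z} \<in> E" using adj a by auto
        then show ?thesis using 1 eq by (simp add: insert_commute)
      next
        case 2
        then have "{g \<rho>, z} \<in> E" using adj a by auto
        then show ?thesis using 2 eq by simp
      next
        case 3
        then show ?thesis using g(3) a(3) eq by simp
      qed
    qed
    ultimately show ?case by blast
  qed
  then show ?thesis by blast
qed

text \<open>A bound for the number of vertices that an embedding places or has to avoid.\<close>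

definition slack :: "nat \<Rightarrow> nat \<Rightarrow> nat \<Rightarrow> nat" where
  "slack p s t = s + t + 2 * s * t * (p + 1)"

text \<open>The vertices of the bipartite graph in \<open>S\<close> are already placed by \<open>x\<close> and the cliques are
  prescribed only on the cores \<open>C i j\<close>. Everything else is chosen from the reservoirs \<open>Y l\<close>, one
  vertex in each part of \<open>L i j\<close>; an unplaced vertex \<open>u\<close> is chosen from the part \<open>lu u\<close>.\<close>

lemma clique_system_extend:
  fixes E :: "'a set set" and Y :: "nat \<Rightarrow> 'a set"
  assumes st: "1 \<le> s" "1 \<le> t"
    and S: "S \<subseteq> bip_verts s t"
    and sp: "spread s t S x C"
    and core: "\<And>i j. \<lbrakk>i < s; j < t\<rbrakk> \<Longrightarrow> finite (C i j) \<and> nsets (C i j) 2 \<subseteq> E"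
    and L: "\<And>i j. \<lbrakk>i < s; j < t\<rbrakk> \<Longrightarrow> L i j \<subseteq> {..<p} \<and> card (C i j) + card (L i j) = p + 1"
    and lu: "\<And>i j. \<lbrakk>i < s; j < t; Inl i \<notin> S\<rbrakk> \<Longrightarrow> lu (Inl i) \<in> L i j"
            "\<And>i j. \<lbrakk>i < s; j < t; Inr j \<notin> S\<rbrakk> \<Longrightarrow> lu (Inr j) \<in> L i j"
            "\<And>i j. \<lbrakk>i < s; j < t; Inl i \<notin> S; Inr j \<notin> S\<rbrakk> \<Longrightarrow> lu (Inl i) \<noteq> lu (Inr j)"
    and finY: "\<And>l. l < p \<Longrightarrow> finite (Y l)"
    and miss: "\<And>l l' y. \<lbrakk>l < p; l' < p; l \<noteq> l'; y \<in> Y l\<rbrakk> \<Longrightarrow> card {z \<in> Y l'. {y, z} \<notin> E} \<le> m"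
    and cand: "\<And>i j l. \<lbrakk>i < s; j < t; l \<in> L i j\<rbrakk> \<Longrightarrow>
        card {y \<in> Y l. \<forall>z\<in>C i j. {z, y} \<in> E} \<ge> slack p s t * (m + 1)"
    and candl: "\<And>i. \<lbrakk>i < s; Inl i \<notin> S\<rbrakk> \<Longrightarrow>
        card {y \<in> Y (lu (Inl i)). \<forall>j<t. \<forall>z\<in>C i j. {z, y} \<in> E} \<ge> slack p s t * (m + 1)"
    and candr: "\<And>j. \<lbrakk>j < t; Inr j \<notin> S\<rbrakk> \<Longrightarrow>
        card {y \<in> Y (lu (Inr j)). \<forall>i<s. \<forall>z\<in>C i j. {z, y} \<in> E} \<ge> slack p s t * (m + 1)"
  shows "clique_system (p + 1) s t E"
proof -
  define ends where "ends i j = {Inl i, Inr j :: nat + nat}" for i j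
  \<comment> \<open>There are two kinds of slots. A vertex in \<open>U\<close> is one slot shared by
    all cliques through it. A triple in \<open>Z\<close> is a vertex of the single clique
    \<open>(i, j)\<close> in part \<open>l\<close>, present only if no unplaced end of that edge
    already occupies \<open>l\<close>.\<close>
  define U where "U = bip_verts s t - S"
  define Z where "Z = {((i, j), l). i < s \<and> j < t \<and> l \<in> L i j \<and> l \<notin> lu ` (ends i j - S)}"
  define \<Sigma> where "\<Sigma> = Inl ` U \<union> Inr ` Z"
  define X where "X = (\<Union>i<s. \<Union>j<t. C i j)"
  define lab :: "(nat + nat) + ((nat \<times> nat) \<times> nat) \<Rightarrow> nat"
    where "lab \<sigma> = (case \<sigma> of Inl u \<Rightarrow> lu u | Inr q \<Rightarrow> snd q)" for \<sigma>
  \<comment> \<open>A shared slot must be joined to the cores of all cliques through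
    \<open>u\<close>, a private one only to the core of its own clique.\<close>
  define Cand where "Cand \<sigma> = (case \<sigma> of
      Inl u \<Rightarrow> {y \<in> Y (lu u). \<forall>i<s. \<forall>j<t. u \<in> ends i j \<longrightarrow> (\<forall>z\<in>C i j. {z, y} \<in> E)}
    | Inr q \<Rightarrow> {y \<in> Y (snd q). \<forall>z\<in>C (fst (fst q)) (snd (fst q)). {z, y} \<in> E})" for \<sigma>
  have finL: "finite (L i j)" "card (L i j) \<le> p + 1" if "i < s" "j < t" for i j
    using L[OF that] by (auto intro: finite_subset)
  have Zsub: "Z \<subseteq> ({..<s} \<times> {..<t}) \<times> {..<p}" unfolding Z_def using L by fastforce
  have finZ: "finite Z" using Zsub by (rule finite_subset) simp
  have finU: "finite U" unfolding U_def by simp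
  have fin\<Sigma>: "finite \<Sigma>" unfolding \<Sigma>_def using finZ finU by simp
  have finX: "finite X" unfolding X_def using core by blast
  have cX: "card X \<le> s * t * (p + 1)"
  proof -
    have "card X \<le> (\<Sum>i<s. card (\<Union>j<t. C i j))" unfolding X_def by (rule card_UN_le) simp
    also have "\<dots> \<le> (\<Sum>i<s. \<Sum>j<t. card (C i j))" by (intro sum_mono card_UN_le) simp
    also have "\<dots> \<le> (\<Sum>i<s. \<Sum>j<t. p + 1)"
    proof (intro sum_mono)
      fix i j assume "i \<in> {..<s}" "j \<in> {..<t}"
      then show "card (C i j) \<le> p + 1" using L[of i j] by simp
    qed
    also have "\<dots> = s * t * (p + 1)" by (simp add: algebra_simps)
    finally show ?thesis .
  qed
  have c\<Sigma>: "card \<Sigma> \<le> s + t + s * t * (p + 1)"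
  proof -
    have "card \<Sigma> \<le> card U + card Z" unfolding \<Sigma>_def
      by (metis card_Un_le card_image inj_Inl inj_Inr)
    moreover have "card U \<le> s + t" unfolding U_def
      by (metis card_bip_verts card_mono Diff_subset finite_bip_verts order_trans)
    moreover have "card Z \<le> s * t * p"
      using card_mono[OF _ Zsub] by (simp add: card_cartesian_product)
    moreover have "s * t * p \<le> s * t * (p + 1)" by simp
    ultimately show ?thesis by linarith
  qed
  have bigenough: "card X + card \<Sigma> * (m + 1) \<le> slack p s t * (m + 1)"
  proof -
    have "card X + card \<Sigma> * (m + 1) \<le> card X * (m + 1) + card \<Sigma> * (m + 1)" by simp
    also have "\<dots> = (card X + card \<Sigma>) * (m + 1)" by (simp add: algebra_simps)
    also have "\<dots> \<le> slack p s t * (m + 1)"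
    proof (rule mult_right_mono)
      show "card X + card \<Sigma> \<le> slack p s t" using cX c\<Sigma> unfolding slack_def by (simp add: algebra_simps)
    qed simp
    finally show ?thesis .
  qed
  have labp: "lab \<sigma> < p" if "\<sigma> \<in> \<Sigma>" for \<sigma>
  proof (cases \<sigma>)
    case (Inr q) then show ?thesis using that Zsub unfolding \<Sigma>_def lab_def by auto
  next
    case (Inl u)
    then have u: "u \<in> bip_verts s t" "u \<notin> S" using that unfolding \<Sigma>_def U_def by auto
    show ?thesis
    proof (cases u)
      case (Inl i)
      then have "lu u \<in> L i 0" using lu(1)[of i 0] u st by simp
      then show ?thesis using L[of i 0] Inl u st \<open>\<sigma> = Inl u\<close> unfolding lab_def by auto
    next
      case (Inr j)
      then have "lu u \<in> L 0 j" using lu(2)[of 0 j] u st by simp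
      then show ?thesis using L[of 0 j] Inr u st \<open>\<sigma> = Inl u\<close> unfolding lab_def by auto
    qed
  qed
  have "\<exists>g. inj_on g \<Sigma> \<and> (\<forall>\<sigma>\<in>\<Sigma>. g \<sigma> \<in> Cand \<sigma> - X) \<and>
     (\<forall>\<sigma>\<in>\<Sigma>. \<forall>\<tau>\<in>\<Sigma>. lab \<sigma> \<noteq> lab \<tau> \<longrightarrow> {g \<sigma>, g \<tau>} \<in> E)"
  proof (rule greedy_transversal[OF fin\<Sigma> finX])
    show "Cand \<sigma> \<subseteq> Y (lab \<sigma>)" if "\<sigma> \<in> \<Sigma>" for \<sigma>
      unfolding Cand_def lab_def by (auto split: sum.splits)
    show "finite (Y (lab \<sigma>))" if "\<sigma> \<in> \<Sigma>" for \<sigma> using finY labp[OF that] by blast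
    show "card {z \<in> Y (lab \<tau>). {y, z} \<notin> E} \<le> m"
      if "\<sigma> \<in> \<Sigma>" "\<tau> \<in> \<Sigma>" "lab \<sigma> \<noteq> lab \<tau>" "y \<in> Y (lab \<sigma>)" for \<sigma> \<tau> y
      using miss labp that by blast
    show "card X + card \<Sigma> * (m + 1) \<le> card (Cand \<sigma>)" if \<sigma>: "\<sigma> \<in> \<Sigma>" for \<sigma>
    proof -
      have "slack p s t * (m + 1) \<le> card (Cand \<sigma>)"
      proof (cases \<sigma>)
        case (Inr q)
        then obtain i j l where "q = ((i, j), l)" "i < s" "j < t" "l \<in> L i j"
          using \<sigma> unfolding \<Sigma>_def Z_def by auto
        then show ?thesis using cand[of i j l] Inr unfolding Cand_def by simp
      next
        case (Inl u)
        then have u: "u \<in> bip_verts s t" "u \<notin> S" using \<sigma> unfolding \<Sigma>_def U_def by auto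
        show ?thesis
        proof (cases u)
          case (Inl i)
          then have "Cand \<sigma> = {y \<in> Y (lu (Inl i)). \<forall>j<t. \<forall>z\<in>C i j. {z, y} \<in> E}"
            using u \<open>\<sigma> = Inl u\<close> unfolding Cand_def ends_def by auto
          then show ?thesis using candl[of i] u Inl by simp
        next
          case (Inr j)
          then have "Cand \<sigma> = {y \<in> Y (lu (Inr j)). \<forall>i<s. \<forall>z\<in>C i j. {z, y} \<in> E}"
            using u \<open>\<sigma> = Inl u\<close> unfolding Cand_def ends_def by auto
          then show ?thesis using candr[of j] u Inr by simp
        qed
      qed
      then show ?thesis using bigenough by linarith
    qed
  qed
  then obtain g where g: "inj_on g \<Sigma>" "\<And>\<sigma>. \<sigma> \<in> \<Sigma> \<Longrightarrow> g \<sigma> \<in> Cand \<sigma>" "\<And>\<sigma>. \<sigma> \<in> \<Sigma> \<Longrightarrow> g \<sigma> \<notin> X"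
    "\<And>\<sigma> \<tau>. \<lbrakk>\<sigma> \<in> \<Sigma>; \<tau> \<in> \<Sigma>; lab \<sigma> \<noteq> lab \<tau>\<rbrakk> \<Longrightarrow> {g \<sigma>, g \<tau>} \<in> E" by blast
  \<comment> \<open>The slots of the clique \<open>(i, j)\<close>. Their labels run through
    \<open>L i j\<close> without repetition, so the chosen vertices are pairwise adjacent and have
    the right number.\<close>
  define sl where "sl i j = Inl ` (ends i j - S) \<union>
      Inr ` {((i, j), l) | l. l \<in> L i j \<and> l \<notin> lu ` (ends i j - S)}" for i j
  define x' where "x' u = (if u \<in> S then x u else g (Inl u))" for u
  define K where "K i j = C i j \<union> g ` sl i j" for i j
  have sl\<Sigma>: "sl i j \<subseteq> \<Sigma>" if "i < s" "j < t" for i j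
    using that unfolding sl_def \<Sigma>_def U_def Z_def ends_def by auto
  have labsl: "inj_on lab (sl i j)" "lab ` sl i j = L i j" if ij: "i < s" "j < t" for i j
  proof -
    have luL: "lu ` (ends i j - S) \<subseteq> L i j" using lu(1,2)[OF ij] unfolding ends_def by auto
    have "inj_on lu (ends i j - S)" using lu(3)[OF ij] unfolding ends_def inj_on_def by auto
    then show "inj_on lab (sl i j)" unfolding sl_def lab_def inj_on_def by auto
    have "lab ` sl i j = lu ` (ends i j - S) \<union> {l \<in> L i j. l \<notin> lu ` (ends i j - S)}"
    proof -
      have "lab ` Inl ` (ends i j - S) = lu ` (ends i j - S)"
        unfolding lab_def by (simp add: image_image)
      moreover have "lab ` Inr ` {((i, j), l) | l. l \<in> L i j \<and> l \<notin> lu ` (ends i j - S)} =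
          {l \<in> L i j. l \<notin> lu ` (ends i j - S)}"
        unfolding lab_def by (force simp: image_image image_def)
      ultimately show ?thesis unfolding sl_def image_Un by simp
    qed
    then show "lab ` sl i j = L i j" using luL by auto
  qed
  have gadj: "{z, g \<sigma>} \<in> E" if ij: "i < s" "j < t" and \<sigma>: "\<sigma> \<in> sl i j" and z: "z \<in> C i j" for i j \<sigma> z
  proof -
    have "g \<sigma> \<in> Cand \<sigma>" using g(2) sl\<Sigma>[OF ij] \<sigma> by blast
    then show ?thesis using \<sigma> ij z unfolding sl_def Cand_def by auto
  qed
  have CX: "C i j \<subseteq> X" if "i < s" "j < t" for i j using that unfolding X_def by blast
  have xX: "x u \<in> X" if "u \<in> S" for u
  proof -
    have "\<exists>i<s. \<exists>j<t. u \<in> ends i j"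
    proof (cases u)
      case (Inl i) then show ?thesis using that S st by (intro exI[of _ i] conjI exI[of _ 0]) (auto simp: ends_def)
    next
      case (Inr j) then show ?thesis using that S st by (intro exI[of _ 0] conjI exI[of _ j]) (auto simp: ends_def)
    qed
    then show ?thesis using spreadD(2)[OF sp] CX that unfolding ends_def by blast
  qed
  have cl: "card (K i j) = p + 1 \<and> nsets (K i j) 2 \<subseteq> E" if ij: "i < s" "j < t" for i j
  proof
    have fs: "finite (sl i j)" using sl\<Sigma>[OF ij] fin\<Sigma> by (rule finite_subset)
    have "C i j \<inter> g ` sl i j = {}" using g(3) sl\<Sigma>[OF ij] CX[OF ij] by blast
    then have "card (K i j) = card (C i j) + card (g ` sl i j)"
      unfolding K_def using core[OF ij] fs by (intro card_Un_disjoint) auto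
    also have "card (g ` sl i j) = card (sl i j)"
      using inj_on_subset[OF g(1) sl\<Sigma>[OF ij]] by (rule card_image)
    also have "\<dots> = card (L i j)" using card_image[OF labsl(1)[OF ij]] labsl(2)[OF ij] by simp
    finally show "card (K i j) = p + 1" using L[OF ij] by simp
    show "nsets (K i j) 2 \<subseteq> E"
    proof
      fix e assume "e \<in> nsets (K i j) 2"
      then obtain u v where e: "e = {u, v}" "u \<noteq> v" "u \<in> K i j" "v \<in> K i j"
        unfolding nsets_def card_2_iff by auto
      consider "u \<in> C i j" "v \<in> C i j" | \<sigma> where "u \<in> C i j" "\<sigma> \<in> sl i j" "v = g \<sigma>"
        | \<sigma> where "v \<in> C i j" "\<sigma> \<in> sl i j" "u = g \<sigma>"
        | \<sigma> \<tau> where "\<sigma> \<in> sl i j" "u = g \<sigma>" "\<tau> \<in> sl i j" "v = g \<tau>"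
        using e(3,4) unfolding K_def by blast
      then show "e \<in> E"
      proof cases
        case 1
        then have "{u, v} \<in> nsets (C i j) 2" using e by simp
        then show ?thesis using core[OF ij] e by blast
      next
        case 2 then show ?thesis using gadj[OF ij] e by simp
      next
        case 3 then show ?thesis using gadj[OF ij] e by (simp add: insert_commute)
      next
        case 4
        then have "\<sigma> \<noteq> \<tau>" using e by auto
        then have "lab \<sigma> \<noteq> lab \<tau>" using labsl(1)[OF ij] 4 by (auto dest: inj_onD)
        then show ?thesis using g(4) 4 sl\<Sigma>[OF ij] e by blast
      qed
    qed
  qed
  have "spread s t (bip_verts s t) x' K"
    unfolding spread_def
  proof (intro conjI allI impI)
    show "inj_on x' (bip_verts s t)"
    proof (rule inj_onI)
      fix u v assume uv: "u \<in> bip_verts s t" "v \<in> bip_verts s t" "x' u = x' v"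
      have \<Sigma>I: "Inl w \<in> \<Sigma>" if "w \<in> bip_verts s t" "w \<notin> S" for w
        using that unfolding \<Sigma>_def U_def by auto
      show "u = v"
      proof (cases "u \<in> S"; cases "v \<in> S")
        assume "u \<in> S" "v \<in> S" then show ?thesis using uv spreadD(1)[OF sp] unfolding x'_def by (auto dest: inj_onD)
      next
        assume "u \<in> S" "v \<notin> S" then show ?thesis using uv g(3)[OF \<Sigma>I[of v]] xX[of u] unfolding x'_def by auto
      next
        assume "u \<notin> S" "v \<in> S" then show ?thesis using uv g(3)[OF \<Sigma>I[of u]] xX[of v] unfolding x'_def by auto
      next
        assume "u \<notin> S" "v \<notin> S" then show ?thesis
          using uv inj_onD[OF g(1), of "Inl u" "Inl v"] \<Sigma>I unfolding x'_def by auto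
      qed
    qed
    show "x' ` ({Inl i, Inr j} \<inter> bip_verts s t) \<subseteq> K i j" if ij: "i < s" "j < t" for i j
    proof
      fix y assume "y \<in> x' ` ({Inl i, Inr j} \<inter> bip_verts s t)"
      then obtain u where u: "u \<in> ends i j" "y = x' u" unfolding ends_def by blast
      show "y \<in> K i j"
      proof (cases "u \<in> S")
        case True
        then show ?thesis using spreadD(2)[OF sp ij] u unfolding K_def x'_def ends_def by auto
      next
        case False
        then have "Inl u \<in> sl i j" using u unfolding sl_def by auto
        then show ?thesis using False u unfolding K_def x'_def by auto
      qed
    qed
    fix i j i' j' assume ij: "i < s" "j < t" "i' < s" "j' < t" and ne: "(i, j) \<noteq> (i', j')"
    show "K i j \<inter> K i' j' \<subseteq> x' ` ({Inl i, Inr j} \<inter> {Inl i', Inr j'} \<inter> bip_verts s t)"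
    proof
      fix y assume y: "y \<in> K i j \<inter> K i' j'"
      have CCX: "C i j \<subseteq> X" "C i' j' \<subseteq> X" using CX ij by auto
      have gX: "g \<sigma> \<notin> X" if "\<sigma> \<in> sl i j \<union> sl i' j'" for \<sigma>
        using g(3) sl\<Sigma>[OF ij(1,2)] sl\<Sigma>[OF ij(3,4)] that by blast
      \<comment> \<open>Cores lie in \<open>X\<close> and chosen vertices avoid \<open>X\<close>. A
        common vertex of two cliques therefore lies in both cores or fills a slot of both, and a
        slot of two different cliques is a shared one.\<close>
      have "(y \<in> C i j \<and> y \<in> C i' j') \<or> (\<exists>\<sigma>\<in>sl i j. \<exists>\<tau>\<in>sl i' j'. y = g \<sigma> \<and> y = g \<tau>)"
        using y gX CCX unfolding K_def by blast
      then show "y \<in> x' ` ({Inl i, Inr j} \<inter> {Inl i', Inr j'} \<inter> bip_verts s t)"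
      proof
        assume "y \<in> C i j \<and> y \<in> C i' j'"
        then have "y \<in> x ` ({Inl i, Inr j} \<inter> {Inl i', Inr j'} \<inter> S)"
          using spreadD(3)[OF sp ij ne] by blast
        then obtain u where "y = x u" and "u \<in> {Inl i, Inr j} \<inter> {Inl i', Inr j'} \<inter> S"
          by (rule imageE)
        then show ?thesis using S unfolding x'_def by (intro image_eqI[of _ _ u]) auto
      next
        assume "\<exists>\<sigma>\<in>sl i j. \<exists>\<tau>\<in>sl i' j'. y = g \<sigma> \<and> y = g \<tau>"
        then obtain \<sigma> \<tau> where \<sigma>\<tau>: "\<sigma> \<in> sl i j" "\<tau> \<in> sl i' j'" "y = g \<sigma>" "y = g \<tau>" by blast
        then have "\<sigma> = \<tau>" using g(1) sl\<Sigma> ij by (metis inj_onD subsetD)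
        then obtain u where u: "\<sigma> = Inl u" "u \<in> ends i j" "u \<in> ends i' j'" "u \<notin> S"
          using \<sigma>\<tau>(1,2) ne unfolding sl_def by auto
        then have "u \<in> bip_verts s t" using ij unfolding ends_def by auto
        then show ?thesis using u \<sigma>\<tau>(3) unfolding x'_def ends_def by (intro image_eqI[of _ _ u]) auto
      qed
    qed
  qed
  then show ?thesis unfolding clique_system_def using cl by blast
qed

subsection \<open>Matching number, maximum degree and number of edges\<close>

definition matching :: "'a set set \<Rightarrow> bool" where
  "matching M \<longleftrightarrow> (\<forall>e\<in>M. \<forall>f\<in>M. e \<noteq> f \<longrightarrow> e \<inter> f = {})"

lemma matchingD: "\<lbrakk>matching M; e \<in> M; f \<in> M; z \<in> e; z \<in> f\<rbrakk> \<Longrightarrow> e = f"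
  unfolding matching_def by blast

lemma matching_subset: "\<lbrakk>matching M; N \<subseteq> M\<rbrakk> \<Longrightarrow> matching N"
  unfolding matching_def by blast

lemma card_Union_matching:
  assumes "matching M" "\<And>e. e \<in> M \<Longrightarrow> card e = 2" "finite M"
  shows "card (\<Union>M) = 2 * card M"
proof -
  have "card (\<Union>M) = (\<Sum>e\<in>M. card e)"
    using assms unfolding matching_def
    by (intro card_Union_disjoint) (auto simp: pairwise_def disjnt_def intro: card_ge_0_finite)
  also have "\<dots> = 2 * card M" using assms(2) by simp
  finally show ?thesis .
qed

definition is_max_matching :: "'a set set \<Rightarrow> 'a set set \<Rightarrow> bool" where
  "is_max_matching J M \<longleftrightarrow> M \<subseteq> J \<and> matching M \<and> (\<forall>N. N \<subseteq> J \<and> matching N \<longrightarrow> card N \<le> card M)"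

lemma ex_max_matching:
  assumes "finite J"
  shows "\<exists>M. is_max_matching J M"
proof -
  let ?A = "{M. M \<subseteq> J \<and> matching M}"
  have fin: "finite (card ` ?A)" using assms by simp
  have "{} \<in> ?A" by (simp add: matching_def)
  then have "card ` ?A \<noteq> {}" by blast
  then have "Max (card ` ?A) \<in> card ` ?A" using fin by (intro Max_in)
  then obtain M where M: "M \<in> ?A" "card M = Max (card ` ?A)" by auto
  have "card N \<le> card M" if "N \<subseteq> J" "matching N" for N
    unfolding M(2) using fin that by (intro Max_ge) auto
  then show ?thesis unfolding is_max_matching_def using M(1) by blast
qed

text \<open>Gallai's lemma: if no maximum matching misses both \<open>u\<close> and \<open>w\<close>, and none misses both \<open>w\<close> and
  \<open>v\<close>, then none misses both \<open>u\<close> and \<open>v\<close>. Switching \<open>M\<close> and \<open>N\<close> on the component of \<open>w\<close> in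
  \<open>M \<union> N\<close> shows that \<open>u\<close> and \<open>v\<close> lie in it, too many vertices of degree at most one for a path.
  The component is found as a set that is maximal among those spanning at least as many edges as a
  tree would.\<close>

lemma gallai_transfer:
  assumes finJ: "finite J" and J2: "\<And>e. e \<in> J \<Longrightarrow> card e = 2"
    and M: "is_max_matching J M" "u \<notin> \<Union>M" "v \<notin> \<Union>M"
    and N: "is_max_matching J N" "w \<notin> \<Union>N"
    and dist: "u \<noteq> v"
  shows "(\<exists>M'. is_max_matching J M' \<and> w \<notin> \<Union>M' \<and> u \<notin> \<Union>M') \<or>
         (\<exists>M'. is_max_matching J M' \<and> w \<notin> \<Union>M' \<and> v \<notin> \<Union>M')"
proof (rule ccontr)
  assume neg: "\<not> ?thesis"
  have MJ: "M \<subseteq> J" "matching M" and NJ: "N \<subseteq> J" "matching N"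
    using M(1) N(1) unfolding is_max_matching_def by auto
  have cMN: "card M = card N" using M(1) N(1) unfolding is_max_matching_def by (meson le_antisym)
  have finM: "finite M" "finite N" using MJ NJ finJ by (auto intro: finite_subset)
  let ?V = "insert w (\<Union>J)"
  have finV: "finite ?V" using finJ J2 by (auto intro!: finite_Union intro: card_ge_0_finite)
  define ins where "ins X A = {e \<in> A. e \<subseteq> X}" for X :: "'a set" and A
  \<comment> \<open>Connectedness without paths: \<open>X\<close> spans at least
    \<open>card X - 1\<close> edges of \<open>M \<union> N\<close>. A largest such set around
    \<open>w\<close> plays the role of the component.\<close>
  define P where "P X \<longleftrightarrow> w \<in> X \<and> X \<subseteq> ?V \<and> card X \<le> card (ins X (M \<union> N)) + 1" for X
  have "P {w}" by (simp add: P_def)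
  moreover have "\<forall>X. P X \<longrightarrow> card X \<le> card ?V" unfolding P_def using finV by (auto intro: card_mono)
  ultimately have "\<exists>X. P X \<and> (\<forall>Y. P Y \<longrightarrow> card Y \<le> card X)" by (intro ex_has_greatest_nat[of P "{w}" card "card ?V + 1"]) (auto simp: less_Suc_eq_le)
  then obtain X where PX: "P X" and maxX: "\<And>Y. P Y \<Longrightarrow> card Y \<le> card X" by blast
  have X: "w \<in> X" "X \<subseteq> ?V" "card X \<le> card (ins X (M \<union> N)) + 1" using PX by (auto simp: P_def)
  have finX: "finite X" using X finV finite_subset by blast
  \<comment> \<open>An edge leaving \<open>X\<close> would add one vertex and at least one spanned
    edge, contradicting maximality.\<close>
  have closed: "e \<subseteq> X" if e: "e \<in> M \<union> N" "e \<inter> X \<noteq> {}" for e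
  proof (rule ccontr)
    assume "\<not> e \<subseteq> X"
    have "card e = 2" using e MJ NJ J2 by blast
    then obtain a b where ab: "e = {a, b}" "a \<noteq> b" by (auto simp: card_2_iff)
    then obtain c d where cd: "e = {c, d}" "c \<in> X" "d \<notin> X"
      using e(2) \<open>\<not> e \<subseteq> X\<close> by blast
    let ?Y = "insert d X"
    have "d \<in> ?V" using cd e MJ NJ by blast
    have "insert e (ins X (M \<union> N)) \<subseteq> ins ?Y (M \<union> N)" unfolding ins_def using cd e by auto
    then have "card (insert e (ins X (M \<union> N))) \<le> card (ins ?Y (M \<union> N))"
      using finM unfolding ins_def by (intro card_mono) auto
    moreover have "e \<notin> ins X (M \<union> N)" unfolding ins_def using cd by auto
    moreover have "finite (ins X (M \<union> N))" unfolding ins_def using finM by simp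
    ultimately have "card (ins X (M \<union> N)) + 1 \<le> card (ins ?Y (M \<union> N))" by simp
    then have "P ?Y" unfolding P_def using X \<open>d \<in> ?V\<close> cd finX by simp
    then have "card ?Y \<le> card X" by (rule maxX)
    then show False using cd finX by simp
  qed
  \<comment> \<open>\<open>sw A B\<close> replaces the edges of \<open>A\<close> inside
    \<open>X\<close> by those of \<open>B\<close>. As neither exchange can enlarge a maximum
    matching, \<open>M\<close> and \<open>N\<close> have equally many edges inside \<open>X\<close>,
    and \<open>sw M N\<close> is again maximum.\<close>
  define sw where "sw A B = (A - ins X A) \<union> ins X B" for A B :: "'a set set"
  have sw_matching: "matching (sw A B)" if AB: "matching A" "matching B" "A \<subseteq> M \<union> N" "B \<subseteq> M \<union> N" for A B
  proof -
    have "e = f" if ef: "e \<in> sw A B" "f \<in> sw A B" "z \<in> e" "z \<in> f" for e f z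
    proof -
      have out: "g \<inter> X = {}" if "g \<in> A - ins X A" for g
        using closed[of g] that \<open>A \<subseteq> M \<union> N\<close> unfolding ins_def by blast
      consider "e \<in> A" "f \<in> A" | "e \<in> B" "f \<in> B" | "e \<inter> X = {}" "f \<subseteq> X" | "f \<inter> X = {}" "e \<subseteq> X"
        using ef(1,2) out unfolding sw_def ins_def by blast
      then show ?thesis
      proof cases
        case 1 then show ?thesis using matchingD[OF AB(1)] ef by blast
      next
        case 2 then show ?thesis using matchingD[OF AB(2)] ef by blast
      qed (use ef in blast)+
    qed
    then show ?thesis unfolding matching_def by blast
  qed
  have sw_card: "card (sw A B) + card (ins X A) = card A + card (ins X B)" if "finite A" "finite B" "A \<subseteq> M \<union> N"
    for A B
  proof -
    have "e \<notin> ins X B" if "e \<in> A - ins X A" for e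
      using that unfolding ins_def by blast
    then have "card (sw A B) = card (A - ins X A) + card (ins X B)"
      unfolding sw_def using that by (intro card_Un_disjoint) (auto simp: ins_def)
    moreover have "card A = card (A - ins X A) + card (ins X A)"
      using that by (simp add: card_Diff_subset ins_def card_mono)
    ultimately show ?thesis by simp
  qed
  have swJ: "sw M N \<subseteq> J" "sw N M \<subseteq> J" using MJ NJ unfolding sw_def ins_def by auto
  have m1: "matching (sw M N)" "matching (sw N M)" using sw_matching MJ NJ by auto
  have le: "card (sw M N) \<le> card M" "card (sw N M) \<le> card N"
    using M(1) N(1) swJ m1 unfolding is_max_matching_def by auto
  have inseq: "card (ins X M) = card (ins X N)"
    using sw_card[of M N] sw_card[of N M] le finM by simp
  then have "card (sw M N) = card M" using sw_card[of M N] finM by simp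
  then have maxsw: "is_max_matching J (sw M N)"
    using M(1) swJ m1 unfolding is_max_matching_def by simp
  have wX: "w \<in> X" using X by blast
  have "w \<notin> \<Union>(sw M N)" using N(2) wX closed unfolding sw_def ins_def by blast
  \<comment> \<open>A maximum matching that misses \<open>w\<close> has to cover \<open>u\<close>
    and \<open>v\<close>, by the assumption to be refuted. Since \<open>M\<close> misses both, they
    are covered by edges of \<open>N\<close> inside \<open>X\<close>.\<close>
  then have "u \<in> \<Union>(sw M N)" "v \<in> \<Union>(sw M N)" using neg maxsw by blast+
  then have uvX: "u \<in> X" "v \<in> X" using M(2,3) unfolding sw_def ins_def by blast+
  have c2: "card (\<Union>(ins X A)) = 2 * card (ins X A)" if "matching A" "finite A" "A \<subseteq> J" for A
    using that J2 by (intro card_Union_matching) (auto simp: ins_def matching_def)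
  have "\<Union>(ins X M) \<subseteq> X - {u, v}" using M(2,3) unfolding ins_def by blast
  then have "card (\<Union>(ins X M)) \<le> card (X - {u, v})" using finX by (intro card_mono) auto
  also have "\<dots> = card X - 2" using uvX dist finX by (simp add: card_Diff_subset)
  finally have a: "2 * card (ins X M) \<le> card X - 2" using c2 MJ finM by simp
  have "\<Union>(ins X N) \<subseteq> X - {w}" using N(2) unfolding ins_def by blast
  then have "card (\<Union>(ins X N)) \<le> card (X - {w})" using finX by (intro card_mono) auto
  also have "\<dots> = card X - 1" using wX finX by simp
  finally have b: "2 * card (ins X N) \<le> card X - 1" using c2 NJ finM by simp
  have "ins X (M \<union> N) = ins X M \<union> ins X N" unfolding ins_def by blast
  then have "card (ins X (M \<union> N)) \<le> card (ins X M) + card (ins X N)" by (simp add: card_Un_le)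
  then have c: "card X \<le> card (ins X M) + card (ins X N) + 1" using X by linarith
  have "card X \<ge> 2" using uvX dist finX by (metis card_2_iff card_mono empty_subsetI insert_subset)
  \<comment> \<open>\<open>M\<close> misses two vertices of \<open>X\<close> and \<open>N\<close>
    misses one, so together they have at most \<open>card X - 3 / 2\<close> edges inside
    \<open>X\<close>, fewer than a spanning tree.\<close>
  then show False using a b c by linarith
qed

definition mnum :: "'a set set \<Rightarrow> nat" where
  "mnum J = Max (card ` {M. M \<subseteq> J \<and> matching M})"

lemma mnum_props:
  assumes "finite J"
  shows "\<And>M. \<lbrakk>M \<subseteq> J; matching M\<rbrakk> \<Longrightarrow> card M \<le> mnum J"
    and "\<exists>M. M \<subseteq> J \<and> matching M \<and> card M = mnum J"
    and "is_max_matching J M \<Longrightarrow> card M = mnum J"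
proof -
  let ?A = "{M. M \<subseteq> J \<and> matching M}"
  have fin: "finite (card ` ?A)" using assms by simp
  have "{} \<in> ?A" by (simp add: matching_def)
  then have "card ` ?A \<noteq> {}" by blast
  then have "Max (card ` ?A) \<in> card ` ?A" using fin by (intro Max_in)
  then show ex: "\<exists>M. M \<subseteq> J \<and> matching M \<and> card M = mnum J" unfolding mnum_def by auto
  show le: "card M \<le> mnum J" if "M \<subseteq> J" "matching M" for M
    unfolding mnum_def using fin that by (intro Max_ge) auto
  show "card M = mnum J" if "is_max_matching J M"
    using that ex le unfolding is_max_matching_def by (metis le_antisym)
qed

lemma card_edges_le_degree:
  assumes "finite J" "\<And>e. e \<in> J \<Longrightarrow> card e = 2" "\<And>e. e \<in> J \<Longrightarrow> e \<subseteq> C" "finite C"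
    and "\<And>v. v \<in> C \<Longrightarrow> card {e \<in> J. v \<in> e} \<le> d"
  shows "2 * card J \<le> card C * d"
proof -
  have "2 * card J = (\<Sum>e\<in>J. card e)" using assms(2) by simp
  also have "\<dots> = (\<Sum>e\<in>J. card {v \<in> C. v \<in> e})"
  proof (rule sum.cong)
    fix e assume "e \<in> J"
    then have "{v \<in> C. v \<in> e} = e" using assms(3) by auto
    then show "card e = card {v \<in> C. v \<in> e}" by simp
  qed simp
  also have "\<dots> = (\<Sum>v\<in>C. card {e \<in> J. v \<in> e})"
    using sum_multicount_gen[OF assms(1,4), of "\<lambda>e v. v \<in> e" "\<lambda>v. card {e \<in> J. v \<in> e}"] by simp
  also have "\<dots> \<le> (\<Sum>v\<in>C. d)" by (intro sum_mono assms(5))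
  finally show ?thesis by simp
qed

text \<open>Induction on the number of edges. If some vertex lies in every maximum matching, its
  deletion lowers the matching number and costs at most \<open>d\<close> edges. Otherwise, by
  Gallai's lemma, never being missed together is an equivalence relation that contains adjacency,
  and a class with \<open>m\<close> edges of a maximum matching has at most \<open>2 * m + 1\<close>
  vertices.\<close>

lemma card_edges_le_matching_exact:
  assumes "finite J" "\<And>e. e \<in> J \<Longrightarrow> card e = 2" "\<And>v. card {e \<in> J. v \<in> e} \<le> d"
  shows "card J \<le> mnum J * (d + 1)"
  using assms
proof (induction "card J" arbitrary: J rule: less_induct)
  case less
  note finJ = less.prems(1) and J2 = less.prems(2) and deg = less.prems(3)
  have finU: "finite (\<Union>J)" using finJ J2 by (auto intro!: finite_Union intro: card_ge_0_finite)
  show ?case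
  proof (cases "\<exists>v\<in>\<Union>J. \<forall>M. is_max_matching J M \<longrightarrow> v \<in> \<Union>M")
    case True
    then obtain v where v: "v \<in> \<Union>J" "\<And>M. is_max_matching J M \<Longrightarrow> v \<in> \<Union>M" by blast
    let ?J = "{e \<in> J. v \<notin> e}"
    have "?J \<subset> J" using v(1) by blast
    then have lt: "card ?J < card J" using finJ by (rule psubset_card_mono[rotated])
    have "card ?J \<le> mnum ?J * (d + 1)"
    proof (rule less.hyps[OF lt])
      show "card {e \<in> ?J. w \<in> e} \<le> d" for w
        by (rule order_trans[OF card_mono deg[of w]]) (use finJ in auto)
    qed (use finJ J2 in auto)
    moreover have "mnum ?J < mnum J"
    proof (rule ccontr)
      assume "\<not> ?thesis"
      obtain M where M: "M \<subseteq> ?J" "matching M" "card M = mnum ?J"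
        using mnum_props(2)[of ?J] finJ by auto
      have "M \<subseteq> J" using M(1) by blast
      have "card N \<le> card M" if "N \<subseteq> J" "matching N" for N
        using mnum_props(1)[OF finJ that] M(3) \<open>\<not> mnum ?J < mnum J\<close> by linarith
      then have "is_max_matching J M" unfolding is_max_matching_def using M(2) \<open>M \<subseteq> J\<close> by blast
      then show False using v(2) M(1) by blast
    qed
    moreover have "card J = card ?J + card {e \<in> J. v \<in> e}"
    proof -
      have "J = ?J \<union> {e \<in> J. v \<in> e}" by blast
      then have "card J = card (?J \<union> {e \<in> J. v \<in> e})" by simp
      also have "\<dots> = card ?J + card {e \<in> J. v \<in> e}" using finJ by (intro card_Un_disjoint) auto
      finally show ?thesis .
    qed
    moreover have "mnum ?J * (d + 1) + (d + 1) \<le> mnum J * (d + 1)"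
      using mult_right_mono[of "mnum ?J + 1" "mnum J" "d + 1"] calculation(2) by simp
    ultimately show ?thesis using deg[of v] by linarith
  next
    case False
    then have missed: "\<exists>M. is_max_matching J M \<and> v \<notin> \<Union>M" if "v \<in> \<Union>J" for v using that by blast
    define rel where "rel u v \<longleftrightarrow> u = v \<or> \<not> (\<exists>M. is_max_matching J M \<and> u \<notin> \<Union>M \<and> v \<notin> \<Union>M)" for u v
    have rel_sym: "rel u v \<Longrightarrow> rel v u" for u v unfolding rel_def by blast
    have rel_trans: "rel u v" if r: "rel u w" "rel w v" "w \<in> \<Union>J" for u v w
    proof (rule ccontr)
      assume "\<not> rel u v"
      then obtain M where M: "is_max_matching J M" "u \<notin> \<Union>M" "v \<notin> \<Union>M" "u \<noteq> v" unfolding rel_def by blast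
      obtain N where N: "is_max_matching J N" "w \<notin> \<Union>N" using missed r(3) by blast
      have "w \<noteq> u" "w \<noteq> v" using \<open>\<not> rel u v\<close> that by auto
      then show False using gallai_transfer[OF finJ J2 M(1-3) N M(4)] that(1,2) unfolding rel_def by blast
    qed
    have edge_rel: "rel u v" if "{u, v} \<in> J" for u v
    proof (rule ccontr)
      assume "\<not> rel u v"
      then obtain M where M: "is_max_matching J M" "u \<notin> \<Union>M" "v \<notin> \<Union>M" unfolding rel_def by blast
      then have MJ: "M \<subseteq> J" "matching M" unfolding is_max_matching_def by auto
      have "matching (insert {u, v} M)" using MJ(2) M(2,3) unfolding matching_def by auto
      then have "card (insert {u, v} M) \<le> card M" using M(1) MJ(1) that unfolding is_max_matching_def by blast
      moreover have "{u, v} \<notin> M" using M(2) by blast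
      ultimately show False using finite_subset[OF MJ(1) finJ] by simp
    qed
    define cls where "cls v = {w \<in> \<Union>J. rel v w}" for v
    define Q where "Q = cls ` \<Union>J"
    have finQ: "finite Q" unfolding Q_def using finU by simp
    have cls_eq: "cls v = cls w" if "v \<in> \<Union>J" "w \<in> \<Union>J" "rel v w" for v w
      unfolding cls_def using that rel_trans rel_sym by blast
    have in_cls: "e \<subseteq> cls v" if ev: "e \<in> J" "v \<in> e" for e v
    proof -
      obtain a b where "e = {a, b}" using J2[OF ev(1)] by (auto simp: card_2_iff)
      then show ?thesis using that edge_rel[of a b] rel_sym[of a b] unfolding cls_def rel_def
        by auto
    qed
    have disjQ: "C = D" if CDz: "C \<in> Q" "D \<in> Q" "z \<in> C" "z \<in> D" for C D z
    proof -
      obtain c d where cd: "C = cls c" "D = cls d" "c \<in> \<Union>J" "d \<in> \<Union>J" using CDz(1,2) unfolding Q_def by blast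
      then have "cls c = cls z" "cls d = cls z" using that(3,4) cls_eq unfolding cls_def by auto
      then show ?thesis using cd by simp
    qed
    obtain M where M: "is_max_matching J M" using ex_max_matching[OF finJ] by blast
    then have MJ: "M \<subseteq> J" "matching M" unfolding is_max_matching_def by auto
    have finM: "finite M" using MJ(1) finJ by (rule finite_subset)
    define ins where "ins C A = {e \<in> A. e \<subseteq> C}" for C :: "'a set" and A
    have sumQ: "card A = (\<Sum>C\<in>Q. card (ins C A))" if "A \<subseteq> J" for A
    proof -
      have "A = (\<Union>C\<in>Q. ins C A)"
      proof
        show "A \<subseteq> (\<Union>C\<in>Q. ins C A)"
        proof
          fix e assume e: "e \<in> A"
          then have "card e = 2" using that J2 by blast
          then obtain v where "v \<in> e" by fastforce
          then have "e \<subseteq> cls v" "cls v \<in> Q" using in_cls e that unfolding Q_def by blast+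
          then show "e \<in> (\<Union>C\<in>Q. ins C A)" using e unfolding ins_def by blast
        qed
      qed (auto simp: ins_def)
      then have "card A = card (\<Union>C\<in>Q. ins C A)" by simp
      also have "\<dots> = (\<Sum>C\<in>Q. card (ins C A))"
      proof (rule card_UN_disjoint[OF finQ])
        show "\<forall>C\<in>Q. finite (ins C A)" using finite_subset[OF that finJ] unfolding ins_def by simp
        show "\<forall>C\<in>Q. \<forall>D\<in>Q. C \<noteq> D \<longrightarrow> ins C A \<inter> ins D A = {}"
        proof (intro ballI impI)
          fix C D assume CD: "C \<in> Q" "D \<in> Q" "C \<noteq> D"
          have False if e: "e \<in> ins C A" "e \<in> ins D A" for e
          proof -
            have "card e = 2" using e(1) J2 \<open>A \<subseteq> J\<close> unfolding ins_def by blast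
            then obtain v where "v \<in> e" by fastforce
            then show False using disjQ[of C D v] CD e unfolding ins_def by blast
          qed
          then show "ins C A \<inter> ins D A = {}" by blast
        qed
      qed
      finally show ?thesis .
    qed
    have bound: "card (ins C J) \<le> card (ins C M) * (d + 1)" if C: "C \<in> Q" for C
    proof -
      obtain c where c: "C = cls c" "c \<in> \<Union>J" using C unfolding Q_def by blast
      have finC: "finite C" by (rule finite_subset[OF _ finU]) (auto simp: c(1) cls_def)
      have relC: "rel a b" if "a \<in> C" "b \<in> C" for a b
        using that rel_trans[of a c b] rel_sym c unfolding cls_def by blast
      define m where "m = card (ins C M)"
      have MC: "\<Union>(ins C M) = C \<inter> \<Union>M"
      proof
        show "C \<inter> \<Union>M \<subseteq> \<Union>(ins C M)"
        proof
          fix z assume z: "z \<in> C \<inter> \<Union>M"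
          then obtain e where e: "e \<in> M" "z \<in> e" by blast
          have "C = cls z" using cls_eq[of c z] c z unfolding cls_def by auto
          then have "e \<subseteq> C" using in_cls[of e z] e MJ by blast
          then show "z \<in> \<Union>(ins C M)" unfolding ins_def using e by blast
        qed
      qed (auto simp: ins_def)
      have cm: "card (C \<inter> \<Union>M) = 2 * m"
        unfolding MC[symmetric] m_def using MJ J2 finM
        by (intro card_Union_matching) (auto simp: ins_def matching_def)
      \<comment> \<open>Two distinct vertices of one class are never both missed by a maximum
        matching.\<close>
      have "card (C - \<Union>M) \<le> 1"
      proof -
        have "a = b" if "a \<in> C - \<Union>M" "b \<in> C - \<Union>M" for a b
          using relC[of a b] that M unfolding rel_def by blast
        then show ?thesis using finC by (metis One_nat_def card_le_Suc0_iff_eq finite_Diff)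
      qed
      moreover have "card C = card (C \<inter> \<Union>M) + card (C - \<Union>M)"
        using finC by (metis card_Int_Diff)
      ultimately have nC: "card C \<le> 2 * m + 1" using cm by simp
      have J2C: "card e = 2" "e \<subseteq> C" if "e \<in> ins C J" for e using that J2 unfolding ins_def by auto
      have finI: "finite (ins C J)" unfolding ins_def using finJ by simp
      have b1: "2 * card (ins C J) \<le> card C * d"
      proof (rule card_edges_le_degree[OF finI J2C finC])
        show "card {e \<in> ins C J. v \<in> e} \<le> d" for v
          by (rule order_trans[OF card_mono deg[of v]]) (use finJ in \<open>auto simp: ins_def\<close>)
      qed
      have b2: "2 * card (ins C J) \<le> card C * (card C - 1)"
      proof (rule card_edges_le_degree[OF finI J2C finC])
        fix v assume v: "v \<in> C"
        have "{e \<in> ins C J. v \<in> e} \<subseteq> (\<lambda>z. {v, z}) ` (C - {v})"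
        proof
          fix e assume e: "e \<in> {e \<in> ins C J. v \<in> e}"
          then have "card e = 2" using J2C(1) by simp
          then obtain a b where "e = {a, b}" "a \<noteq> b" by (auto simp: card_2_iff)
          then show "e \<in> (\<lambda>z. {v, z}) ` (C - {v})"
            using e J2C(2)[of e] by (auto simp: image_iff doubleton_eq_iff)
        qed
        then have "card {e \<in> ins C J. v \<in> e} \<le> card (C - {v})"
          using finC by (meson card_image_le card_mono finite_Diff finite_imageI order_trans)
        then show "card {e \<in> ins C J. v \<in> e} \<le> card C - 1" using v finC by simp
      qed
      \<comment> \<open>For \<open>d \<le> 2 * m\<close> the degree sum is the better bound,
        otherwise the number of pairs among \<open>2 * m + 1\<close> vertices; each gives at most
        \<open>m * (d + 1)\<close> edges.\<close>
      show ?thesis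
      proof (cases "d \<le> 2 * m")
        case True
        have "2 * card (ins C J) \<le> (2 * m + 1) * d"
          using b1 mult_right_mono[OF nC, of d] by linarith
        also have "\<dots> = 2 * (m * d) + d" by (simp add: algebra_simps)
        also have "\<dots> \<le> 2 * (m * (d + 1))" using True by (simp add: algebra_simps)
        finally show ?thesis unfolding m_def by simp
      next
        case False
        have "2 * card (ins C J) \<le> (2 * m + 1) * (2 * m)"
          using b2 mult_mono[OF nC, of "card C - 1" "2 * m"] nC by linarith
        also have "\<dots> \<le> (2 * m) * (d + 1)" using False by (simp add: algebra_simps)
        finally show ?thesis unfolding m_def by simp
      qed
    qed
    have "card J = (\<Sum>C\<in>Q. card (ins C J))" by (rule sumQ) simp
    also have "\<dots> \<le> (\<Sum>C\<in>Q. card (ins C M) * (d + 1))" by (intro sum_mono bound)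
    also have "\<dots> = card M * (d + 1)" using sumQ[OF MJ(1)] by (simp only: sum_distrib_right)
    finally show ?thesis using mnum_props(3)[OF finJ] M by simp
  qed
qed

text \<open>The bound for matching number \<open>r\<close> and maximum degree \<open>d\<close>,
  sharpened for \<open>d \<le> 1\<close>, where the graph is empty or a matching. Both sharpenings
  count: \<open>lump_bound\<close> is an equality for \<open>b = 1\<close>, and
  \<open>multi_part_arith\<close> relies on the value 0 for \<open>d = 0\<close>.\<close>

definition edge_cap :: "nat \<Rightarrow> nat \<Rightarrow> nat" where
  "edge_cap r d = (if d = 0 then 0 else if d = 1 then r else r * (d + 1))"

lemma card_edges_le_cap:
  assumes fin: "finite J" and J2: "\<And>e. e \<in> J \<Longrightarrow> card e = 2"
    and deg: "\<And>v. card {e \<in> J. v \<in> e} \<le> d"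
  shows "card J \<le> edge_cap (mnum J) d"
proof -
  consider "d = 0" | "d = 1" | "d \<ge> 2" by linarith
  then show ?thesis
  proof cases
    case 1
    have "J = {}"
    proof (rule ccontr)
      assume "J \<noteq> {}"
      then obtain e where e: "e \<in> J" by blast
      then obtain v where v: "v \<in> e" using J2 by fastforce
      have "card {e \<in> J. v \<in> e} > 0" using e v fin by (auto simp: card_gt_0_iff)
      then show False using deg[of v] 1 by simp
    qed
    then show ?thesis by simp
  next
    case 2
    have "matching J" unfolding matching_def
    proof (intro ballI impI)
      fix e f assume ef: "e \<in> J" "f \<in> J" "e \<noteq> f"
      have False if "v \<in> e" "v \<in> f" for v
      proof -
        have "card {e, f} \<le> card {e \<in> J. v \<in> e}" using ef that fin by (intro card_mono) auto
        then show False using deg[of v] 2 ef(3) by simp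
      qed
      then show "e \<inter> f = {}" by blast
    qed
    then show ?thesis using mnum_props(1)[OF fin, of J] 2 by (simp add: edge_cap_def)
  next
    case 3
    then show ?thesis using card_edges_le_matching_exact[OF assms] by (simp add: edge_cap_def)
  qed
qed

text \<open>At each vertex \<open>v\<close> at most \<open>m v\<close> edges are discarded to bring
  the degree down to \<open>d\<close>. The remaining graph has no larger matching number, and the
  discarded edges are paid for by the sum.\<close>

lemma trim_degrees:
  assumes fin: "finite J" and J2: "\<And>e. e \<in> J \<Longrightarrow> card e = 2" and JV: "\<And>e. e \<in> J \<Longrightarrow> e \<subseteq> V" and finV: "finite V"
    and deg: "\<And>v. v \<in> V \<Longrightarrow> card {e \<in> J. v \<in> e} \<le> d + m v"
  shows "card J \<le> edge_cap (mnum J) d + (\<Sum>v\<in>V. m v)"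
proof -
  have "\<exists>D. D \<subseteq> {e \<in> J. v \<in> e} \<and> card D \<le> m v \<and> card ({e \<in> J. v \<in> e} - D) \<le> d" if v: "v \<in> V" for v
  proof -
    let ?A = "{e \<in> J. v \<in> e}"
    have finA: "finite ?A" using fin by simp
    obtain D where D: "D \<subseteq> ?A" "card D = min (m v) (card ?A)" "finite D"
      by (rule obtain_subset_with_card_n[OF min.cobounded2])
    then have "card (?A - D) = card ?A - min (m v) (card ?A)"
      using finA by (simp add: card_Diff_subset finite_subset)
    then show ?thesis using D deg[OF v] by (intro exI[of _ D]) auto
  qed
  then have "\<forall>v\<in>V. \<exists>D. D \<subseteq> {e \<in> J. v \<in> e} \<and> card D \<le> m v \<and> card ({e \<in> J. v \<in> e} - D) \<le> d"
    by blast
  from bchoice[OF this] obtain D where "\<forall>v\<in>V. D v \<subseteq> {e \<in> J. v \<in> e} \<and> card (D v) \<le> m v \<and>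
      card ({e \<in> J. v \<in> e} - D v) \<le> d" by (rule exE)
  then have D: "\<And>v. v \<in> V \<Longrightarrow> D v \<subseteq> {e \<in> J. v \<in> e}" "\<And>v. v \<in> V \<Longrightarrow> card (D v) \<le> m v"
     "\<And>v. v \<in> V \<Longrightarrow> card ({e \<in> J. v \<in> e} - D v) \<le> d" by simp_all
  let ?X = "\<Union>v\<in>V. D v"
  have XJ: "?X \<subseteq> J" using D(1) by blast
  have "card (J - ?X) \<le> edge_cap (mnum (J - ?X)) d"
  proof (rule card_edges_le_cap)
    show "card {e \<in> J - ?X. v \<in> e} \<le> d" for v
    proof (cases "v \<in> V")
      case True
      have "{e \<in> J - ?X. v \<in> e} \<subseteq> {e \<in> J. v \<in> e} - D v" using True by blast
      then have "card {e \<in> J - ?X. v \<in> e} \<le> card ({e \<in> J. v \<in> e} - D v)"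
        using fin by (intro card_mono) auto
      then show ?thesis using D(3)[OF True] by linarith
    next
      case False
      then have "{e \<in> J - ?X. v \<in> e} = {}" using JV by blast
      then show ?thesis by (simp only: card.empty)
    qed
  qed (use fin J2 in auto)
  also have "\<dots> \<le> edge_cap (mnum J) d"
  proof -
    obtain M where "M \<subseteq> J - ?X" "matching M" "card M = mnum (J - ?X)"
      using mnum_props(2)[of "J - ?X"] fin by auto
    then have "mnum (J - ?X) \<le> mnum J" using mnum_props(1)[OF fin, of M] by auto
    then show ?thesis unfolding edge_cap_def using mult_right_mono[of _ "mnum J" "d + 1"] by simp
  qed
  finally have "card (J - ?X) \<le> edge_cap (mnum J) d" .
  moreover have "card ?X \<le> (\<Sum>v\<in>V. m v)"
    using card_UN_le[OF finV, of D] sum_mono[of V "\<lambda>v. card (D v)" m] D(2) by force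
  moreover have "card J = card (J - ?X) + card ?X"
    using XJ fin by (simp add: card_Diff_subset card_mono finite_subset)
  ultimately show ?thesis by linarith
qed

subsection \<open>Edges of complete multipartite graphs\<close>

text \<open>The number of pairs inside the classes of a balanced partition of \<open>m\<close>
  vertices into \<open>p\<close> classes: if the vertices are dealt out in turn, vertex
  \<open>i\<close> joins a class with \<open>i div p\<close> earlier members.\<close>

definition class_pairs :: "nat \<Rightarrow> nat \<Rightarrow> nat" where
  "class_pairs p m = (\<Sum>i<m. i div p)"

lemma choose_two_Suc: "Suc n choose 2 = (n choose 2) + n"
  by (simp add: numeral_2_eq_2)

lemma class_pairs_Suc: "class_pairs p (Suc m) = class_pairs p m + m div p"
  by (simp add: class_pairs_def)

text \<open>Among \<open>m + 1\<close> vertices some class has more than \<open>m div p\<close>, and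
  removing one of its vertices destroys at least \<open>m div p\<close> pairs. Induction on
  \<open>m\<close> thus takes the place of a convexity argument.\<close>

lemma class_pairs_le:
  fixes f :: "nat \<Rightarrow> nat"
  assumes "p \<ge> 1" "(\<Sum>i<p. f i) = m"
  shows "class_pairs p m \<le> (\<Sum>i<p. (f i choose 2))"
  using assms(2)
proof (induction m arbitrary: f)
  case 0
  then show ?case by (simp add: class_pairs_def)
next
  case (Suc m)
  have "\<exists>j<p. m div p < f j"
  proof (rule ccontr)
    assume "\<not> ?thesis"
    then have "f i \<le> m div p" if "i < p" for i using that not_less by blast
    then have "(\<Sum>i<p. f i) \<le> (\<Sum>i<p. m div p)" by (intro sum_mono) simp
    also have "\<dots> = p * (m div p)" by simp
    also have "\<dots> \<le> m" by simp
    finally show False using Suc.prems by simp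
  qed
  then obtain j where j: "j < p" "m div p < f j" by blast
  define g where "g = f(j := f j - 1)"
  have gj: "f j = Suc (g j)" using j unfolding g_def by simp
  have split: "(\<Sum>i<p. h i) = h j + (\<Sum>i\<in>{..<p}-{j}. h i)" for h :: "nat \<Rightarrow> nat"
    using j(1) by (intro sum.remove) auto
  have rest: "(\<Sum>i\<in>{..<p}-{j}. h (f i)) = (\<Sum>i\<in>{..<p}-{j}. h (g i))" for h :: "nat \<Rightarrow> nat"
    unfolding g_def by (intro sum.cong) auto
  have "(\<Sum>i<p. g i) = m"
    using Suc.prems split[of f] split[of g] rest[of "\<lambda>x. x"] gj by simp
  then have "class_pairs p m \<le> (\<Sum>i<p. (g i choose 2))" by (rule Suc.IH)
  moreover have "(\<Sum>i<p. (f i choose 2)) = (\<Sum>i<p. (g i choose 2)) + g j"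
    using split[of "\<lambda>i. f i choose 2"] split[of "\<lambda>i. g i choose 2"] rest[of "\<lambda>x. x choose 2"]
    by (simp add: gj choose_two_Suc)
  moreover have "m div p \<le> g j" using gj j by simp
  ultimately show ?case by (simp add: class_pairs_Suc)
qed

lemma card_nsets_2: "finite A \<Longrightarrow> card (nsets A 2) = card A choose 2"
  by (simp add: card_nsets)

lemma finite_nsets_2 [simp]: "finite A \<Longrightarrow> finite (nsets A 2)"
  by (rule finite_imp_finite_nsets)

lemma nsets_2_E:
  assumes "e \<in> nsets A 2"
  obtains u v where "e = {u, v}" "u \<noteq> v" "u \<in> A" "v \<in> A"
  using assms by (auto simp: nsets_def card_2_iff)

lemma class_size_eq:
  assumes "p \<ge> 1"
  shows "card {u. u < m \<and> u mod p = m mod p} = m div p"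
  using card_residue_class[of "m mod p" p m] assms by simp

lemma edges_turan: "e \<in> edges (turan_graph p m) \<longleftrightarrow> (\<exists>u v. e = {u, v} \<and> u < m \<and> v < m \<and> u mod p \<noteq> v mod p)"
  unfolding turan_graph_def by auto

lemma finite_turan: "finite (edges (turan_graph p m))"
proof (rule finite_subset)
  show "edges (turan_graph p m) \<subseteq> nsets {..<m} 2"
    unfolding turan_graph_def by auto
qed simp

text \<open>The new vertex \<open>m\<close> misses exactly the \<open>m div p\<close> earlier
  vertices of its residue class; the additive form avoids truncated subtraction.\<close>

lemma turan_edges_Suc:
  assumes "p \<ge> 1"
  shows "turan_edges p (Suc m) + m div p = turan_edges p m + m"
proof -
  let ?N = "{u. u < m \<and> u mod p \<noteq> m mod p}"
  have eq: "edges (turan_graph p (Suc m)) = edges (turan_graph p m) \<union> (\<lambda>u. {u, m}) ` ?N"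
  proof
    show "edges (turan_graph p (Suc m)) \<subseteq> edges (turan_graph p m) \<union> (\<lambda>u. {u, m}) ` ?N"
    proof
      fix e assume "e \<in> edges (turan_graph p (Suc m))"
      then obtain u v where uv: "e = {u, v}" "u < Suc m" "v < Suc m" "u mod p \<noteq> v mod p"
        unfolding edges_turan by blast
      consider "u = m" "v < m" | "v = m" "u < m" | "u < m" "v < m"
        using uv by (metis less_SucE)
      then show "e \<in> edges (turan_graph p m) \<union> (\<lambda>u. {u, m}) ` ?N"
      proof cases
        case 1 then show ?thesis using uv by (intro UnI2 image_eqI[of _ _ v]) auto
      next
        case 2 then show ?thesis using uv by (intro UnI2 image_eqI[of _ _ u]) auto
      next
        case 3
        then have "e \<in> edges (turan_graph p m)" unfolding edges_turan using uv by blast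
        then show ?thesis by blast
      qed
    qed
    show "edges (turan_graph p m) \<union> (\<lambda>u. {u, m}) ` ?N \<subseteq> edges (turan_graph p (Suc m))"
    proof
      fix e assume "e \<in> edges (turan_graph p m) \<union> (\<lambda>u. {u, m}) ` ?N"
      then show "e \<in> edges (turan_graph p (Suc m))"
      proof
        assume "e \<in> edges (turan_graph p m)"
        then obtain u v where "e = {u, v}" "u < m" "v < m" "u mod p \<noteq> v mod p"
          unfolding edges_turan by blast
        then show ?thesis unfolding edges_turan by (intro exI[of _ u] exI[of _ v]) simp
      next
        assume "e \<in> (\<lambda>u. {u, m}) ` ?N"
        then obtain u where "e = {u, m}" "u < m" "u mod p \<noteq> m mod p" by blast
        then show ?thesis unfolding edges_turan by (intro exI[of _ u] exI[of _ m]) simp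
      qed
    qed
  qed
  have "card (edges (turan_graph p (Suc m))) = card (edges (turan_graph p m)) + card ((\<lambda>u. {u, m}) ` ?N)"
    unfolding eq using finite_turan
    by (intro card_Un_disjoint) (auto simp: edges_turan doubleton_eq_iff)
  also have "card ((\<lambda>u. {u, m}) ` ?N) = card ?N"
    by (intro card_image) (auto simp: inj_on_def doubleton_eq_iff)
  finally have E: "card (edges (turan_graph p (Suc m))) = card (edges (turan_graph p m)) + card ?N" .
  have "card ?N + m div p = m"
  proof -
    have "card ?N + card {u. u < m \<and> u mod p = m mod p} = card (?N \<union> {u. u < m \<and> u mod p = m mod p})"
      by (intro card_Un_disjoint[symmetric]) auto
    also have "?N \<union> {u. u < m \<and> u mod p = m mod p} = {..<m}" by auto
    finally show ?thesis using class_size_eq[OF assms] by simp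
  qed
  then show ?thesis unfolding turan_edges_def E by (simp only: add.assoc)
qed

lemma turan_edges_eq:
  assumes "p \<ge> 1"
  shows "turan_edges p m + class_pairs p m = (m choose 2)"
proof (induction m)
  case 0
  have "edges (turan_graph p 0) = {}" by (auto simp: turan_graph_def)
  then show ?case by (simp add: turan_edges_def class_pairs_def)
next
  case (Suc m)
  have "turan_edges p (Suc m) + class_pairs p (Suc m) = (turan_edges p (Suc m) + m div p) + class_pairs p m"
    by (simp add: class_pairs_Suc)
  also have "\<dots> = (turan_edges p m + class_pairs p m) + m"
    unfolding turan_edges_Suc[OF assms] by simp
  also have "\<dots> = Suc m choose 2" unfolding Suc.IH choose_two_Suc by simp
  finally show ?case .
qed

text \<open>By complement: the pairs inside the parts number at least
  \<open>class_pairs p (card V)\<close>. A pair joins different parts when its image under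
  \<open>part\<close> has two elements, which requires no naming of its ends.\<close>

lemma card_cross_pairs_le_turan:
  assumes p: "p \<ge> 1" and fin: "finite V" and part: "\<And>v. v \<in> V \<Longrightarrow> part v < p"
  shows "card {e \<in> nsets V 2. card (part ` e) = 2} \<le> turan_edges p (card V)"
proof -
  let ?P = "\<lambda>i. {v \<in> V. part v = i}"
  have V: "V = (\<Union>i<p. ?P i)" using part by auto
  have sumV: "(\<Sum>i<p. card (?P i)) = card V"
    by (subst (2) V, subst card_UN_disjoint) (use fin in auto)
  have finP: "finite (?P i)" for i using fin by simp
  have same: "nsets V 2 - {e \<in> nsets V 2. card (part ` e) = 2} = (\<Union>i<p. nsets (?P i) 2)"
  proof
    show "nsets V 2 - {e \<in> nsets V 2. card (part ` e) = 2} \<subseteq> (\<Union>i<p. nsets (?P i) 2)"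
    proof
      fix e assume e: "e \<in> nsets V 2 - {e \<in> nsets V 2. card (part ` e) = 2}"
      then obtain u v where uv: "e = {u, v}" "u \<noteq> v" "u \<in> V" "v \<in> V" by (auto elim: nsets_2_E)
      then have "part u = part v" using e by (auto simp: card_insert_if split: if_splits)
      then have "e \<in> nsets (?P (part u)) 2" using uv by simp
      then show "e \<in> (\<Union>i<p. nsets (?P i) 2)" using part uv by blast
    qed
    show "(\<Union>i<p. nsets (?P i) 2) \<subseteq> nsets V 2 - {e \<in> nsets V 2. card (part ` e) = 2}"
    proof
      fix e assume "e \<in> (\<Union>i<p. nsets (?P i) 2)"
      then obtain i where "e \<in> nsets (?P i) 2" by blast
      then show "e \<in> nsets V 2 - {e \<in> nsets V 2. card (part ` e) = 2}" by (auto elim!: nsets_2_E)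
    qed
  qed
  have "card (\<Union>i<p. nsets (?P i) 2) = (\<Sum>i<p. card (nsets (?P i) 2))"
  proof (rule card_UN_disjoint)
    show "\<forall>i\<in>{..<p}. \<forall>j\<in>{..<p}. i \<noteq> j \<longrightarrow> nsets (?P i) 2 \<inter> nsets (?P j) 2 = {}"
    proof (intro ballI impI)
      fix i j :: nat assume "i \<noteq> j"
      then have "?P i \<inter> ?P j = {}" by blast
      moreover have "e \<subseteq> A" "e \<noteq> {}" if "e \<in> nsets A 2" for e and A :: "'a set"
        using that by (auto elim!: nsets_2_E)
      ultimately show "nsets (?P i) 2 \<inter> nsets (?P j) 2 = {}" by blast
    qed
  qed (use finP in auto)
  also have "\<dots> = (\<Sum>i<p. card (?P i) choose 2)" using finP by (simp add: card_nsets_2)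
  also have "\<dots> \<ge> class_pairs p (card V)" by (rule class_pairs_le[OF p sumV])
  finally have "class_pairs p (card V) \<le> card (nsets V 2 - {e \<in> nsets V 2. card (part ` e) = 2})"
    unfolding same by simp
  also have "\<dots> = card (nsets V 2) - card {e \<in> nsets V 2. card (part ` e) = 2}"
    using fin by (intro card_Diff_subset) auto
  finally show ?thesis using turan_edges_eq[OF p, of "card V"] card_nsets_2[OF fin]
    card_mono[of "nsets V 2" "{e \<in> nsets V 2. card (part ` e) = 2}"] fin by simp
qed

section \<open>Embedding criteria for nearly joined parts\<close>

definition nbs :: "'a set set \<Rightarrow> 'a \<Rightarrow> 'a set" where
  "nbs E v = {u. {v, u} \<in> E}"

text \<open>In a graph without loops a vertex \<open>v\<close> of \<open>V\<close> is its own
  non-neighbour, which shifts every count by one.\<close>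

definition nonnbs :: "'a set \<Rightarrow> 'a set set \<Rightarrow> 'a \<Rightarrow> 'a set" where
  "nonnbs V E v = {u \<in> V. {v, u} \<notin> E}"

lemma card_common_nbs_ge:
  assumes fin: "finite Y" "finite Q" and miss: "\<And>z. z \<in> Q \<Longrightarrow> card {y \<in> Y. {z, y} \<notin> E} \<le> m"
    and c: "card Q \<le> c" and big: "b + c * m \<le> card Y"
  shows "b \<le> card {y \<in> Y. \<forall>z\<in>Q. {z, y} \<in> E}"
proof -
  let ?A = "{y \<in> Y. \<forall>z\<in>Q. {z, y} \<in> E}"
  have "card (\<Union>z\<in>Q. {y \<in> Y. {z, y} \<notin> E}) \<le> (\<Sum>z\<in>Q. card {y \<in> Y. {z, y} \<notin> E})"
    by (rule card_UN_le[OF fin(2)])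
  also have "\<dots> \<le> (\<Sum>z\<in>Q. m)" by (intro sum_mono miss)
  also have "\<dots> \<le> c * m" using c by simp
  finally have "card (\<Union>z\<in>Q. {y \<in> Y. {z, y} \<notin> E}) \<le> c * m" .
  moreover have "card Y \<le> card (?A \<union> (\<Union>z\<in>Q. {y \<in> Y. {z, y} \<notin> E}))"
    using fin by (intro card_mono) auto
  moreover note card_Un_le[of ?A "\<Union>z\<in>Q. {y \<in> Y. {z, y} \<notin> E}"]
  ultimately show ?thesis using big by linarith
qed

lemma nsets_2_singleton [simp]: "nsets {x} 2 = {}"
  by (auto simp: nsets_def card_2_iff)

text \<open>The left vertices of \<open>K_{s,t}\<close> are placed at the \<open>w i\<close>, which
  are the whole cores. Each clique takes one vertex from each of the \<open>p\<close> parts, and all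
  right vertices come from part \<open>lc\<close>, where the \<open>w i\<close> have many common
  neighbours. In a graph without a copy this limits the vertices that see all parts.\<close>

lemma wide_embed:
  fixes E :: "'a set set" and Y :: "nat \<Rightarrow> 'a set"
  assumes st: "1 \<le> s" "1 \<le> t" and w: "inj_on w {..<s}"
    and finY: "\<And>l. l < p \<Longrightarrow> finite (Y l)"
    and miss: "\<And>l l' y. \<lbrakk>l < p; l' < p; l \<noteq> l'; y \<in> Y l\<rbrakk> \<Longrightarrow> card {z \<in> Y l'. {y, z} \<notin> E} \<le> m"
    and wide: "\<And>i l. \<lbrakk>i < s; l < p\<rbrakk> \<Longrightarrow> slack p s t * (m + 1) \<le> card {y \<in> Y l. {w i, y} \<in> E}"
    and lc: "lc < p" and common: "slack p s t * (m + 1) \<le> card {y \<in> Y lc. \<forall>i<s. {w i, y} \<in> E}"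
  shows "clique_system (p + 1) s t E"
proof (rule clique_system_extend[where S = "Inl ` {..<s}" and x = "\<lambda>u. w (projl u)"
      and C = "\<lambda>i j. {w i}" and L = "\<lambda>i j. {..<p}" and lu = "\<lambda>u. lc" and Y = Y and m = m])
  show "Inl ` {..<s} \<subseteq> bip_verts s t" by (auto simp: bip_verts_def)
  show "spread s t (Inl ` {..<s}) (\<lambda>u. w (projl u)) (\<lambda>i j. {w i})"
    unfolding spread_def
  proof (intro conjI allI impI)
    show "inj_on (\<lambda>u. w (projl u)) (Inl ` {..<s})" using w by (auto simp: inj_on_def)
    show "(\<lambda>u. w (projl u)) ` ({Inl i, Inr j} \<inter> Inl ` {..<s}) \<subseteq> {w i}" for i j :: nat by auto
    fix i j i' j' :: nat assume a: "i < s" "j < t" "i' < s" "j' < t" "(i, j) \<noteq> (i', j')"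
    show "{w i} \<inter> {w i'} \<subseteq> (\<lambda>u. w (projl u)) ` ({Inl i, Inr j} \<inter> {Inl i', Inr j'} \<inter> Inl ` {..<s})"
    proof (cases "i = i'")
      case True
      then show ?thesis using a by force
    next
      case False
      then show ?thesis using inj_onD[OF w, of i i'] a by auto
    qed
  qed
  show "slack p s t * (m + 1) \<le> card {y \<in> Y lc. \<forall>i<s. \<forall>z\<in>{w i}. {z, y} \<in> E}" if "j < t" for j :: nat
    using common by simp
qed (use assms in auto)

text \<open>The edges of the split are the cores, and each clique adds one vertex from every part
  other than \<open>i1\<close>. The set \<open>D\<close> takes the place of part \<open>i1\<close>;
  it may contain further vertices, provided they are nearly joined to the other parts.\<close>

lemma split_embed:
  fixes E :: "'a set set" and Y :: "nat \<Rightarrow> 'a set"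
  assumes st: "1 \<le> s" "1 \<le> t" and p: "3 \<le> p" and i1: "i1 < p"
    and split: "split_in s t B" and BE: "B \<subseteq> E" and B2: "B \<subseteq> nsets D 2"
    and finY: "\<And>l. l < p \<Longrightarrow> finite (Y l)"
    and miss: "\<And>l l' y. \<lbrakk>l < p; l' < p; l \<noteq> l'; y \<in> Y l\<rbrakk> \<Longrightarrow> card {z \<in> Y l'. {y, z} \<notin> E} \<le> m"
    and missD: "\<And>l v. \<lbrakk>l < p; l \<noteq> i1; v \<in> D\<rbrakk> \<Longrightarrow> card {y \<in> Y l. {v, y} \<notin> E} \<le> m"
    and big: "\<And>l. l < p \<Longrightarrow> (slack p s t + 2 * s + 2 * t) * (m + 1) \<le> card (Y l)"
  shows "clique_system (p + 1) s t E"
proof -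
  obtain S x b where S: "S \<subseteq> bip_verts s t" and sp: "spread s t S x b"
    and bB: "\<And>i j. \<lbrakk>i < s; j < t\<rbrakk> \<Longrightarrow> b i j \<in> B"
    using split unfolding split_in_def by blast
  \<comment> \<open>Unplaced left vertices are drawn from part \<open>lA\<close> and unplaced right
    ones from \<open>lB\<close>. Two such parts besides \<open>i1\<close> exist because of
    \<open>3 \<le> p\<close>.\<close>
  have "\<exists>lA lB. lA < p \<and> lB < p \<and> lA \<noteq> lB \<and> lA \<noteq> i1 \<and> lB \<noteq> i1"
  proof -
    consider "i1 = 0" | "i1 = 1" | "i1 \<ge> 2" by linarith
    then show ?thesis
    proof cases
      case 1 then show ?thesis using p by (intro exI[of _ 1] exI[of _ 2]) auto
    next
      case 2 then show ?thesis using p by (intro exI[of _ 0] exI[of _ 2]) auto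
    next
      case 3 then show ?thesis using p by (intro exI[of _ 0] exI[of _ 1]) auto
    qed
  qed
  then obtain lA lB where l: "lA < p" "lB < p" "lA \<noteq> lB" "lA \<noteq> i1" "lB \<noteq> i1" by blast
  have b2: "finite (b i j)" "card (b i j) = 2" "b i j \<subseteq> D" if "i < s" "j < t" for i j
    using bB[OF that] B2 unfolding nsets_def by auto
  \<comment> \<open>The cores meeting at an unplaced vertex have at most \<open>2 * t\<close> or
    \<open>2 * s\<close> vertices in total; the bound \<open>2 * s + 2 * t\<close> serves both sides
    and single cores.\<close>
  have cand: "slack p s t * (m + 1) \<le> card {y \<in> Y l. \<forall>z\<in>Q. {z, y} \<in> E}"
    if "l < p" "l \<noteq> i1" "finite Q" "Q \<subseteq> D" "card Q \<le> 2 * s + 2 * t" for l Q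
  proof (rule card_common_nbs_ge[where m = m and c = "2 * s + 2 * t"])
    have "(slack p s t + 2 * s + 2 * t) * (m + 1) = slack p s t * (m + 1) + (2 * s + 2 * t) * (m + 1)"
      by (simp only: add_mult_distrib add.assoc)
    moreover have "(2 * s + 2 * t) * m \<le> (2 * s + 2 * t) * (m + 1)" by simp
    ultimately show "slack p s t * (m + 1) + (2 * s + 2 * t) * m \<le> card (Y l)"
      using big[OF that(1)] by linarith
    show "card {y \<in> Y l. {z, y} \<notin> E} \<le> m" if "z \<in> Q" for z
      using missD \<open>l < p\<close> \<open>l \<noteq> i1\<close> \<open>Q \<subseteq> D\<close> that by blast
  qed (use that finY in auto)
  define lu where "lu u = (case u of Inl i \<Rightarrow> lA | Inr j \<Rightarrow> lB)" for u :: "nat + nat"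
  have [simp]: "lu (Inl i) = lA" "lu (Inr j) = lB" for i j unfolding lu_def by auto
  have U: "card (\<Union>k<n. f k) \<le> 2 * n" if "\<And>k. k < n \<Longrightarrow> card (f k) = 2" for n and f :: "nat \<Rightarrow> 'a set"
  proof -
    have "card (\<Union>k<n. f k) \<le> (\<Sum>k<n. card (f k))" by (rule card_UN_le) simp
    also have "\<dots> = (\<Sum>k<n. 2)" using that by (intro sum.cong) auto
    finally show ?thesis by simp
  qed
  show ?thesis
  proof (rule clique_system_extend[where S = S and x = x and C = b and L = "\<lambda>i j. {..<p} - {i1}"
        and lu = lu and Y = Y and m = m])
    show "finite (b i j) \<and> nsets (b i j) 2 \<subseteq> E" if ij: "i < s" "j < t" for i j
    proof
      show "finite (b i j)" using b2 ij by blast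
      have "e = b i j" if "e \<in> nsets (b i j) 2" for e
        using that b2[OF ij] unfolding nsets_def by (simp add: card_subset_eq)
      then show "nsets (b i j) 2 \<subseteq> E" using bB[OF ij] BE by blast
    qed
    show "{..<p} - {i1} \<subseteq> {..<p} \<and> card (b i j) + card ({..<p} - {i1}) = p + 1" if "i < s" "j < t" for i j
      using b2[OF that] i1 p by simp
    show "slack p s t * (m + 1) \<le> card {y \<in> Y l. \<forall>z\<in>b i j. {z, y} \<in> E}"
      if "i < s" "j < t" "l \<in> {..<p} - {i1}" for i j l
      using that b2[OF that(1,2)] st by (intro cand) auto
    show "slack p s t * (m + 1) \<le> card {y \<in> Y (lu (Inl i)). \<forall>j<t. \<forall>z\<in>b i j. {z, y} \<in> E}"
      if "i < s" "Inl i \<notin> S" for i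
    proof -
      have "{y \<in> Y lA. \<forall>j<t. \<forall>z\<in>b i j. {z, y} \<in> E} = {y \<in> Y lA. \<forall>z\<in>(\<Union>j<t. b i j). {z, y} \<in> E}" by auto
      moreover have "slack p s t * (m + 1) \<le> card {y \<in> Y lA. \<forall>z\<in>(\<Union>j<t. b i j). {z, y} \<in> E}"
        using U[of t "b i"] b2[OF that(1)] l by (intro cand) force+
      ultimately show ?thesis by simp
    qed
    show "slack p s t * (m + 1) \<le> card {y \<in> Y (lu (Inr j)). \<forall>i<s. \<forall>z\<in>b i j. {z, y} \<in> E}"
      if "j < t" "Inr j \<notin> S" for j
    proof -
      have "{y \<in> Y lB. \<forall>i<s. \<forall>z\<in>b i j. {z, y} \<in> E} = {y \<in> Y lB. \<forall>z\<in>(\<Union>i<s. b i j). {z, y} \<in> E}" by auto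
      moreover have "slack p s t * (m + 1) \<le> card {y \<in> Y lB. \<forall>z\<in>(\<Union>i<s. b i j). {z, y} \<in> E}"
        using U[of s "\<lambda>i. b i j"] b2[OF _ that(1)] l by (intro cand) force+
      ultimately show ?thesis by simp
    qed
  qed (use st S sp l finY miss in auto)
qed

text \<open>With \<open>S = {}\<close> nothing is placed, and a split is just a family of
  \<open>s * t\<close> disjoint edges.\<close>

lemma matching_imp_split:
  assumes M: "matching M" and c: "s * t \<le> card M" and fin: "finite M"
  shows "split_in s t M"
proof -
  have "card ({..<s} \<times> {..<t}) \<le> card M" using c by (simp add: card_cartesian_product)
  then have "\<exists>f. f ` ({..<s} \<times> {..<t}) \<subseteq> M \<and> inj_on f ({..<s} \<times> {..<t})"
    using fin by (intro card_le_inj) auto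
  then obtain f where f: "f ` ({..<s} \<times> {..<t}) \<subseteq> M" "inj_on f ({..<s} \<times> {..<t})"
    by (elim exE conjE)
  define b where "b i j = f (i, j)" for i j
  have bM: "b i j \<in> M" if "i < s" "j < t" for i j using f(1) that unfolding b_def by auto
  have "spread s t {} (\<lambda>_. undefined) b"
    unfolding spread_def
  proof (intro conjI allI impI)
    fix i j i' j' assume a: "i < s" "j < t" "i' < s" "j' < t" "(i, j) \<noteq> (i', j')"
    then have "b i j \<noteq> b i' j'" using inj_onD[OF f(2), of "(i, j)" "(i', j')"] unfolding b_def by auto
    then have "b i j \<inter> b i' j' = {}" using M bM a unfolding matching_def by blast
    then show "b i j \<inter> b i' j' \<subseteq> (\<lambda>_. undefined) ` ({Inl i, Inr j} \<inter> {Inl i', Inr j'} \<inter> {})" by simp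
  qed auto
  then show ?thesis unfolding split_in_def using bM by blast
qed

text \<open>The last left vertex is placed at \<open>xc\<close>, the others at the
  \<open>w i\<close>. A core \<open>c j\<close> is meant to be an edge at \<open>xc\<close> inside
  part \<open>i0\<close>, with \<open>q j = i0\<close>, or a triangle of \<open>xc\<close> and an
  edge inside another part \<open>q j\<close>. Either way it has one vertex more than the number of
  parts it occupies, so one vertex from each remaining part completes the clique.\<close>

lemma star_embed:
  fixes E :: "'a set set" and Y :: "nat \<Rightarrow> 'a set"
  assumes st: "1 \<le> s" "1 \<le> t" and p: "3 \<le> p" and i0: "i0 < p"
    and w: "inj_on w {..<s - 1}"
    and q: "\<And>j. j < t \<Longrightarrow> q j < p"
    and core: "\<And>j. j < t \<Longrightarrow> finite (c j) \<and> xc \<in> c j \<and> nsets (c j) 2 \<subseteq> E \<and> card (c j) = 1 + card {i0, q j}"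
    and disj: "\<And>j j'. \<lbrakk>j < t; j' < t; j \<noteq> j'\<rbrakk> \<Longrightarrow> c j \<inter> c j' = {xc}"
    and wc: "\<And>i j. \<lbrakk>i < s - 1; j < t\<rbrakk> \<Longrightarrow> w i \<notin> c j"
    and finY: "\<And>l. l < p \<Longrightarrow> finite (Y l)"
    and miss: "\<And>l l' y. \<lbrakk>l < p; l' < p; l \<noteq> l'; y \<in> Y l\<rbrakk> \<Longrightarrow> card {z \<in> Y l'. {y, z} \<notin> E} \<le> m"
    and missw: "\<And>l i. \<lbrakk>l < p; i < s - 1\<rbrakk> \<Longrightarrow> card {y \<in> Y l. {w i, y} \<notin> E} \<le> m"
    and missc: "\<And>l j z. \<lbrakk>l < p; j < t; l \<noteq> i0; l \<noteq> q j; z \<in> c j\<rbrakk> \<Longrightarrow> card {y \<in> Y l. {z, y} \<notin> E} \<le> m"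
    and big: "\<And>l. l < p \<Longrightarrow> (slack p s t + s + 3) * (m + 1) \<le> card (Y l)"
  shows "clique_system (p + 1) s t E"
proof -
  define C where "C i j = (if i < s - 1 then {w i} else c j)" for i j
  define L where "L i j = (if i < s - 1 then {..<p} else {..<p} - {i0, q j})" for i j :: nat
  define xx where "xx u = (if projl u < s - 1 then w (projl u) else xc)" for u :: "nat + nat"
  \<comment> \<open>The right vertex \<open>Inr j\<close> is unplaced and needs a part different
    from \<open>i0\<close> and \<open>q j\<close>, which again uses
    \<open>3 \<le> p\<close>.\<close>
  have "\<exists>l<p. l \<noteq> i0 \<and> l \<noteq> q j" for j
  proof -
    have "card {i0, q j} \<le> 2" by (simp add: card_insert_if)
    then have "card {i0, q j} < card {..<p}" using p by simp
    then have "\<not> {..<p} \<subseteq> {i0, q j}" using card_mono[of "{i0, q j}" "{..<p}"] by auto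
    then show ?thesis by auto
  qed
  then obtain l where l: "\<And>j. l j < p \<and> l j \<noteq> i0 \<and> l j \<noteq> q j" by metis
  have cand: "slack p s t * (m + 1) \<le> card {y \<in> Y l. \<forall>z\<in>Q. {z, y} \<in> E}"
    if "l < p" "finite Q" "card Q \<le> s + 3" "\<And>z. z \<in> Q \<Longrightarrow> card {y \<in> Y l. {z, y} \<notin> E} \<le> m" for l Q
  proof (rule card_common_nbs_ge[where m = m and c = "s + 3"])
    have "(slack p s t + s + 3) * (m + 1) = slack p s t * (m + 1) + (s + 3) * (m + 1)"
      by (simp only: add_mult_distrib add.assoc)
    moreover have "(s + 3) * m \<le> (s + 3) * (m + 1)" by simp
    ultimately show "slack p s t * (m + 1) + (s + 3) * m \<le> card (Y l)"
      using big[OF that(1)] by linarith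
  qed (use that finY in auto)
  have c3: "card (c j) \<le> 3" if "j < t" for j
    using core[OF that] by (simp add: card_insert_if split: if_splits)
  have xcw: "xc \<noteq> w i" if "i < s - 1" for i
    using wc[OF that, of 0] core[of 0] st by auto
  show ?thesis
  proof (rule clique_system_extend[where S = "Inl ` {..<s}" and x = xx and C = C and L = L
        and lu = "\<lambda>u. l (projr u)" and Y = Y and m = m])
    show "Inl ` {..<s} \<subseteq> bip_verts s t" by (auto simp: bip_verts_def)
    show "spread s t (Inl ` {..<s}) xx C"
      unfolding spread_def
    proof (intro conjI allI impI)
      show "inj_on xx (Inl ` {..<s})"
      proof (rule inj_onI)
        fix u v assume "u \<in> Inl ` {..<s}" "v \<in> Inl ` {..<s}" and eq: "xx u = xx v"
        then obtain i i' where i: "u = Inl i" "v = Inl i'" "i < s" "i' < s" by blast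
        show "u = v"
          using i eq inj_onD[OF w, of i i'] xcw[of i] xcw[of i'] unfolding xx_def
          by (auto split: if_splits)
      qed
      show "xx ` ({Inl i, Inr j} \<inter> Inl ` {..<s}) \<subseteq> C i j" if "i < s" "j < t" for i j
        using core[OF that(2)] unfolding xx_def C_def by auto
      fix i j i' j' assume a: "i < s" "j < t" "i' < s" "j' < t" "(i, j) \<noteq> (i', j')"
      show "C i j \<inter> C i' j' \<subseteq> xx ` ({Inl i, Inr j} \<inter> {Inl i', Inr j'} \<inter> Inl ` {..<s})"
      proof (cases "i = i'")
        case True
        then have "j \<noteq> j'" using a by simp
        have "C i j \<inter> C i' j' \<subseteq> {xx (Inl i)}"
          using True disj[OF a(2,4) \<open>j \<noteq> j'\<close>] unfolding C_def xx_def by auto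
        then show ?thesis using True a by auto
      next
        case False
        have "C i j \<inter> C i' j' = {}"
          using False a wc inj_onD[OF w, of i i'] unfolding C_def by auto
        then show ?thesis by simp
      qed
    qed
    show "finite (C i j) \<and> nsets (C i j) 2 \<subseteq> E" if "i < s" "j < t" for i j
    proof (cases "i < s - 1")
      case True
      have "nsets {w i} 2 = {}" by (auto simp: nsets_def card_2_iff)
      then show ?thesis using True unfolding C_def by simp
    next
      case False then show ?thesis using core[OF that(2)] unfolding C_def by simp
    qed
    show "L i j \<subseteq> {..<p} \<and> card (C i j) + card (L i j) = p + 1" if "i < s" "j < t" for i j
    proof (cases "i < s - 1")
      case True then show ?thesis unfolding C_def L_def by simp
    next
      case False
      have "{i0, q j} \<subseteq> {..<p}" using i0 q[OF that(2)] by simp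
      then have "card ({..<p} - {i0, q j}) + card {i0, q j} = p"
        using card_mono[of "{..<p}" "{i0, q j}"] by (simp add: card_Diff_subset del: card_insert_if)
      then show ?thesis using False core[OF that(2)] unfolding C_def L_def by auto
    qed
    show "l (projr (Inr j :: nat + nat)) \<in> L i j" if "i < s" "j < t" "Inr j \<notin> Inl ` {..<s}" for i j :: nat
      using l[of j] unfolding L_def by auto
    show "slack p s t * (m + 1) \<le> card {y \<in> Y l. \<forall>z\<in>C i j. {z, y} \<in> E}"
      if ij: "i < s" "j < t" and lL: "l \<in> L i j" for i j l
    proof (cases "i < s - 1")
      case True
      then show ?thesis using lL missw[of l i] unfolding C_def L_def by (intro cand) auto
    next
      case False
      then have "l < p" "l \<noteq> i0" "l \<noteq> q j" using lL unfolding L_def by auto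
      then show ?thesis using False core[OF ij(2)] c3[OF ij(2)] missc[of l j] ij(2) unfolding C_def
        by (intro cand) auto
    qed
    show "slack p s t * (m + 1) \<le> card {y \<in> Y (l (projr (Inr j :: nat + nat))). \<forall>i<s. \<forall>z\<in>C i j. {z, y} \<in> E}"
      if j: "j < t" "Inr j \<notin> Inl ` {..<s}" for j
    proof -
      let ?Q = "w ` {..<s - 1} \<union> c j"
      have "card (w ` {..<s - 1}) \<le> s - 1" using card_image_le[of "{..<s - 1}" w] by simp
      then have "card ?Q \<le> s + 3" using card_Un_le[of "w ` {..<s - 1}" "c j"] c3[OF j(1)] by linarith
      then have "slack p s t * (m + 1) \<le> card {y \<in> Y (l j). \<forall>z\<in>?Q. {z, y} \<in> E}"
        using l[of j] core[OF j(1)] missw missc j(1) by (intro cand) auto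
      also have "{y \<in> Y (l j). \<forall>z\<in>?Q. {z, y} \<in> E} = {y \<in> Y (l j). \<forall>i<s. \<forall>z\<in>C i j. {z, y} \<in> E}"
      proof -
        have "?Q = (\<Union>i<s. C i j)"
        proof
          show "?Q \<subseteq> (\<Union>i<s. C i j)"
          proof
            fix z assume "z \<in> ?Q"
            then show "z \<in> (\<Union>i<s. C i j)"
            proof
              assume "z \<in> w ` {..<s - 1}"
              then show ?thesis unfolding C_def by force
            next
              assume "z \<in> c j"
              then have "z \<in> C (s - 1) j" unfolding C_def by simp
              then show ?thesis using st by (intro UN_I[of "s - 1"]) auto
            qed
          qed
          show "(\<Union>i<s. C i j) \<subseteq> ?Q" unfolding C_def by (auto split: if_splits)
        qed
        then show ?thesis by auto
      qed
      finally show ?thesis by simp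
    qed
  qed (use st finY miss in auto)
qed

subsection \<open>Dense graphs are nearly partite\<close>

lemma pigeonhole_fibre:
  assumes "finite X" "finite T" "T \<noteq> {}" "f ` X \<subseteq> T" "M * card T \<le> card X"
  shows "\<exists>\<tau>\<in>T. M \<le> card {v \<in> X. f v = \<tau>}"
proof (rule ccontr)
  assume neg: "\<not> ?thesis"
  have "X = (\<Union>\<tau>\<in>T. {v \<in> X. f v = \<tau>})" using assms(4) by auto
  then have "card X \<le> (\<Sum>\<tau>\<in>T. card {v \<in> X. f v = \<tau>})"
    using card_UN_le[OF assms(2), of "\<lambda>\<tau>. {v \<in> X. f v = \<tau>}"] by simp
  also have "\<dots> < (\<Sum>\<tau>\<in>T. M)"
    using neg assms(2,3) by (intro sum_strict_mono) (auto simp: not_le)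
  finally show False using assms(5) by (simp add: mult.commute)
qed

text \<open>At most \<open>n / p + 1\<close> non-neighbours for every vertex, itself included, with
  the division cleared. The summand \<open>p\<close> is such that deleting a violating vertex raises
  the excess over \<open>base_count\<close> by at least one.\<close>

definition dense :: "nat \<Rightarrow> 'a set \<Rightarrow> 'a set set \<Rightarrow> bool" where
  "dense p V E \<longleftrightarrow> finite V \<and> E \<subseteq> nsets V 2 \<and>
     (\<forall>v\<in>V. p * card (nonnbs V E v) \<le> card V + p)"

definition complete_parts :: "'a set \<Rightarrow> 'a set set \<Rightarrow> nat \<Rightarrow> nat \<Rightarrow> (nat \<Rightarrow> 'a set) \<Rightarrow> bool" where
  "complete_parts V E j M A \<longleftrightarrow> (\<forall>i<j. A i \<subseteq> V \<and> card (A i) = M) \<and>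
     (\<forall>i<j. \<forall>i'<j. i \<noteq> i' \<longrightarrow> (\<forall>a\<in>A i. \<forall>b\<in>A i'. {a, b} \<in> E))"

lemma sum_nonadjacent:
  assumes "finite V" "finite U"
  shows "(\<Sum>v\<in>V. card {a \<in> U. {v, a} \<notin> E}) = (\<Sum>a\<in>U. card (nonnbs V E a))"
proof -
  have "(\<Sum>a\<in>U. card (nonnbs V E a)) = (\<Sum>a\<in>U. card {v \<in> V. {v, a} \<notin> E})"
    unfolding nonnbs_def by (simp add: insert_commute)
  then show ?thesis
    using sum_multicount_gen[OF assms, of "\<lambda>v a. {v, a} \<notin> E" "\<lambda>a. card {v \<in> V. {v, a} \<notin> E}"] by simp
qed

lemma card_complete_parts_Union:
  assumes "complete_parts V E j M A"
  shows "card (\<Union>i<j. A i) \<le> j * M"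
proof -
  have "card (\<Union>i<j. A i) \<le> (\<Sum>i<j. card (A i))" by (rule card_UN_le) simp
  also have "\<dots> = (\<Sum>i<j. M)" using assms by (intro sum.cong) (auto simp: complete_parts_def)
  finally show ?thesis by simp
qed

lemma dense_sum_nonadjacent:
  assumes d: "dense p V E" and A: "complete_parts V E j M A"
  shows "p * (\<Sum>v\<in>V. card {a \<in> (\<Union>i<j. A i). {v, a} \<notin> E}) \<le> j * M * (card V + p)"
proof -
  let ?U = "\<Union>i<j. A i"
  have U: "?U \<subseteq> V" using A unfolding complete_parts_def by blast
  have fin: "finite V" "finite ?U" using d U unfolding dense_def by (auto intro: finite_subset)
  have "p * (\<Sum>v\<in>V. card {a \<in> ?U. {v, a} \<notin> E}) = (\<Sum>a\<in>?U. p * card (nonnbs V E a))"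
    unfolding sum_nonadjacent[OF fin] by (rule sum_distrib_left)
  also have "\<dots> \<le> (\<Sum>a\<in>?U. card V + p)"
    using d U unfolding dense_def by (intro sum_mono) blast
  also have "\<dots> = card ?U * (card V + p)" by simp
  also have "\<dots> \<le> j * M * (card V + p)"
    by (rule mult_right_mono[OF card_complete_parts_Union[OF A]]) simp
  finally show ?thesis .
qed

lemma card_nonadjacent_ge:
  assumes "finite U" "B \<subseteq> U" "card B = M" "card (B \<inter> nbs E v) < m"
  shows "M < card {a \<in> U. {v, a} \<notin> E} + m"
proof -
  have "finite B" using assms by (auto intro: finite_subset)
  have "B = (B \<inter> nbs E v) \<union> {a \<in> B. {v, a} \<notin> E}" unfolding nbs_def by auto
  then have "card B \<le> card (B \<inter> nbs E v) + card {a \<in> B. {v, a} \<notin> E}"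
    using card_Un_le[of "B \<inter> nbs E v" "{a \<in> B. {v, a} \<notin> E}"] by simp
  moreover have "card {a \<in> B. {v, a} \<notin> E} \<le> card {a \<in> U. {v, a} \<notin> E}"
    using assms by (intro card_mono) auto
  ultimately show ?thesis using assms(3,4) by linarith
qed

text \<open>An induction in the manner of Erdos and Stone. A vertex is bad if it has fewer than
  \<open>M\<close> neighbours in one of the \<open>j\<close> parts found so far. Density leaves many
  good vertices, and \<open>M\<close> of them have the same neighbours in all parts; these form the
  new part, and every old part shrinks to \<open>M\<close> of the common neighbours.\<close>

lemma ex_complete_parts:
  assumes "j \<le> p"
  shows "\<exists>n0. \<forall>(V :: 'a set) E. dense p V E \<longrightarrow> n0 \<le> card V \<longrightarrow> (\<exists>A. complete_parts V E j M A)"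
  using assms
proof (induction j arbitrary: M)
  case 0
  then show ?case by (simp add: complete_parts_def)
next
  case (Suc j)
  show ?case
  proof (cases "M = 0")
    case True
    have "complete_parts V E (Suc j) M (\<lambda>_. {})" for V :: "'a set" and E
      using True by (simp add: complete_parts_def)
    then show ?thesis by blast
  next
    case False
    \<comment> \<open>With parts of size \<open>2 * p * M\<close> a bad vertex misses at least
      \<open>(2 * p - 1) * M\<close> vertices, whereas the average is about \<open>2 * j * M\<close>
      with \<open>j \<le> p - 1\<close>; so not almost all vertices can be bad. The constant
      \<open>c0\<close> is \<open>M\<close> times a bound for the number of possible neighbourhoods
      in the parts.\<close>
    define M' where "M' = 2 * p * M"
    define c0 where "c0 = M * 2 ^ (j * M')"
    obtain n1 where n1: "\<And>(V :: 'a set) E. dense p V E \<Longrightarrow> n1 \<le> card V \<Longrightarrow> \<exists>A. complete_parts V E j M' A"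
      using Suc.IH[of M'] Suc.prems by (metis Suc_leD)
    define n0 where "n0 = n1 + 2 * p * p + c0 * (2 * p) + 1"
    have "\<exists>A. complete_parts V E (Suc j) M A" if d: "dense p V E" and n: "n0 \<le> card V" for V :: "'a set" and E
    proof -
      obtain A where A: "complete_parts V E j M' A" using n1[OF d] n unfolding n0_def by auto
      have finV: "finite V" using d unfolding dense_def by blast
      define U where "U = (\<Union>i<j. A i)"
      have UV: "U \<subseteq> V" using A unfolding complete_parts_def U_def by blast
      have finU: "finite U" using UV finV by (rule finite_subset)
      have cU: "card U \<le> j * M'" unfolding U_def by (rule card_complete_parts_Union[OF A])
      define nad where "nad v = card {a \<in> U. {v, a} \<notin> E}" for v
      define Bad where "Bad = {v \<in> V. \<exists>i<j. card (A i \<inter> nbs E v) < M}"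
      have BadV: "Bad \<subseteq> V" and finBad: "finite Bad" unfolding Bad_def using finV by auto
      have bad: "(2 * p - 1) * M \<le> nad v" if vB: "v \<in> Bad" for v
      proof -
        obtain i where i: "i < j" "card (A i \<inter> nbs E v) < M" using vB unfolding Bad_def by blast
        have "A i \<subseteq> U" "card (A i) = M'" using A i unfolding complete_parts_def U_def by auto
        then have "M' < nad v + M" unfolding nad_def using i finU by (intro card_nonadjacent_ge) auto
        moreover have "(2 * p - 1) * M + M = M'"
        proof -
          obtain r where "p = Suc r" using Suc.prems by (cases p) auto
          then show ?thesis unfolding M'_def by (simp add: algebra_simps)
        qed
        ultimately show ?thesis by linarith
      qed
      have "card Bad * ((2 * p - 1) * M) = (\<Sum>v\<in>Bad. (2 * p - 1) * M)" by simp
      also have "\<dots> \<le> (\<Sum>v\<in>Bad. nad v)" by (intro sum_mono bad)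
      also have "\<dots> \<le> (\<Sum>v\<in>V. nad v)" using BadV finV by (intro sum_mono2) auto
      finally have "p * (card Bad * ((2 * p - 1) * M)) \<le> p * (\<Sum>v\<in>V. nad v)" by (rule mult_left_mono) simp
      also have "\<dots> \<le> j * M' * (card V + p)" unfolding nad_def U_def by (rule dense_sum_nonadjacent[OF d A])
      also have "\<dots> \<le> (p - 1) * M' * (card V + p)" using Suc.prems by (intro mult_right_mono) auto
      finally have "(p * M) * (card Bad * (2 * p - 1)) \<le> (p * M) * (2 * (p - 1) * (card V + p))"
        unfolding M'_def by (simp add: algebra_simps)
      then have badle: "card Bad * (2 * p - 1) \<le> 2 * (p - 1) * (card V + p)" using False Suc.prems by simp
      define Good where "Good = V - Bad"
      have cgood: "card Good = card V - card Bad" unfolding Good_def using finBad BadV by (rule card_Diff_subset)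
      have BV: "card Bad \<le> card V" using BadV finV by (rule card_mono[rotated])
      have "c0 \<le> card Good"
      proof (rule ccontr)
        assume "\<not> c0 \<le> card Good"
        then have "card V < card Bad + c0" using cgood BV by linarith
        then have "card V * (2 * p - 1) \<le> (card Bad + c0) * (2 * p - 1)" by (intro mult_right_mono) auto
        also have "\<dots> \<le> 2 * (p - 1) * (card V + p) + c0 * (2 * p - 1)"
          using badle by (simp add: add_mult_distrib)
        finally have *: "card V * (2 * p - 1) \<le> 2 * (p - 1) * (card V + p) + c0 * (2 * p - 1)" .
        obtain r where r: "p = Suc r" using Suc.prems by (cases p) auto
        have "card V * (2 * r + 1) \<le> 2 * r * (card V + p) + c0 * (2 * r + 1)"
          using * unfolding r by simp
        then have "card V \<le> 2 * r * p + c0 * (2 * r + 1)" by (simp add: algebra_simps)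
        moreover have "2 * r * p \<le> 2 * p * p" "c0 * (2 * r + 1) \<le> c0 * (2 * p)" unfolding r by simp_all
        ultimately show False using n unfolding n0_def by linarith
      qed
      moreover have "M * card (Pow U) \<le> c0"
        unfolding c0_def card_Pow[OF finU] using cU by (simp add: power_increasing)
      ultimately have "M * card (Pow U) \<le> card Good" by linarith
      then have "\<exists>\<tau>\<in>Pow U. M \<le> card {v \<in> Good. U \<inter> nbs E v = \<tau>}"
        using finV finU unfolding Good_def by (intro pigeonhole_fibre) auto
      then obtain \<tau> where \<tau>: "M \<le> card {v \<in> Good. U \<inter> nbs E v = \<tau>}" by blast
      obtain X where X: "X \<subseteq> {v \<in> Good. U \<inter> nbs E v = \<tau>}" "card X = M" "finite X"
        by (rule obtain_subset_with_card_n[OF \<tau>])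
      have "X \<noteq> {}" using X(2) False by auto
      then obtain v0 where v0: "v0 \<in> Good" "U \<inter> nbs E v0 = \<tau>" using X(1) by blast
      have "\<exists>B. B \<subseteq> A i \<inter> \<tau> \<and> card B = M" if "i < j" for i
      proof -
        have "A i \<inter> nbs E v0 = A i \<inter> \<tau>" using v0(2) that unfolding U_def by blast
        then have "M \<le> card (A i \<inter> \<tau>)" using v0(1) that unfolding Good_def Bad_def by fastforce
        then show ?thesis using obtain_subset_with_card_n by metis
      qed
      then have "\<forall>i. \<exists>B. i < j \<longrightarrow> B \<subseteq> A i \<inter> \<tau> \<and> card B = M" by blast
      from choice[OF this] obtain B where B: "\<And>i. i < j \<Longrightarrow> B i \<subseteq> A i \<inter> \<tau> \<and> card (B i) = M" by blast
      define A' where "A' i = (if i < j then B i else X)" for i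
      have adjX: "{a, x} \<in> E" if "a \<in> B i" "i < j" "x \<in> X" for a x i
      proof -
        have "a \<in> nbs E x" using B[OF that(2)] that X(1) by blast
        then show ?thesis unfolding nbs_def by (simp add: insert_commute)
      qed
      have AV: "A i \<subseteq> V" if "i < j" for i using A that unfolding complete_parts_def by blast
      have "complete_parts V E (Suc j) M A'"
        unfolding complete_parts_def
      proof (intro conjI allI impI ballI)
        fix i assume "i < Suc j"
        show "A' i \<subseteq> V" using B[of i] AV[of i] X(1) unfolding A'_def Good_def by auto
        show "card (A' i) = M" using B[of i] X(2) unfolding A'_def by auto
      next
        fix i i' a b assume h: "i < Suc j" "i' < Suc j" "i \<noteq> i'" "a \<in> A' i" "b \<in> A' i'"
        consider "i < j" "i' < j" | "i < j" "i' = j" | "i = j" "i' < j" using h by linarith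
        then show "{a, b} \<in> E"
        proof cases
          case 1
          then have "a \<in> A i" "b \<in> A i'" using h B unfolding A'_def by auto
          then show ?thesis using A 1 h(3) unfolding complete_parts_def by blast
        next
          case 2 then show ?thesis using h adjX[of a i b] unfolding A'_def by auto
        next
          case 3 then show ?thesis using h adjX[of b i' a] unfolding A'_def by (auto simp: insert_commute)
        qed
      qed
      then show ?thesis by blast
    qed
    then show ?thesis by blast
  qed
qed

section \<open>Near-partitions of dense graphs into independent sets\<close>

lemma ex_vertex_cover:
  assumes fin: "finite J" and J2: "\<And>e. e \<in> J \<Longrightarrow> card e = 2"
  shows "\<exists>C. finite C \<and> card C \<le> 2 * mnum J \<and> (\<forall>e\<in>J. e \<inter> C \<noteq> {}) \<and> C \<subseteq> \<Union>J"
proof -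
  obtain M where M: "is_max_matching J M" using ex_max_matching[OF fin] by blast
  then have MJ: "M \<subseteq> J" "matching M" unfolding is_max_matching_def by auto
  have finM: "finite M" using MJ(1) fin by (rule finite_subset)
  have "card (\<Union>M) = 2 * mnum J"
    using card_Union_matching[OF MJ(2) _ finM] MJ(1) J2 mnum_props(3)[OF fin M] by auto
  moreover have "finite (\<Union>M)"
  proof (rule finite_Union[OF finM])
    show "finite e" if "e \<in> M" for e using J2[of e] MJ(1) that by (intro card_ge_0_finite) auto
  qed
  moreover have "e \<inter> \<Union>M \<noteq> {}" if e: "e \<in> J" for e
  proof
    assume d: "e \<inter> \<Union>M = {}"
    have "e \<noteq> {}" using J2[OF e] by auto
    then have "e \<notin> M" using d by blast
    have "matching (insert e M)" using MJ(2) d unfolding matching_def by blast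
    then have "card (insert e M) \<le> card M" using M MJ(1) e unfolding is_max_matching_def by blast
    then show False using \<open>e \<notin> M\<close> finM by simp
  qed
  ultimately show ?thesis using MJ(1) by (intro exI[of _ "\<Union>M"]) auto
qed

lemma mnum_lt_if_no_split:
  assumes fin: "finite J" and ns: "\<not> split_in s t J"
  shows "mnum J < s * t"
proof (rule ccontr)
  assume "\<not> ?thesis"
  obtain M where M: "M \<subseteq> J" "matching M" "card M = mnum J" using mnum_props(2)[OF fin] by blast
  then have "split_in s t M" using \<open>\<not> mnum J < s * t\<close> fin
    by (intro matching_imp_split) (auto intro: finite_subset)
  then have "split_in s t J" using M(1) unfolding split_in_def by blast
  then show False using ns by blast
qed

text \<open>A complete partite subgraph of constant size sorts the vertices. Few see all of its
  parts, by \<open>wide_embed\<close>; few miss much more than one part, since \<open>M\<close>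
  missed vertices is about the average. The others are nearly joined to all parts but one, which
  determines their class. A class contains no split, hence has a small vertex cover, and removing it
  leaves an independent set.\<close>

lemma ex_near_parts:
  fixes e :: real
  assumes st: "1 \<le> s" "1 \<le> t" and p: "3 \<le> p" and e: "e > 0"
  shows "\<exists>n0. \<forall>(V :: 'a set) E. dense p V E \<longrightarrow> n0 \<le> card V \<longrightarrow> \<not> clique_system (p + 1) s t E \<longrightarrow>
     (\<exists>U. (\<forall>i<p. U i \<subseteq> V) \<and> (\<forall>i<p. \<forall>j<p. i \<noteq> j \<longrightarrow> U i \<inter> U j = {}) \<and>
       (\<forall>i<p. \<forall>x\<in>U i. \<forall>y\<in>U i. {x, y} \<notin> E) \<and>
       real (card (V - (\<Union>i<p. U i))) \<le> e * real (card V))"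
proof -
  define m0 where "m0 = slack p s t"
  have m0: "1 \<le> m0" unfolding m0_def slack_def using st by simp
  \<comment> \<open>The choice of \<open>q\<close> limits the atypical vertices to a proportion
    \<open>e / 2\<close> up to a constant; the other half of \<open>e\<close> absorbs all constants,
    collected in \<open>c2\<close>.\<close>
  obtain q0 :: nat where q0: "2 / e \<le> real q0" using real_arch_simple by blast
  define q where "q = q0 + 1"
  have q: "real q \<ge> 2 / e" "q \<ge> 1" unfolding q_def using q0 by simp_all
  have qe: "1 / real q \<le> e / 2" using q e by (simp add: field_simps)
  \<comment> \<open>Large enough for \<open>split_embed\<close> with up to \<open>q * m0\<close>
    missing neighbours.\<close>
  define M where "M = (slack p s t + 2 * s + 2 * t) * (q * m0 + 1)"
  have Mm0: "m0 \<le> M" unfolding M_def m0_def[symmetric] using m0 by (simp add: algebra_simps)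
  define c1 where "c1 = s * 2 ^ (p * M)"
  define c2 where "c2 = c1 + M * p + c1 * M + p * (2 * (s * t))"
  obtain n1 where n1: "\<And>(V :: 'a set) E. dense p V E \<Longrightarrow> n1 \<le> card V \<Longrightarrow> \<exists>A. complete_parts V E p M A"
    using ex_complete_parts[of p p M] by auto
  obtain n2 :: nat where n2: "real n2 \<ge> 2 * real c2 / e" using real_arch_simple by blast
  show ?thesis
  proof (intro exI[of _ "n1 + n2"] allI impI)
    fix V :: "'a set" and E
    assume d: "dense p V E" and n: "n1 + n2 \<le> card V" and F: "\<not> clique_system (p + 1) s t E"
    obtain A where A: "complete_parts V E p M A" using n1[OF d] n by auto
    have finV: "finite V" and E2: "E \<subseteq> nsets V 2" using d unfolding dense_def by auto
    define UA where "UA = (\<Union>i<p. A i)"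
    have AV: "A i \<subseteq> V" "card (A i) = M" "finite (A i)" if "i < p" for i
      using A that finite_subset[OF _ finV, of "A i"] unfolding complete_parts_def by blast+
    have finUA: "finite UA" unfolding UA_def using AV by blast
    have cUA: "card UA \<le> p * M" unfolding UA_def by (rule card_complete_parts_Union[OF A])
    have Across: "{y, z} \<in> E" if "l < p" "l' < p" "l \<noteq> l'" "y \<in> A l" "z \<in> A l'" for l l' y z
      using A that unfolding complete_parts_def by blast
    have Amiss: "card {z \<in> A l'. {y, z} \<notin> E} = 0" if "l < p" "l' < p" "l \<noteq> l'" "y \<in> A l" for l l' y
    proof -
      have "{z \<in> A l'. {y, z} \<notin> E} = {}" using Across that by blast
      then show ?thesis by (simp only: card.empty)
    qed
    define nad where "nad v = card {a \<in> UA. {v, a} \<notin> E}" for v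
    define T where "T = {v \<in> V. \<forall>i<p. m0 \<le> card (A i \<inter> nbs E v)}"
    have finT: "finite T" unfolding T_def using finV by simp
    \<comment> \<open>More than \<open>c1\<close> such vertices would include \<open>s\<close> with
      the same neighbours in \<open>UA\<close>, which are then common neighbours.\<close>
    have cT: "card T \<le> c1"
    proof (rule ccontr)
      assume "\<not> card T \<le> c1"
      have "s * card (Pow UA) \<le> c1"
        unfolding c1_def card_Pow[OF finUA] using cUA by (simp add: power_increasing)
      then have "\<exists>\<tau>\<in>Pow UA. s \<le> card {v \<in> T. UA \<inter> nbs E v = \<tau>}"
        using finT finUA \<open>\<not> card T \<le> c1\<close> by (intro pigeonhole_fibre) auto
      then obtain \<tau> where \<tau>: "s \<le> card {v \<in> T. UA \<inter> nbs E v = \<tau>}" by blast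
      let ?X = "{v \<in> T. UA \<inter> nbs E v = \<tau>}"
      have "\<exists>w. w ` {..<s} \<subseteq> ?X \<and> inj_on w {..<s}"
        using \<tau> finT by (intro card_le_inj) auto
      then obtain w where w: "w ` {..<s} \<subseteq> ?X" "inj_on w {..<s}" by (elim exE conjE)
      have wi: "w i \<in> T" "UA \<inter> nbs E (w i) = \<tau>" if "i < s" for i using w(1) that by auto
      have set_eq: "{y \<in> A l. {w i, y} \<in> E} = A l \<inter> nbs E (w i)" for l i unfolding nbs_def by auto
      have "clique_system (p + 1) s t E"
      proof (rule wide_embed[OF st w(2), where Y = A and m = 0 and lc = 0])
        show "slack p s t * (0 + 1) \<le> card {y \<in> A l. {w i, y} \<in> E}" if "i < s" "l < p" for i l
          unfolding set_eq using wi[OF that(1)] that(2) unfolding T_def m0_def by auto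
        have "{y \<in> A 0. \<forall>i<s. {w i, y} \<in> E} = A 0 \<inter> nbs E (w 0)"
        proof -
          have "A 0 \<inter> nbs E (w i) = A 0 \<inter> nbs E (w 0)" if "i < s" for i
          proof -
            have "A 0 \<subseteq> UA" unfolding UA_def using p by (intro UN_upper) auto
            moreover have "UA \<inter> nbs E (w i) = UA \<inter> nbs E (w 0)"
              using wi(2)[OF that] wi(2)[of 0] st by simp
            ultimately show ?thesis by blast
          qed
          then have "(y \<in> A 0 \<and> {w i, y} \<in> E) \<longleftrightarrow> (y \<in> A 0 \<and> {w 0, y} \<in> E)" if "i < s" for i y
            using that unfolding nbs_def by blast
          moreover have "0 < s" using st by simp
          ultimately show ?thesis unfolding nbs_def by blast
        qed
        then show "slack p s t * (0 + 1) \<le> card {y \<in> A 0. \<forall>i<s. {w i, y} \<in> E}"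
          using wi[of 0] st p unfolding T_def m0_def by auto
        show "card {z \<in> A l'. {y, z} \<notin> E} \<le> 0" if "l < p" "l' < p" "l \<noteq> l'" "y \<in> A l" for l l' y
          using Amiss[OF that] by simp
      qed (use AV p in auto)
      then show False using F by blast
    qed
    have nadT: "\<exists>i<p. card (A i \<inter> nbs E v) < m0" if "v \<in> V - T" for v
      using that unfolding T_def by (auto simp: not_le)
    have nad_ge: "M - m0 \<le> nad v" if v: "v \<in> V - T" for v
    proof -
      obtain i where i: "i < p" "card (A i \<inter> nbs E v) < m0" using nadT[OF v] by blast
      have "M < nad v + m0" unfolding nad_def
        using i AV[OF i(1)] finUA by (intro card_nonadjacent_ge[of _ "A i"]) (auto simp: UA_def)
      then show ?thesis by linarith
    qed
    \<comment> \<open>Outside \<open>T\<close> every vertex misses at least \<open>M - m0\<close>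
      vertices of \<open>UA\<close>, already close to the average. Exceeding this minimum by
      \<open>q * m0\<close> is possible only for about a fraction \<open>1 / q\<close> of the
      vertices.\<close>
    define B where "B = {v \<in> V - T. M - m0 + q * m0 \<le> nad v}"
    have finB: "finite B" and BV: "B \<subseteq> V - T" unfolding B_def using finV by auto
    have cB: "card B * (q * m0) \<le> m0 * card V + M * p + c1 * M"
    proof -
      have "p * (\<Sum>v\<in>V. nad v) \<le> p * M * (card V + p)"
        unfolding nad_def UA_def by (rule dense_sum_nonadjacent[OF d A])
      then have "(\<Sum>v\<in>V. nad v) \<le> M * (card V + p)" using p by (simp add: mult.assoc)
      moreover have "(\<Sum>v\<in>V-T. (M - m0) + (if v \<in> B then q * m0 else 0)) \<le> (\<Sum>v\<in>V-T. nad v)"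
        using nad_ge by (intro sum_mono) (auto simp: B_def)
      moreover have "(\<Sum>v\<in>V-T. (M - m0) + (if v \<in> B then q * m0 else 0)) =
          card (V - T) * (M - m0) + card B * (q * m0)"
      proof -
        have "(\<Sum>v\<in>V-T. if v \<in> B then q * m0 else 0) = (\<Sum>v\<in>B. q * m0)"
          using finV BV by (simp add: sum.inter_restrict[symmetric] Int_absorb1)
        then show ?thesis by (simp add: sum.distrib)
      qed
      moreover have "(\<Sum>v\<in>V-T. nad v) \<le> (\<Sum>v\<in>V. nad v)" using finV by (intro sum_mono2) auto
      ultimately have 1: "card (V - T) * (M - m0) + card B * (q * m0) \<le> M * (card V + p)" by linarith
      have TV: "T \<subseteq> V" unfolding T_def by blast
      have "card V * (M - m0) \<le> card (V - T) * (M - m0) + c1 * M"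
      proof -
        have "card V = card (V - T) + card T"
          using TV finV finT by (simp add: card_Diff_subset card_mono)
        then have "card V * (M - m0) = card (V - T) * (M - m0) + card T * (M - m0)"
          by (simp add: add_mult_distrib)
        moreover have "card T * (M - m0) \<le> c1 * M" using cT by (intro mult_mono) auto
        ultimately show ?thesis by linarith
      qed
      moreover have "card V * (M - m0) + card V * m0 = card V * M"
        using Mm0 by (simp add: diff_mult_distrib2)
      moreover have "M * (card V + p) = card V * M + M * p" by (simp add: algebra_simps)
      moreover have "m0 * card V = card V * m0" by simp
      ultimately show ?thesis using 1 by linarith
    qed
    have cB': "real (card B) \<le> e / 2 * real (card V) + real (M * p + c1 * M)"
    proof -
      have "real (card B) * (real q * real m0) \<le> real m0 * real (card V) + real (M * p + c1 * M)"
        using cB by (metis (mono_tags) of_nat_add of_nat_le_iff of_nat_mult add.assoc)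
      also have "\<dots> \<le> real m0 * real (card V) + (real q * real m0) * real (M * p + c1 * M)"
      proof -
        have "1 * real (M * p + c1 * M) \<le> (real q * real m0) * real (M * p + c1 * M)"
          using q(2) m0 by (intro mult_right_mono) (auto simp: mult_ge1_I)
        then show ?thesis by simp
      qed
      also have "\<dots> = (real q * real m0) * (1 / real q * real (card V) + real (M * p + c1 * M))"
        using q(2) by (simp add: field_simps)
      finally have "real (card B) \<le> 1 / real q * real (card V) + real (M * p + c1 * M)"
        using q(2) m0 by (simp add: mult.commute[of "real (card B)"])
      also have "\<dots> \<le> e / 2 * real (card V) + real (M * p + c1 * M)"
        using qe by (intro add_right_mono mult_right_mono) auto
      finally show ?thesis .
    qed
    \<comment> \<open>The class of \<open>v\<close> is the index of a part in which it has few
      neighbours.\<close>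
    define \<iota> where "\<iota> v = (SOME i. i < p \<and> card (A i \<inter> nbs E v) < m0)" for v
    have \<iota>: "\<iota> v < p" "card (A (\<iota> v) \<inter> nbs E v) < m0" if "v \<in> V - T" for v
      using someI_ex[OF nadT[OF that, unfolded Bex_def]] unfolding \<iota>_def by auto
    define V0 where "V0 i = {v \<in> V - T - B. \<iota> v = i}" for i
    define J where "J i = {e \<in> E. e \<subseteq> V0 i}" for i
    have finE: "finite E" using finite_subset[OF E2] finV by simp
    have missV0: "card {y \<in> A l. {v, y} \<notin> E} \<le> q * m0" if "i < p" "v \<in> V0 i" "l < p" "l \<noteq> i" for i v l
    proof -
      have v: "v \<in> V - T" "v \<notin> B" "\<iota> v = i" using that unfolding V0_def by auto
      have lt: "nad v < M - m0 + q * m0" using v unfolding B_def by auto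
      have "M < card {a \<in> A i. {v, a} \<notin> E} + m0"
        using \<iota>(2)[OF v(1)] v(3) AV[OF that(1)] by (intro card_nonadjacent_ge[of _ "A i"]) auto
      moreover have "card {a \<in> A i. {v, a} \<notin> E} + card {y \<in> A l. {v, y} \<notin> E} \<le> nad v"
      proof -
        have "A i \<inter> A l = {}"
        proof (rule ccontr)
          assume "A i \<inter> A l \<noteq> {}"
          then obtain z where z: "z \<in> A i" "z \<in> A l" by blast
          have "{z, z} \<in> E" using Across[of i l z z] that z by auto
          then show False using E2 by (auto simp: nsets_def)
        qed
        then have "card {a \<in> A i. {v, a} \<notin> E} + card {y \<in> A l. {v, y} \<notin> E} =
            card ({a \<in> A i. {v, a} \<notin> E} \<union> {y \<in> A l. {v, y} \<notin> E})"
          using AV that by (intro card_Un_disjoint[symmetric]) auto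
        also have "\<dots> \<le> nad v" unfolding nad_def using finUA that
          by (intro card_mono) (auto simp: UA_def)
        finally show ?thesis .
      qed
      ultimately show ?thesis using lt Mm0 by linarith
    qed
    have Jsub: "J i \<subseteq> nsets (V0 i) 2" for i using E2 unfolding J_def nsets_def by auto
    have finJ: "finite (J i)" and J2: "\<And>e. e \<in> J i \<Longrightarrow> card e = 2" for i
      using finE E2 unfolding J_def nsets_def by auto
    have mJ: "mnum (J i) < s * t" if i: "i < p" for i
    proof (rule mnum_lt_if_no_split[OF finJ])
      show "\<not> split_in s t (J i)"
      proof
        assume "split_in s t (J i)"
        then have "clique_system (p + 1) s t E"
        proof (rule split_embed[OF st p i, where Y = A and m = "q * m0" and D = "V0 i"])
          show "J i \<subseteq> E" unfolding J_def by blast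
          show "card {z \<in> A l'. {y, z} \<notin> E} \<le> q * m0" if "l < p" "l' < p" "l \<noteq> l'" "y \<in> A l" for l l' y
            using Amiss[OF that] by simp
          show "card {y \<in> A l. {v, y} \<notin> E} \<le> q * m0" if "l < p" "l \<noteq> i" "v \<in> V0 i" for l v
            using missV0 i that by blast
          show "(slack p s t + 2 * s + 2 * t) * (q * m0 + 1) \<le> card (A l)" if "l < p" for l
            using AV[OF that] unfolding M_def by simp
        qed (use Jsub AV in auto)
        then show False using F by blast
      qed
    qed
    have "\<forall>i. \<exists>C. finite C \<and> card C \<le> 2 * mnum (J i) \<and> (\<forall>e\<in>J i. e \<inter> C \<noteq> {}) \<and> C \<subseteq> \<Union>(J i)"
      by (intro allI ex_vertex_cover finJ J2)
    from choice[OF this] obtain C where "\<forall>i. finite (C i) \<and> card (C i) \<le> 2 * mnum (J i) \<and>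
      (\<forall>e\<in>J i. e \<inter> C i \<noteq> {}) \<and> C i \<subseteq> \<Union>(J i)" by (rule exE)
    then have C: "\<And>i. finite (C i)" "\<And>i. card (C i) \<le> 2 * mnum (J i)"
      "\<And>i e. e \<in> J i \<Longrightarrow> e \<inter> C i \<noteq> {}" by simp_all
    \<comment> \<open>Each class loses a vertex cover of its inner edges, at most
      \<open>2 * (s * t)\<close> vertices.\<close>
    define U where "U i = V0 i - C i" for i
    have "V - (\<Union>i<p. U i) \<subseteq> T \<union> B \<union> (\<Union>i<p. C i)"
      using \<iota>(1) unfolding U_def V0_def by blast
    then have "card (V - (\<Union>i<p. U i)) \<le> card (T \<union> B \<union> (\<Union>i<p. C i))"
      using finT finB C(1) by (intro card_mono) auto
    also have "\<dots> \<le> card T + card B + card (\<Union>i<p. C i)"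
      by (meson card_Un_le add_mono order_refl order_trans)
    also have "card (\<Union>i<p. C i) \<le> p * (2 * (s * t))"
    proof -
      have "card (\<Union>i<p. C i) \<le> (\<Sum>i<p. card (C i))" by (rule card_UN_le) simp
      also have "\<dots> \<le> (\<Sum>i<p. 2 * (s * t))"
      proof (intro sum_mono)
        fix i assume "i \<in> {..<p}"
        then show "card (C i) \<le> 2 * (s * t)" using C(2)[of i] mJ[of i] by simp
      qed
      finally show ?thesis by simp
    qed
    finally have "real (card (V - (\<Union>i<p. U i))) \<le> real (card T + card B + p * (2 * (s * t)))" by linarith
    also have "\<dots> \<le> e / 2 * real (card V) + real c2"
      using cB' cT unfolding c2_def by simp
    also have "\<dots> \<le> e * real (card V)"
    proof -
      have "2 * real c2 / e \<le> real (card V)" using n2 n by linarith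
      then show ?thesis using e by (simp add: field_simps)
    qed
    finally have "real (card (V - (\<Union>i<p. U i))) \<le> e * real (card V)" .
    moreover have "{x, y} \<notin> E" if "x \<in> U i" "y \<in> U i" for i x y
    proof
      assume "{x, y} \<in> E"
      then have "{x, y} \<in> J i" using that unfolding J_def U_def by auto
      then show False using C(3)[of "{x, y}" i] that unfolding U_def by blast
    qed
    moreover have "U i \<inter> U j = {}" if "i \<noteq> j" for i j using that unfolding U_def V0_def by blast
    moreover have "U i \<subseteq> V" for i unfolding U_def V0_def by blast
    ultimately show "\<exists>U. (\<forall>i<p. U i \<subseteq> V) \<and> (\<forall>i<p. \<forall>j<p. i \<noteq> j \<longrightarrow> U i \<inter> U j = {}) \<and>
       (\<forall>i<p. \<forall>x\<in>U i. \<forall>y\<in>U i. {x, y} \<notin> E) \<and>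
       real (card (V - (\<Union>i<p. U i))) \<le> e * real (card V)"
      by (intro exI[of _ U] conjI allI impI ballI) simp_all
  qed
qed

section \<open>Growth of the Turan numbers, choice of parameters, counting estimates\<close>

lemma turan_edges_diff:
  assumes p: "p \<ge> 1" and ab: "a \<le> b"
  shows "real (turan_edges p a) + real (b - a) * (real a - real a / real p) \<le> real (turan_edges p b)"
    and "real (turan_edges p b) \<le> real (turan_edges p a) + real (b - a) * (real b - real b / real p + 1)"
proof -
  have tstep: "real (turan_edges p (Suc m)) = real (turan_edges p m) + real m - real (m div p)" for m
    using turan_edges_Suc[OF p, of m] by linarith
  have dv: "real (m div p) \<le> real m / real p" "real m / real p - 1 \<le> real (m div p)" for m
  proof -
    have "m div p * p \<le> m" by simp
    then have "real (m div p) * real p \<le> real m" by (metis of_nat_le_iff of_nat_mult)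
    then show "real (m div p) \<le> real m / real p" using p by (simp add: pos_le_divide_eq)
    have "m \<le> (m div p + 1) * p" using dividend_less_div_times[of p m] p by (simp add: mult.commute)
    then have "real m \<le> (real (m div p) + 1) * real p"
      by (metis of_nat_le_iff of_nat_mult of_nat_add of_nat_1)
    then have "real m / real p \<le> real (m div p) + 1" using p by (simp add: pos_divide_le_eq)
    then show "real m / real p - 1 \<le> real (m div p)" by linarith
  qed
  have mono: "real x - real x / real p \<le> real y - real y / real p" if "x \<le> y" for x y
  proof -
    have "real x * (1 - 1 / real p) \<le> real y * (1 - 1 / real p)"
      using that p by (intro mult_right_mono) auto
    then show ?thesis by (simp add: algebra_simps)
  qed
  show "real (turan_edges p a) + real (b - a) * (real a - real a / real p) \<le> real (turan_edges p b)"
    using ab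
  proof (induction b rule: dec_induct)
    case (step n)
    have "real (Suc n - a) = real (n - a) + 1" using step.hyps by (simp add: Suc_diff_le)
    then have "real (Suc n - a) * (real a - real a / real p) =
        real (n - a) * (real a - real a / real p) + (real a - real a / real p)"
      by (simp only: distrib_right mult_1)
    then show ?case using step.IH tstep[of n] dv(1)[of n] mono[OF step.hyps(1)]
      by linarith
  qed simp
  show "real (turan_edges p b) \<le> real (turan_edges p a) + real (b - a) * (real b - real b / real p + 1)"
  proof -
    have "real (turan_edges p c) \<le> real (turan_edges p a) + real (c - a) * (real b - real b / real p + 1)"
      if "a \<le> c" "c \<le> b" for c
      using that
    proof (induction c rule: dec_induct)
      case (step n)
      have "real (Suc n - a) = real (n - a) + 1" using step.hyps by (simp add: Suc_diff_le)
      then have "real (Suc n - a) * (real b - real b / real p + 1) =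
          real (n - a) * (real b - real b / real p + 1) + (real b - real b / real p + 1)"
        by (simp only: distrib_right mult_1)
      then show ?case using step.IH step.prems tstep[of n] dv(2)[of n] mono[of n b]
        by linarith
    qed simp
    then show ?thesis using ab by simp
  qed
qed

text \<open>A list of pairs \<open>(c, b)\<close> encodes finitely many requirements on one small
  parameter, so that they can be met in a single step; \<open>ex_large\<close> does the same for a
  large \<open>n\<close>.\<close>

lemma ex_small:
  assumes "\<forall>(c, b)\<in>set L. (b :: real) > 0"
  shows "\<exists>d>0. \<forall>(c, b)\<in>set L. c * d \<le> b"
  using assms
proof (induction L)
  case Nil
  show ?case by (intro exI[of _ 1]) simp
next
  case (Cons a L)
  obtain c b where a: "a = (c, b)" by (cases a)
  obtain d where d: "d > 0" "\<forall>(c, b)\<in>set L. c * d \<le> b" using Cons by auto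
  have b: "b > 0" using Cons.prems a by simp
  define e where "e = min d (b / (\<bar>c\<bar> + 1))"
  have e: "e > 0" "e \<le> d" "e \<le> b / (\<bar>c\<bar> + 1)" unfolding e_def using d b by auto
  have "c * e \<le> b"
  proof -
    have "c * e \<le> (\<bar>c\<bar> + 1) * e" using e by (intro mult_right_mono) auto
    also have "\<dots> \<le> b" using e(3) by (simp add: field_simps)
    finally show ?thesis .
  qed
  moreover have "c' * e \<le> b'" if "(c', b') \<in> set L" for c' b'
  proof (cases "c' \<ge> 0")
    case True
    then have "c' * e \<le> c' * d" using e by (intro mult_left_mono) auto
    then show ?thesis using d that by fastforce
  next
    case False
    then have "c' * e \<le> 0" using e by (simp add: mult_nonpos_nonneg)
    moreover have "b' > 0" using Cons.prems that by auto
    ultimately show ?thesis by linarith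
  qed
  ultimately show ?case using e(1) a by (intro exI[of _ e]) auto
qed

lemma ex_large:
  assumes "\<forall>(c, b)\<in>set L. (c :: real) > 0"
  shows "\<exists>n0. \<forall>n\<ge>n0. \<forall>(c, b)\<in>set L. b \<le> c * real n"
  using assms
proof (induction L)
  case Nil
  show ?case by simp
next
  case (Cons a L)
  obtain c b where a: "a = (c, b)" by (cases a)
  obtain n0 where n0: "\<And>n. n \<ge> n0 \<Longrightarrow> \<forall>(c, b)\<in>set L. b \<le> c * real n" using Cons by auto
  have c: "c > 0" using Cons.prems a by simp
  obtain n1 :: nat where n1: "real n1 \<ge> b / c" using real_arch_simple by blast
  have "b \<le> c * real n" if "n \<ge> n1" for n
  proof -
    have "b / c \<le> real n" using n1 that by linarith
    then show ?thesis using c by (simp add: field_simps)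
  qed
  then have "\<forall>n\<ge>max n0 n1. \<forall>(c, b)\<in>set (a # L). b \<le> c * real n" using n0 a by auto
  then show ?case by blast
qed

text \<open>Double counting. A vertex with at least \<open>s\<close> neighbours in \<open>X\<close>
  lies in \<open>Z\<close> or is a common neighbour of one of at most \<open>2 ^ card X\<close>
  subsets of size \<open>s\<close>. All other vertices contribute at most \<open>s - 1\<close> to
  the degree sum.\<close>

lemma sum_degrees_le:
  assumes fin: "finite V" "finite X" and Zs: "\<And>S. \<lbrakk>S \<subseteq> X; card S = s\<rbrakk> \<Longrightarrow>
      card {y \<in> V - Z. \<forall>w\<in>S. {w, y} \<in> E} \<le> b" and s: "1 \<le> s"
  shows "(\<Sum>w\<in>X. card (V \<inter> nbs E w)) \<le> (s - 1) * card V + card X * (card (V \<inter> Z) + 2 ^ card X * b)"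
proof -
  let ?c = "\<lambda>u. card {w \<in> X. {w, u} \<in> E}"
  define B where "B = {u \<in> V. s \<le> ?c u}"
  have finB: "finite B" unfolding B_def using fin by simp
  define \<S> where "\<S> = {S. S \<subseteq> X \<and> card S = s}"
  have fin\<S>: "finite \<S>" unfolding \<S>_def using fin by simp
  have c\<S>: "card \<S> \<le> 2 ^ card X"
    using card_mono[of "Pow X" \<S>] fin(2) unfolding \<S>_def by (auto simp: card_Pow)
  have "B \<subseteq> (V \<inter> Z) \<union> (\<Union>S\<in>\<S>. {y \<in> V - Z. \<forall>w\<in>S. {w, y} \<in> E})"
  proof
    fix u assume u: "u \<in> B"
    obtain S where "S \<subseteq> {w \<in> X. {w, u} \<in> E}" "card S = s"
      using obtain_subset_with_card_n[of s "{w \<in> X. {w, u} \<in> E}"] u unfolding B_def by blast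
    then show "u \<in> (V \<inter> Z) \<union> (\<Union>S\<in>\<S>. {y \<in> V - Z. \<forall>w\<in>S. {w, y} \<in> E})"
      using u unfolding B_def \<S>_def by blast
  qed
  then have "card B \<le> card ((V \<inter> Z) \<union> (\<Union>S\<in>\<S>. {y \<in> V - Z. \<forall>w\<in>S. {w, y} \<in> E}))"
    using fin fin\<S> by (intro card_mono) auto
  also have "\<dots> \<le> card (V \<inter> Z) + card (\<Union>S\<in>\<S>. {y \<in> V - Z. \<forall>w\<in>S. {w, y} \<in> E})" by (rule card_Un_le)
  also have "card (\<Union>S\<in>\<S>. {y \<in> V - Z. \<forall>w\<in>S. {w, y} \<in> E}) \<le> (\<Sum>S\<in>\<S>. card {y \<in> V - Z. \<forall>w\<in>S. {w, y} \<in> E})"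
    by (rule card_UN_le[OF fin\<S>])
  also have "\<dots> \<le> (\<Sum>S\<in>\<S>. b)" using Zs unfolding \<S>_def by (intro sum_mono) auto
  also have "\<dots> \<le> 2 ^ card X * b" using c\<S> by simp
  finally have cB: "card B \<le> card (V \<inter> Z) + 2 ^ card X * b" by simp
  have "(\<Sum>w\<in>X. card (V \<inter> nbs E w)) = (\<Sum>w\<in>X. card {u \<in> V. {w, u} \<in> E})"
    unfolding nbs_def by (intro sum.cong) (auto intro: arg_cong[of _ _ card])
  also have "\<dots> = (\<Sum>u\<in>V. ?c u)"
    using sum_multicount_gen[OF fin(2,1), of "\<lambda>w u. {w, u} \<in> E" ?c] by simp
  also have "\<dots> \<le> (\<Sum>u\<in>V. (s - 1) + (if u \<in> B then card X else 0))"
  proof (rule sum_mono)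
    fix u assume "u \<in> V"
    have "?c u \<le> card X" using fin(2) by (intro card_mono) auto
    then show "?c u \<le> (s - 1) + (if u \<in> B then card X else 0)"
      using \<open>u \<in> V\<close> unfolding B_def by auto
  qed
  also have "\<dots> = (s - 1) * card V + card X * card B"
  proof -
    have "(\<Sum>u\<in>V. if u \<in> B then card X else 0) = (\<Sum>u\<in>V \<inter> B. card X)"
      by (rule sum.inter_restrict[OF fin(1), symmetric])
    also have "V \<inter> B = B" unfolding B_def by blast
    finally show ?thesis by (simp add: sum.distrib mult.commute)
  qed
  also have "\<dots> \<le> (s - 1) * card V + card X * (card (V \<inter> Z) + 2 ^ card X * b)"
    using cB by (intro add_left_mono mult_left_mono) auto
  finally show ?thesis .
qed

text \<open>After each vertex of \<open>V - W\<close> is assigned to one set \<open>P i\<close>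
  containing it, an edge meets \<open>W\<close>, joins two classes, or lies inside some
  \<open>P i\<close>. The second kind is bounded by the Turan number.\<close>

lemma card_edges_le_parts:
  assumes finV: "finite V" and E2: "E \<subseteq> nsets V 2" and p: "p \<ge> 1"
    and W: "W \<subseteq> V" and P: "V - W \<subseteq> (\<Union>i<p. P i)"
  shows "card E \<le> (\<Sum>w\<in>W. card (V \<inter> nbs E w)) + turan_edges p (card V - card W) +
    (\<Sum>i<p. card {e \<in> E. e \<subseteq> P i})"
proof -
  define part where "part v = (SOME i. i < p \<and> v \<in> P i)" for v
  have part: "part v < p \<and> v \<in> P (part v)" if "v \<in> V - W" for v
    unfolding part_def by (rule someI_ex) (use that P in blast)
  have finW: "finite W" using W finV by (rule finite_subset)
  have finE: "finite E" using finite_subset[OF E2] finV by simp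
  let ?EW = "\<Union>w\<in>W. (\<lambda>u. {w, u}) ` (V \<inter> nbs E w)"
  let ?EC = "{e \<in> nsets (V - W) 2. card (part ` e) = 2}"
  let ?EP = "\<Union>i<p. {e \<in> E. e \<subseteq> P i}"
  have "E \<subseteq> ?EW \<union> (?EC \<union> ?EP)"
  proof
    fix e assume e: "e \<in> E"
    then obtain u v where uv: "e = {u, v}" "u \<noteq> v" "u \<in> V" "v \<in> V" using E2 by (blast elim: nsets_2_E)
    show "e \<in> ?EW \<union> (?EC \<union> ?EP)"
    proof (cases "u \<in> W \<or> v \<in> W")
      case True
      then show ?thesis
      proof
        assume "u \<in> W"
        then show ?thesis using uv e unfolding nbs_def by (intro UnI1 UN_I[of u]) auto
      next
        assume "v \<in> W"
        then show ?thesis using uv e unfolding nbs_def by (intro UnI1 UN_I[of v]) (auto simp: insert_commute)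
      qed
    next
      case False
      then have VW: "u \<in> V - W" "v \<in> V - W" using uv by auto
      show ?thesis
      proof (cases "part u = part v")
        case True
        have "u \<in> P (part u)" "v \<in> P (part v)" using part[OF VW(1)] part[OF VW(2)] by blast+
        then have "e \<subseteq> P (part u)" using uv(1) True by simp
        then show ?thesis using part[OF VW(1)] e by blast
      next
        case False
        then have "e \<in> ?EC" using uv VW by simp
        then show ?thesis by blast
      qed
    qed
  qed
  moreover have finEC: "finite ?EC" using finV by simp
  moreover have finEW: "finite ?EW" using finW finV by blast
  ultimately have "card E \<le> card (?EW \<union> (?EC \<union> ?EP))" using finE by (intro card_mono) auto
  also have "\<dots> \<le> card ?EW + (card ?EC + card ?EP)"
    by (meson add_left_mono card_Un_le order_trans)
  also have "card ?EW \<le> (\<Sum>w\<in>W. card (V \<inter> nbs E w))"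
  proof -
    have "card ?EW \<le> (\<Sum>w\<in>W. card ((\<lambda>u. {w, u}) ` (V \<inter> nbs E w)))" by (rule card_UN_le[OF finW])
    also have "\<dots> \<le> (\<Sum>w\<in>W. card (V \<inter> nbs E w))" using finV by (intro sum_mono card_image_le) auto
    finally show ?thesis .
  qed
  also have "card ?EC \<le> turan_edges p (card (V - W))"
    using finV part by (intro card_cross_pairs_le_turan[OF p]) auto
  also have "card (V - W) = card V - card W" using W finW by (simp add: card_Diff_subset)
  also have "card ?EP \<le> (\<Sum>i<p. card {e \<in> E. e \<subseteq> P i})" by (rule card_UN_le) simp
  finally show ?thesis by simp
qed

lemma card_edges_le_cover:
  assumes finV: "finite Q" and J: "J \<subseteq> nsets Q 2" and C: "finite C" "\<And>e. e \<in> J \<Longrightarrow> e \<inter> C \<noteq> {}"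
    and deg: "\<And>v. v \<in> C \<Longrightarrow> card {u \<in> Q. {v, u} \<in> J} \<le> d"
  shows "card J \<le> card C * d"
proof -
  have "J \<subseteq> (\<Union>v\<in>C. (\<lambda>u. {v, u}) ` {u \<in> Q. {v, u} \<in> J})"
  proof
    fix e assume e: "e \<in> J"
    then obtain a b where ab: "e = {a, b}" "a \<in> Q" "b \<in> Q" using J by (blast elim: nsets_2_E)
    consider "a \<in> C" | "b \<in> C" using C(2)[OF e] ab by blast
    then show "e \<in> (\<Union>v\<in>C. (\<lambda>u. {v, u}) ` {u \<in> Q. {v, u} \<in> J})"
    proof cases
      case 1 then show ?thesis using ab e by (intro UN_I[of a]) auto
    next
      case 2 then show ?thesis using ab e by (intro UN_I[of b]) (auto simp: insert_commute)
    qed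
  qed
  then have "card J \<le> card (\<Union>v\<in>C. (\<lambda>u. {v, u}) ` {u \<in> Q. {v, u} \<in> J})"
    using finV C(1) by (intro card_mono) auto
  also have "\<dots> \<le> (\<Sum>v\<in>C. card ((\<lambda>u. {v, u}) ` {u \<in> Q. {v, u} \<in> J}))" by (rule card_UN_le[OF C(1)])
  also have "\<dots> \<le> (\<Sum>v\<in>C. d)"
    using finV deg by (intro sum_mono order_trans[OF card_image_le]) auto
  finally show ?thesis by simp
qed

text \<open>A stability argument. The sets from \<open>ex_near_parts\<close> absorb all vertices
  with few neighbours in one of them; the vertices that see every set form \<open>W\<close>. As any
  \<open>s\<close> of them have few common neighbours, boundedly many of them have total degree at
  most about \<open>(s - 1) * n\<close>. Comparison with the assumed number of edges then forces
  \<open>card W = s - 1\<close> and nearly full degrees in \<open>W\<close>.\<close>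

lemma ex_near_partite:
  fixes \<gamma> :: real
  assumes st: "1 \<le> s" "1 \<le> t" and p: "3 \<le> p" and \<gamma>: "\<gamma> > 0"
  shows "\<exists>n0. \<forall>(V :: 'a set) E. dense p V E \<longrightarrow> n0 \<le> card V \<longrightarrow> \<not> clique_system (p + 1) s t E \<longrightarrow>
     (s - 1) * (card V - s + 1) + turan_edges p (card V - s + 1) \<le> card E \<longrightarrow>
     (\<exists>W P. W \<subseteq> V \<and> card W = s - 1 \<and> (\<forall>i<p. P i \<subseteq> V - W) \<and> V - W \<subseteq> (\<Union>i<p. P i) \<and>
       (\<forall>i<p. \<forall>j<p. i \<noteq> j \<longrightarrow> P i \<inter> P j = {}) \<and>
       (\<forall>w\<in>W. real (card (nonnbs V E w)) \<le> \<gamma> * real (card V)) \<and>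
       (\<forall>i<p. \<forall>v\<in>P i. real (card (nonnbs V E v - P i)) \<le> \<gamma> * real (card V)) \<and>
       (\<forall>i<p. real (card V) / real p - \<gamma> * real (card V) \<le> real (card (P i))))"
proof -
  define rs where "rs = real s"
  define rp where "rp = real p"
  define Q where "Q = real (slack p s t + 2 * s + 2 * t)"
  \<comment> \<open>\<open>K * \<delta>N\<close> will bound the edges inside all parts: each part
    has a cover of at most \<open>2 * (s * t)\<close> vertices, of inner degree at most
    \<open>2 * \<delta>N\<close>.\<close>
  define K where "K = 4 * real p * real s * real t"
  have rp: "rp \<ge> 3" and rs: "rs \<ge> 1" using p st unfolding rp_def rs_def by auto
  have H: "slack p s t \<ge> 1" unfolding slack_def using st by simp
  then have Q1: "Q \<ge> 1" unfolding Q_def by simp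
  have Kpos: "K > 0" unfolding K_def using p st by simp
  \<comment> \<open>There are two scales: \<open>\<delta>\<close> decides whether a vertex sees a
    part, and the smaller \<open>\<epsilon>\<close> measures what \<open>ex_near_parts\<close>
    leaves over. The list \<open>L\<close> below records what \<open>n\<close> has to
    dominate.\<close>
  obtain \<delta> where \<delta>0: "\<delta> > 0" and \<delta>: "2 * \<delta> \<le> \<gamma>" "K * \<delta> \<le> \<gamma> / 2" "K * \<delta> \<le> 1 / (4 * rp)" "K * \<delta> \<le> 1 / 8"
      "(2 * Q) * \<delta> \<le> 1 / (8 * rp)"
    using ex_small[of "[(2, \<gamma>), (K, \<gamma> / 2), (K, 1 / (4 * rp)), (K, 1 / 8), (2 * Q, 1 / (8 * rp))]"] \<gamma> rp
    by auto
  define A where "A = 4 ^ s * real p * real (slack p s t)"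
  have A0: "A \<ge> 0" unfolding A_def by simp
  obtain \<epsilon> where \<epsilon>0: "\<epsilon> > 0" and \<epsilon>: "2 * \<epsilon> \<le> \<delta>" "(2 * Q) * \<epsilon> \<le> \<delta> / 2" "(1 + 2 * A) * \<epsilon> \<le> 1 / (24 * rs)"
      "\<epsilon> \<le> 1 / (8 * rp)" "\<epsilon> \<le> \<gamma> / 2"
    using ex_small[of "[(2, \<delta>), (2 * Q, \<delta> / 2), (1 + 2 * A, 1 / (24 * rs)), (1, 1 / (8 * rp)), (1, \<gamma> / 2)]"]
      \<gamma> rp rs \<delta>0 by auto
  obtain n1 where n1: "\<And>(V :: 'a set) E. dense p V E \<Longrightarrow> n1 \<le> card V \<Longrightarrow> \<not> clique_system (p + 1) s t E \<Longrightarrow>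
     \<exists>U. (\<forall>i<p. U i \<subseteq> V) \<and> (\<forall>i<p. \<forall>j<p. i \<noteq> j \<longrightarrow> U i \<inter> U j = {}) \<and>
       (\<forall>i<p. \<forall>x\<in>U i. \<forall>y\<in>U i. {x, y} \<notin> E) \<and>
       real (card (V - (\<Union>i<p. U i))) \<le> \<epsilon> * real (card V)"
    using ex_near_parts[OF st p \<epsilon>0, where ?'a = 'a] by metis
  define L where "L = [(\<epsilon>, rp + 1), (\<delta> / 2, Q), (1 / (8 * rp), Q), (1 / (24 * rs), A), (1, 100 * rs * rs + 100),
     (1 / (8 * rp), rp + 1), (\<delta> / 2, rp + 1), (1 / (8 * rp), rs * rs + rs), (\<gamma> / 2, rs * rs + 2 * rs + rp),
     (1 / 8, rs * rs + 4 * rs)]"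
  have "\<forall>(c, b)\<in>set L. (c :: real) > 0" unfolding L_def using \<epsilon>0 \<delta>0 rp rs \<gamma> by auto
  from ex_large[OF this] obtain n2 where n2: "\<forall>n\<ge>n2. \<forall>(c, b)\<in>set L. b \<le> c * real n" by (rule exE)
  show ?thesis
  proof (intro exI[of _ "n1 + n2 + s"] allI impI)
    fix V :: "'a set" and E
    assume d: "dense p V E" and n: "n1 + n2 + s \<le> card V" and F: "\<not> clique_system (p + 1) s t E"
      and eb: "(s - 1) * (card V - s + 1) + turan_edges p (card V - s + 1) \<le> card E"
    have finV: "finite V" and E2: "E \<subseteq> nsets V 2" using d unfolding dense_def by auto
    define N where "N = real (card V)"
    define \<epsilon>N where "\<epsilon>N = \<epsilon> * N"
    define \<delta>N where "\<delta>N = \<delta> * N"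
    have "\<forall>(c, b)\<in>set L. b \<le> c * N" unfolding N_def using n by (intro spec[OF n2, THEN mp]) simp
    then have big: "rp + 1 \<le> \<epsilon>N" "Q \<le> \<delta>N / 2" "Q \<le> N / (8 * rp)" "A \<le> N / (24 * rs)" "100 * rs * rs + 100 \<le> N"
        "rp + 1 \<le> N / (8 * rp)" "rp + 1 \<le> \<delta>N / 2" "rs * rs + rs \<le> N / (8 * rp)"
        "rs * rs + 2 * rs + rp \<le> \<gamma> / 2 * N" "rs * rs + 4 * rs \<le> N / 8"
      unfolding L_def \<epsilon>N_def \<delta>N_def by auto
    have N0: "N \<ge> 0" unfolding N_def by simp
    have sm\<delta>: "2 * \<delta>N \<le> \<gamma> * N" "K * \<delta>N \<le> \<gamma> / 2 * N" "K * \<delta>N \<le> N / (4 * rp)" "K * \<delta>N \<le> N / 8"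
        "2 * Q * \<delta>N \<le> N / (8 * rp)"
      using \<delta>[THEN mult_right_mono, OF N0] unfolding \<delta>N_def by (simp_all add: mult.assoc)
    have sm\<epsilon>: "2 * \<epsilon>N \<le> \<delta>N" "2 * Q * \<epsilon>N \<le> \<delta>N / 2" "(1 + 2 * A) * \<epsilon>N \<le> N / (24 * rs)"
      "\<epsilon>N \<le> N / (8 * rp)" "\<epsilon>N \<le> \<gamma> / 2 * N"
      using \<epsilon>[THEN mult_right_mono, OF N0] unfolding \<epsilon>N_def \<delta>N_def by (simp_all add: mult.assoc)
    obtain U where U: "\<And>i. i < p \<Longrightarrow> U i \<subseteq> V" "\<And>i j. \<lbrakk>i < p; j < p; i \<noteq> j\<rbrakk> \<Longrightarrow> U i \<inter> U j = {}"
      "\<And>i x y. \<lbrakk>i < p; x \<in> U i; y \<in> U i\<rbrakk> \<Longrightarrow> {x, y} \<notin> E" "real (card (V - (\<Union>i<p. U i))) \<le> \<epsilon>N"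
    proof -
      have "n1 \<le> card V" using n by simp
      from n1[OF d this F] obtain U where "(\<forall>i<p. U i \<subseteq> V) \<and> (\<forall>i<p. \<forall>j<p. i \<noteq> j \<longrightarrow> U i \<inter> U j = {}) \<and>
         (\<forall>i<p. \<forall>x\<in>U i. \<forall>y\<in>U i. {x, y} \<notin> E) \<and>
         real (card (V - (\<Union>i<p. U i))) \<le> \<epsilon> * real (card V)" by (rule exE)
      then show thesis by (intro that[of U]) (simp_all add: \<epsilon>N_def N_def)
    qed
    have finU: "finite (U i)" if "i < p" for i using U(1)[OF that] finV by (rule finite_subset)
    have nn: "real (card (nonnbs V E v)) \<le> N / rp + 1" if "v \<in> V" for v
    proof -
      have "p * card (nonnbs V E v) \<le> card V + p" using d that unfolding dense_def by blast
      then have "rp * real (card (nonnbs V E v)) \<le> N + rp" unfolding rp_def N_def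
        by (metis of_nat_add of_nat_le_iff of_nat_mult)
      then show ?thesis using rp by (simp add: field_simps)
    qed
    have finnn: "finite (nonnbs V E v)" for v unfolding nonnbs_def using finV by simp
    \<comment> \<open>An independent set lies in the non-neighbourhood of each of its vertices,
      which density bounds. The lower bound \<open>Ulb\<close> follows, since the other sets obey
      the same upper bound.\<close>
    have Uub: "real (card (U i)) \<le> N / rp + 1" if i: "i < p" for i
    proof (cases "U i = {}")
      case True then show ?thesis using rp N0 by simp
    next
      case False
      then obtain v where v: "v \<in> U i" by blast
      have "U i \<subseteq> nonnbs V E v" using U(1)[OF i] U(3)[OF i v] unfolding nonnbs_def by blast
      then have "card (U i) \<le> card (nonnbs V E v)" using finnn by (intro card_mono) auto
      then show ?thesis using nn[of v] v U(1)[OF i] by fastforce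
    qed
    have Ulb: "N / rp - \<epsilon>N - rp \<le> real (card (U i))" if i: "i < p" for i
    proof -
      have "V \<subseteq> (V - (\<Union>i<p. U i)) \<union> (U i \<union> (\<Union>j\<in>{..<p} - {i}. U j))" by auto
      then have "card V \<le> card ((V - (\<Union>i<p. U i)) \<union> (U i \<union> (\<Union>j\<in>{..<p} - {i}. U j)))"
        using finV finU i by (intro card_mono) auto
      also have "\<dots> \<le> card (V - (\<Union>i<p. U i)) + (card (U i) + card (\<Union>j\<in>{..<p} - {i}. U j))"
        by (meson add_left_mono card_Un_le order_trans)
      also have "card (\<Union>j\<in>{..<p} - {i}. U j) \<le> (\<Sum>j\<in>{..<p} - {i}. card (U j))" by (rule card_UN_le) simp
      finally have "N \<le> real (card (V - (\<Union>i<p. U i))) + real (card (U i)) + (\<Sum>j\<in>{..<p} - {i}. real (card (U j)))"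
        unfolding N_def by (simp flip: of_nat_sum of_nat_add)
      also have "(\<Sum>j\<in>{..<p} - {i}. real (card (U j))) \<le> (\<Sum>j\<in>{..<p} - {i}. N / rp + 1)"
        using Uub by (intro sum_mono) auto
      also have "\<dots> = (rp - 1) * (N / rp + 1)" using i p unfolding rp_def by simp
      also have "\<dots> = N - N / rp + rp - 1" using rp by (simp add: field_simps)
      finally show ?thesis using U(4) by linarith
    qed
    define m where "m = nat \<lfloor>2 * \<epsilon>N\<rfloor>"
    have m: "real m \<le> 2 * \<epsilon>N" unfolding m_def using big(1) rp by (intro of_nat_floor) auto
    have m_ge: "x \<le> m" if "real x \<le> 2 * \<epsilon>N" for x using that unfolding m_def by (simp add: le_nat_floor)
    \<comment> \<open>The at most \<open>N / rp + 1\<close> non-neighbours of \<open>v\<close>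
      already include all of \<open>U i\<close>, which leaves few elsewhere.\<close>
    have Umiss: "real (card (nonnbs V E v - U i)) \<le> 2 * \<epsilon>N" if i: "i < p" and v: "v \<in> U i" for i v
    proof -
      have "U i \<subseteq> nonnbs V E v" using U(1)[OF i] U(3)[OF i v] unfolding nonnbs_def by blast
      then have "real (card (nonnbs V E v - U i)) = real (card (nonnbs V E v)) - real (card (U i))"
        using finU[OF i] finnn by (simp add: card_Diff_subset card_mono)
      then show ?thesis using Ulb[OF i] nn[of v] v U(1)[OF i] big(1) by force
    qed
    have UmissY: "card {z \<in> U l'. {y, z} \<notin> E} \<le> m" if "l < p" "l' < p" "l \<noteq> l'" "y \<in> U l" for l l' y
    proof -
      have "{z \<in> U l'. {y, z} \<notin> E} \<subseteq> nonnbs V E y - U l"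
        using U(1)[OF that(2)] U(2)[OF that(1-3)] unfolding nonnbs_def by blast
      then have "card {z \<in> U l'. {y, z} \<notin> E} \<le> card (nonnbs V E y - U l)"
        using finnn by (intro card_mono) auto
      then show ?thesis using Umiss[OF that(1,4)] by (intro m_ge) linarith
    qed
    define hb where "hb = slack p s t * (m + 1)"
    have hbQ: "real hb \<le> Q * (2 * \<epsilon>N + 1)"
    proof -
      have "real (slack p s t) * (real m + 1) \<le> Q * (2 * \<epsilon>N + 1)"
        using m unfolding Q_def by (intro mult_mono) auto
      then show ?thesis unfolding hb_def by (simp only: of_nat_mult of_nat_add of_nat_1)
    qed
    have hb\<delta>: "real hb \<le> \<delta>N"
    proof -
      have "Q * (2 * \<epsilon>N + 1) = 2 * Q * \<epsilon>N + Q" by (simp add: algebra_simps)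
      then show ?thesis using hbQ sm\<epsilon>(2) big(2) by linarith
    qed
    define W where "W = {v \<in> V - (\<Union>i<p. U i). \<forall>i<p. \<delta>N \<le> real (card (U i \<inter> nbs E v))}"
    have WV: "W \<subseteq> V" unfolding W_def by blast
    have finW: "finite W" using WV finV by (rule finite_subset)
    have few: "card {y \<in> V - (V - (\<Union>i<p. U i)). \<forall>w\<in>S. {w, y} \<in> E} \<le> p * hb"
      if S: "S \<subseteq> W" "card S = s" for S
    proof -
      have lt: "card {y \<in> U l. \<forall>w\<in>S. {w, y} \<in> E} \<le> hb" if l: "l < p" for l
      proof (rule ccontr)
        assume neg: "\<not> card {y \<in> U l. \<forall>w\<in>S. {w, y} \<in> E} \<le> hb"
        have finS: "finite S" using S(1) finW by (rule finite_subset)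
        then obtain w where w: "bij_betw w {..<s} S"
          using S(2) by (metis card_lessThan finite_lessThan finite_same_card_bij)
        have wS: "w ` {..<s} = S" and winj: "inj_on w {..<s}" using w unfolding bij_betw_def by auto
        have "clique_system (p + 1) s t E"
        proof (rule wide_embed[OF st winj, where Y = U and m = m and lc = l])
          show "slack p s t * (m + 1) \<le> card {y \<in> U l. {w i, y} \<in> E}" if "i < s" "l < p" for i l
          proof -
            have "w i \<in> W" using wS that S by blast
            then have "\<delta>N \<le> real (card (U l \<inter> nbs E (w i)))" using that unfolding W_def by blast
            moreover have "U l \<inter> nbs E (w i) = {y \<in> U l. {w i, y} \<in> E}" unfolding nbs_def by auto
            ultimately show ?thesis using hb\<delta> unfolding hb_def[symmetric] by simp
          qed
          have "{y \<in> U l. \<forall>i<s. {w i, y} \<in> E} = {y \<in> U l. \<forall>w\<in>S. {w, y} \<in> E}"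
            unfolding wS[symmetric] by auto
          then show "slack p s t * (m + 1) \<le> card {y \<in> U l. \<forall>i<s. {w i, y} \<in> E}"
            using neg unfolding hb_def[symmetric] by simp
        qed (use finU UmissY l in auto)
        then show False using F by blast
      qed
      have "{y \<in> V - (V - (\<Union>i<p. U i)). \<forall>w\<in>S. {w, y} \<in> E} \<subseteq> (\<Union>l<p. {y \<in> U l. \<forall>w\<in>S. {w, y} \<in> E})" by auto
      then have "card {y \<in> V - (V - (\<Union>i<p. U i)). \<forall>w\<in>S. {w, y} \<in> E} \<le>
          card (\<Union>l<p. {y \<in> U l. \<forall>w\<in>S. {w, y} \<in> E})"
        using finU by (intro card_mono) auto
      also have "\<dots> \<le> (\<Sum>l<p. card {y \<in> U l. \<forall>w\<in>S. {w, y} \<in> E})" by (rule card_UN_le) simp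
      also have "\<dots> \<le> (\<Sum>l<p. hb)" using lt by (intro sum_mono) auto
      finally show ?thesis by simp
    qed
    \<comment> \<open>An error of \<open>N / (12 * rs)\<close> per vertex amounts to at most
      \<open>N / 6\<close> over \<open>2 * s\<close> vertices, which the comparisons below can
      afford.\<close>
    have degsum: "(\<Sum>w\<in>X. real (card (V \<inter> nbs E w))) \<le> (rs - 1) * N + real (card X) * (N / (12 * rs))"
      if X: "X \<subseteq> W" "card X \<le> 2 * s" for X
    proof -
      have finX: "finite X" using X(1) finW by (rule finite_subset)
      have "(\<Sum>w\<in>X. card (V \<inter> nbs E w)) \<le> (s - 1) * card V +
          card X * (card (V \<inter> (V - (\<Union>i<p. U i))) + 2 ^ card X * (p * hb))"
        using X(1) st(1) by (intro sum_degrees_le[OF finV finX] few) auto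
      then have "real (\<Sum>w\<in>X. card (V \<inter> nbs E w)) \<le> real ((s - 1) * card V +
          card X * (card (V \<inter> (V - (\<Union>i<p. U i))) + 2 ^ card X * (p * hb)))" by (rule of_nat_mono)
      also have "\<dots> = (rs - 1) * N + real (card X) *
          (real (card (V \<inter> (V - (\<Union>i<p. U i)))) + 2 ^ card X * (real p * real hb))"
        unfolding rs_def N_def using st by (simp add: of_nat_diff)
      also have "V \<inter> (V - (\<Union>i<p. U i)) = V - (\<Union>i<p. U i)" by blast
      also have "(rs - 1) * N + real (card X) *
          (real (card (V - (\<Union>i<p. U i))) + 2 ^ card X * (real p * real hb)) \<le>
          (rs - 1) * N + real (card X) * (N / (12 * rs))"
      proof (intro add_left_mono mult_left_mono)
        have "(2 :: real) ^ card X \<le> 2 ^ (2 * s)" using X(2) by (intro power_increasing) auto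
        also have "\<dots> = 4 ^ s" by (simp add: power_mult)
        finally have p4: "(2 :: real) ^ card X \<le> 4 ^ s" .
        have hb': "real hb \<le> real (slack p s t) * (2 * \<epsilon>N + 1)"
          unfolding hb_def of_nat_mult of_nat_add of_nat_1 using m by (intro mult_left_mono) auto
        have "2 ^ card X * (real p * real hb) \<le> 4 ^ s * (real p * (real (slack p s t) * (2 * \<epsilon>N + 1)))"
          using p4 hb' by (intro mult_mono) auto
        also have "\<dots> = A * (2 * \<epsilon>N + 1)" unfolding A_def by simp
        finally have "2 ^ card X * (real p * real hb) \<le> 2 * A * \<epsilon>N + A" by (simp add: algebra_simps)
        moreover have "(1 + 2 * A) * \<epsilon>N = \<epsilon>N + 2 * A * \<epsilon>N" by (simp add: algebra_simps)
        moreover have "N / (24 * rs) + N / (24 * rs) = N / (12 * rs)" by simp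
        ultimately show "real (card (V - (\<Union>i<p. U i))) + 2 ^ card X * (real p * real hb) \<le> N / (12 * rs)"
          using U(4) sm\<epsilon>(3) big(4) by linarith
      qed simp
      finally show ?thesis by simp
    qed
    have deglb: "N - N / rp - 1 \<le> real (card (V \<inter> nbs E v))" if "v \<in> V" for v
    proof -
      have "V = nonnbs V E v \<union> (V \<inter> nbs E v)" unfolding nonnbs_def nbs_def by auto
      then have "card V \<le> card (nonnbs V E v) + card (V \<inter> nbs E v)"
        using card_Un_le[of "nonnbs V E v" "V \<inter> nbs E v"] by simp
      then show ?thesis using nn[OF that] unfolding N_def by linarith
    qed
    have Np: "N / rp \<le> N / 3" using rp N0 by (intro divide_left_mono) auto
    \<comment> \<open>By density, \<open>2 * s\<close> vertices have total degree at least about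
      \<open>4 / 3 * rs * N\<close>, against the upper bound
      \<open>(rs - 1) * N + N / 6\<close>.\<close>
    have W2s: "card W \<le> 2 * s"
    proof (rule ccontr)
      assume "\<not> card W \<le> 2 * s"
      then have "2 * s \<le> card W" by simp
      then obtain X where X: "X \<subseteq> W" "card X = 2 * s" "finite X"
        by (rule obtain_subset_with_card_n)
      have "real (card X) * (2 / 3 * N - 1) \<le> (\<Sum>w\<in>X. real (card (V \<inter> nbs E w)))"
      proof -
        have "(\<Sum>w\<in>X. 2 / 3 * N - 1) \<le> (\<Sum>w\<in>X. real (card (V \<inter> nbs E w)))"
        proof (rule sum_mono)
          fix w assume "w \<in> X"
          then have "w \<in> V" using X(1) WV by blast
          then show "2 / 3 * N - 1 \<le> real (card (V \<inter> nbs E w))" using deglb[of w] Np by linarith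
        qed
        then show ?thesis by simp
      qed
      also have "\<dots> \<le> (rs - 1) * N + real (card X) * (N / (12 * rs))" using X by (intro degsum) auto
      finally have "2 * rs * (2 / 3 * N - 1) \<le> (rs - 1) * N + 2 * rs * (N / (12 * rs))"
        unfolding X(2) rs_def by simp
      then have "4 / 3 * (rs * N) - 2 * rs \<le> rs * N - N + N / 6" using rs by (simp add: algebra_simps)
      moreover have "rs * N \<ge> 1 * N" using rs N0 by (intro mult_right_mono) auto
      moreover have "rs * 1 \<le> rs * rs" using rs by (intro mult_left_mono) auto
      moreover have "N \<ge> 100 * (rs * rs)" using big(5) by (simp add: mult.assoc)
      ultimately show False using rs by linarith
    qed
    define \<iota> where "\<iota> v = (SOME i. i < p \<and> real (card (U i \<inter> nbs E v)) < \<delta>N)" for v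
    have \<iota>: "\<iota> v < p" "real (card (U (\<iota> v) \<inter> nbs E v)) < \<delta>N" if "v \<in> V - (\<Union>i<p. U i) - W" for v
    proof -
      have "\<exists>i. i < p \<and> real (card (U i \<inter> nbs E v)) < \<delta>N"
        using that unfolding W_def by (auto simp: not_le)
      from someI_ex[OF this] show "\<iota> v < p" "real (card (U (\<iota> v) \<inter> nbs E v)) < \<delta>N" unfolding \<iota>_def by auto
    qed
    define P where "P i = U i \<union> {v \<in> V - (\<Union>i<p. U i) - W. \<iota> v = i}" for i
    have PV: "P i \<subseteq> V - W" if "i < p" for i using U(1)[OF that] that unfolding P_def W_def by blast
    have Pcover: "V - W \<subseteq> (\<Union>i<p. P i)" using \<iota>(1) unfolding P_def by blast
    have Pdisj: "P i \<inter> P j = {}" if "i < p" "j < p" "i \<noteq> j" for i j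
      using U(2)[OF that] that unfolding P_def by blast
    have finP: "finite (P i)" if "i < p" for i using PV[OF that] finV by (blast intro: finite_subset)
    have UP: "U i \<subseteq> P i" for i unfolding P_def by blast
    \<comment> \<open>A vertex outside \<open>U i\<close> assigned to part \<open>i\<close> misses
      all but at most \<open>\<delta>N\<close> of \<open>U i\<close>, and this nearly exhausts its
      non-neighbours.\<close>
    have Pmiss: "real (card (nonnbs V E v - U i)) \<le> 2 * \<delta>N" "real (card (U i \<inter> nbs E v)) \<le> \<delta>N"
      if i: "i < p" and v: "v \<in> P i" for i v
    proof -
      have "real (card (nonnbs V E v - U i)) \<le> 2 * \<delta>N \<and> real (card (U i \<inter> nbs E v)) \<le> \<delta>N"
      proof (cases "v \<in> U i")
        case True
        have "U i \<inter> nbs E v = {}" using U(3)[OF i True] unfolding nbs_def by blast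
        then have "card (U i \<inter> nbs E v) = 0" by (simp only: card.empty)
        then show ?thesis using Umiss[OF i True] sm\<epsilon>(1) big(1) rp by simp
      next
        case False
        then have v': "v \<in> V - (\<Union>i<p. U i) - W" "\<iota> v = i" using v unfolding P_def by auto
        have "card (U i) = card (U i \<inter> nbs E v) + card (U i - nbs E v)"
          using finU[OF i] by (rule card_Int_Diff)
        moreover have "nonnbs V E v = (nonnbs V E v - U i) \<union> (U i - nbs E v)"
          using U(1)[OF i] unfolding nonnbs_def nbs_def by auto
        then have "card (nonnbs V E v) = card ((nonnbs V E v - U i) \<union> (U i - nbs E v))" by (rule arg_cong)
        moreover have "card ((nonnbs V E v - U i) \<union> (U i - nbs E v)) =
            card (nonnbs V E v - U i) + card (U i - nbs E v)"
          using finnn finU[OF i] by (intro card_Un_disjoint) auto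
        moreover have "real (card (nonnbs V E v)) \<le> N / rp + 1" using nn v' by blast
        moreover note Ulb[OF i] \<iota>(2)[OF v'(1), unfolded v'(2)] big(1,7) sm\<epsilon>(1)
        ultimately show ?thesis by linarith
      qed
      then show "real (card (nonnbs V E v - U i)) \<le> 2 * \<delta>N" "real (card (U i \<inter> nbs E v)) \<le> \<delta>N" by auto
    qed
    define J where "J i = {e \<in> E. e \<subseteq> P i}" for i
    have finE: "finite E" using finite_subset[OF E2] finV by simp
    have finJ: "finite (J i)" for i unfolding J_def using finE by simp
    have Jsub: "J i \<subseteq> nsets (P i) 2" for i using E2 unfolding J_def nsets_def by auto
    have J2: "card e = 2" if "e \<in> J i" for e i using Jsub that unfolding nsets_def by blast
    define m2 where "m2 = nat \<lfloor>2 * \<delta>N\<rfloor>"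
    have \<delta>Npos: "0 \<le> \<delta>N" unfolding \<delta>N_def using \<delta>0 N0 by simp
    have m2: "real m2 \<le> 2 * \<delta>N" unfolding m2_def using \<delta>Npos by (intro of_nat_floor) auto
    have m2_ge: "x \<le> m2" if "real x \<le> 2 * \<delta>N" for x using that unfolding m2_def by (simp add: le_nat_floor)
    have mm2: "m \<le> m2" using m sm\<epsilon>(1) \<delta>Npos by (intro m2_ge) linarith
    have mJ: "mnum (J i) < s * t" if i: "i < p" for i
    proof (rule mnum_lt_if_no_split[OF finJ])
      show "\<not> split_in s t (J i)"
      proof
        assume "split_in s t (J i)"
        then have "clique_system (p + 1) s t E"
        proof (rule split_embed[OF st p i, where Y = U and m = m2 and D = "P i"])
          show "J i \<subseteq> E" unfolding J_def by blast
          show "card {z \<in> U l'. {y, z} \<notin> E} \<le> m2" if "l < p" "l' < p" "l \<noteq> l'" "y \<in> U l" for l l' y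
            using UmissY[OF that] mm2 by linarith
          show "card {y \<in> U l. {v, y} \<notin> E} \<le> m2" if "l < p" "l \<noteq> i" "v \<in> P i" for l v
          proof -
            have "{y \<in> U l. {v, y} \<notin> E} \<subseteq> nonnbs V E v - U i"
              using U(1)[OF that(1)] U(2)[OF that(1) i that(2)] unfolding nonnbs_def by blast
            then have "card {y \<in> U l. {v, y} \<notin> E} \<le> card (nonnbs V E v - U i)"
              using finnn by (intro card_mono) auto
            then show ?thesis using Pmiss(1)[OF i that(3)] by (intro m2_ge) linarith
          qed
          show "(slack p s t + 2 * s + 2 * t) * (m2 + 1) \<le> card (U l)" if "l < p" for l
          proof -
            have "Q * (real m2 + 1) \<le> Q * (2 * \<delta>N + 1)" using m2 Q1 by (intro mult_left_mono) auto
            also have "\<dots> = 2 * Q * \<delta>N + Q" by (simp add: algebra_simps)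
            also have "\<dots> \<le> N / (8 * rp) + N / (8 * rp)" using sm\<delta>(5) big(3) by linarith
            also have "\<dots> \<le> N / rp - N / (8 * rp) - N / (8 * rp)" using rp N0 by (simp add: field_simps)
            also have "\<dots> \<le> N / rp - \<epsilon>N - rp" using sm\<epsilon>(4) big(6) by linarith
            also have "\<dots> \<le> real (card (U l))" by (rule Ulb[OF that])
            finally have "real ((slack p s t + 2 * s + 2 * t) * (m2 + 1)) \<le> real (card (U l))"
              unfolding Q_def by (simp add: algebra_simps)
            then show ?thesis by (simp only: of_nat_le_iff)
          qed
        qed (use Jsub finU in auto)
        then show False using F by blast
      qed
    qed
    have cJ: "real (card (J i)) \<le> 4 * rs * real t * \<delta>N" if i: "i < p" for i
    proof -
      have "\<exists>C. finite C \<and> card C \<le> 2 * mnum (J i) \<and> (\<forall>e\<in>J i. e \<inter> C \<noteq> {}) \<and> C \<subseteq> \<Union>(J i)"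
        by (intro ex_vertex_cover finJ J2)
      then obtain C where C: "finite C" "card C \<le> 2 * mnum (J i)" "\<forall>e\<in>J i. e \<inter> C \<noteq> {}" "C \<subseteq> \<Union>(J i)"
        by (elim exE conjE)
      have CP: "C \<subseteq> P i" using C(4) unfolding J_def by blast
      have "card (J i) \<le> card C * m2"
      proof (rule card_edges_le_cover[OF finP[OF i] Jsub C(1)])
        show "e \<inter> C \<noteq> {}" if "e \<in> J i" for e using C(3) that by blast
        fix v assume "v \<in> C"
        then have v: "v \<in> P i" using CP by blast
        have "{u \<in> P i. {v, u} \<in> J i} \<subseteq> (U i \<inter> nbs E v) \<union> (V - (\<Union>i<p. U i))"
          unfolding P_def J_def nbs_def by auto
        then have "card {u \<in> P i. {v, u} \<in> J i} \<le> card ((U i \<inter> nbs E v) \<union> (V - (\<Union>i<p. U i)))"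
          using finU[OF i] finV by (intro card_mono) auto
        also have "\<dots> \<le> card (U i \<inter> nbs E v) + card (V - (\<Union>i<p. U i))" by (rule card_Un_le)
        finally show "card {u \<in> P i. {v, u} \<in> J i} \<le> m2"
          using Pmiss(2)[OF i v] U(4) sm\<epsilon>(1) big(1) rp by (intro m2_ge) linarith
      qed
      also have "\<dots> \<le> 2 * (s * t) * m2" using C(2) mJ[OF i] by (intro mult_right_mono) auto
      finally have "real (card (J i)) \<le> 2 * (rs * real t) * real m2"
        unfolding rs_def by (metis of_nat_le_iff of_nat_mult of_nat_numeral)
      also have "\<dots> \<le> 2 * (rs * real t) * (2 * \<delta>N)" using m2 rs by (intro mult_left_mono) auto
      finally show ?thesis by simp
    qed
    have sumJ: "(\<Sum>i<p. real (card (J i))) \<le> K * \<delta>N"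
    proof -
      have "(\<Sum>i<p. real (card (J i))) \<le> (\<Sum>i<p. 4 * rs * real t * \<delta>N)" using cJ by (intro sum_mono) auto
      also have "\<dots> = K * \<delta>N" unfolding K_def rs_def by simp
      finally show ?thesis .
    qed
    define DW where "DW = (\<Sum>w\<in>W. real (card (V \<inter> nbs E w)))"
    have edges_ub: "real (card E) \<le> DW + real (turan_edges p (card V - card W)) + K * \<delta>N"
    proof -
      have "card E \<le> (\<Sum>w\<in>W. card (V \<inter> nbs E w)) + turan_edges p (card V - card W) + (\<Sum>i<p. card (J i))"
        unfolding J_def using p Pcover by (intro card_edges_le_parts[OF finV E2 _ WV]) auto
      then have "real (card E) \<le> real ((\<Sum>w\<in>W. card (V \<inter> nbs E w)) + turan_edges p (card V - card W) + (\<Sum>i<p. card (J i)))"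
        by (rule of_nat_mono)
      then show ?thesis using sumJ unfolding DW_def by simp
    qed
    have sn: "s \<le> card V" using n by simp
    have "real ((s - 1) * (card V - s + 1) + turan_edges p (card V - s + 1)) \<le> real (card E)"
      using eb by (rule of_nat_mono)
    moreover have "real (card V - s + 1) = N - rs + 1" unfolding N_def rs_def using sn by (simp add: of_nat_diff)
    moreover have "real (s - 1) = rs - 1" unfolding rs_def using st by (simp add: of_nat_diff)
    moreover define T1 where "T1 = real (turan_edges p (card V - s + 1))"
    ultimately have edges_lb: "(rs - 1) * (N - rs + 1) + T1 \<le> real (card E)"
      by (simp only: of_nat_add of_nat_mult)
    have exp: "(rs - 1) * (N - rs + 1) = (rs - 1) * N - (rs * rs - 2 * rs + 1)" by (simp add: algebra_simps)
    have WN: "real (card (V \<inter> nbs E w)) \<le> N" for w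
      unfolding N_def using finV by (simp add: card_mono)
    \<comment> \<open>With \<open>s\<close> or more vertices in \<open>W\<close> the degree sum is
      still only about \<open>(rs - 1) * N\<close>, while the Turan graph on the remaining vertices
      has at least about \<open>2 / 3 * N\<close> fewer edges than the one in the assumed lower
      bound.\<close>
    have Wlt: "card W < s"
    proof (rule ccontr)
      assume "\<not> card W < s"
      then have Ws: "s \<le> card W" by simp
      have DWub: "DW \<le> (rs - 1) * N + real (card W) * (N / (12 * rs))"
        unfolding DW_def using W2s by (intro degsum) auto
      have "real (card W) * (N / (12 * rs)) \<le> (2 * rs) * (N / (12 * rs))"
        using W2s rs N0 unfolding rs_def by (intro mult_right_mono) auto
      also have "\<dots> = N / 6" using rs by simp
      finally have DWub': "DW \<le> (rs - 1) * N + N / 6" using DWub by linarith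
      define a where "a = card V - card W"
      have WleV: "card W \<le> card V" using WV finV by (rule card_mono[rotated])
      have aN: "N - 2 * rs \<le> real a" unfolding a_def N_def rs_def using W2s WleV by (simp add: of_nat_diff)
      have "a \<le> card V - s + 1" unfolding a_def using Ws by simp
      from turan_edges_diff(1)[of p, OF _ this] p
      have "real (turan_edges p a) + real (card V - s + 1 - a) * (real a - real a / rp) \<le>
          real (turan_edges p (card V - s + 1))" unfolding rp_def by simp
      moreover have "1 * (2 / 3 * real a) \<le> real (card V - s + 1 - a) * (real a - real a / rp)"
      proof (rule mult_mono)
        show "1 \<le> real (card V - s + 1 - a)" unfolding a_def using Ws sn WleV by simp
        have "real a / rp \<le> real a / 3" using rp by (intro divide_left_mono) auto
        then show "2 / 3 * real a \<le> real a - real a / rp" by linarith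
      qed auto
      ultimately have "2 / 3 * real a + real (turan_edges p a) \<le> real (turan_edges p (card V - s + 1))" by linarith
      then have T: "2 / 3 * real a + real (turan_edges p a) \<le> T1" unfolding T1_def .
      have "2 / 3 * (N - 2 * rs) \<le> 2 / 3 * real a" by (rule mult_left_mono[OF aN]) simp
      also have "\<dots> \<le> (rs * rs - 2 * rs + 1) + N / 6 + N / 8"
        using T edges_ub[folded a_def] edges_lb DWub' sm\<delta>(4) unfolding exp by argo
      finally have "2 / 3 * (N - 2 * rs) \<le> (rs * rs - 2 * rs + 1) + N / 6 + N / 8" .
      moreover have "rs \<le> rs * rs" using rs mult_left_mono[of 1 rs rs] by simp
      moreover have "N \<ge> 100 * (rs * rs)" using big(5) by (simp add: mult.assoc)
      ultimately show False using rs by argo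
    qed
    \<comment> \<open>The number of vertices that \<open>W\<close> lacks. Each of them adds only
      about \<open>N - N / rp\<close> edges to the Turan graph instead of \<open>N\<close>, a
      deficit that the edges inside the parts cannot make up.\<close>
    define g where "g = rs - 1 - real (card W)"
    have g0: "g \<ge> 0" unfolding g_def rs_def using Wlt by linarith
    have DWlb: "(rs - 1) * N - (rs * rs - 2 * rs + 1) - g * (N - N / rp + 1) - K * \<delta>N \<le> DW"
    proof -
      have le: "card V - s + 1 \<le> card V - card W" using Wlt sn by linarith
      have diff: "real (card V - card W - (card V - s + 1)) = g"
        unfolding g_def rs_def using Wlt sn by (simp add: of_nat_diff)
      have "real (turan_edges p (card V - card W)) \<le> real (turan_edges p (card V - s + 1)) +
          g * (real (card V - card W) - real (card V - card W) / rp + 1)"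
        using turan_edges_diff(2)[of p, OF _ le] p unfolding diff rp_def by simp
      also have "\<dots> \<le> real (turan_edges p (card V - s + 1)) + g * (N - N / rp + 1)"
      proof (intro add_left_mono mult_left_mono g0 add_right_mono)
        have "real (card V - card W) * (1 - 1 / rp) \<le> N * (1 - 1 / rp)"
          unfolding N_def using rp by (intro mult_right_mono) auto
        then show "real (card V - card W) - real (card V - card W) / rp \<le> N - N / rp"
          by (simp add: algebra_simps)
      qed
      finally show ?thesis using edges_ub edges_lb unfolding exp T1_def[symmetric] by argo
    qed
    have DWub: "DW \<le> real (card W) * N"
    proof -
      have "DW \<le> (\<Sum>w\<in>W. N)" unfolding DW_def using WN by (intro sum_mono) auto
      then show ?thesis by simp
    qed
    have cW: "card W = s - 1"
    proof (rule ccontr)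
      assume "card W \<noteq> s - 1"
      then have g1: "g \<ge> 1" unfolding g_def rs_def using Wlt by linarith
      have "(rs - 1) * N - real (card W) * N = g * N" unfolding g_def by (simp add: algebra_simps)
      then have "g * N - (rs * rs - 2 * rs + 1) - g * (N - N / rp + 1) - K * \<delta>N \<le> 0"
        using DWlb DWub by linarith
      moreover have "g * (N - N / rp + 1) = g * N - g * (N / rp) + g" by (simp add: algebra_simps)
      ultimately have "g * (N / rp) \<le> (rs * rs - 2 * rs + 1) + g + K * \<delta>N" by linarith
      moreover have "1 * (N / rp) \<le> g * (N / rp)" using g1 N0 rp by (intro mult_right_mono) auto
      moreover have "g \<le> rs" unfolding g_def by simp
      ultimately have "N / rp \<le> rs * rs + 1 + N / (4 * rp)" using sm\<delta>(3) rs by linarith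
      moreover have "N / (8 * rp) + N / (4 * rp) \<le> N / rp" using N0 rp by (simp add: field_simps)
      moreover have "rs * rs + rs \<le> N / (8 * rp)" by (rule big(8))
      moreover have "N / (8 * rp) + N / (4 * rp) + N / (8 * rp) + N / (2 * rp) = N / rp" using rp by (simp add: field_simps)
      moreover have "N / (2 * rp) = 4 * (N / (8 * rp))" by simp
      ultimately show False using rs big(6) rp by linarith
    qed
    \<comment> \<open>The other \<open>s - 2\<close> vertices of \<open>W\<close> contribute at most
      \<open>N\<close> each to the degree sum, so \<open>w\<close> itself must have almost full
      degree.\<close>
    have Wnn: "real (card (nonnbs V E w)) \<le> \<gamma> * N" if w: "w \<in> W" for w
    proof -
      have cWr: "real (card W) = rs - 1" unfolding cW rs_def using st by (simp add: of_nat_diff)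
      then have "g = 0" unfolding g_def by simp
      then have lb: "(rs - 1) * N - (rs * rs - 2 * rs + 1) - K * \<delta>N \<le> DW" using DWlb by simp
      have "DW = real (card (V \<inter> nbs E w)) + (\<Sum>w\<in>W - {w}. real (card (V \<inter> nbs E w)))"
        unfolding DW_def using w finW by (simp add: sum.remove)
      also have "\<dots> \<le> real (card (V \<inter> nbs E w)) + (\<Sum>w\<in>W - {w}. N)"
        using WN by (intro add_left_mono sum_mono) auto
      also have "(\<Sum>w\<in>W - {w}. N) = (rs - 2) * N"
      proof -
        have "real (card (W - {w})) = rs - 2"
          using cWr w finW card_gt_0_iff[of W] by (auto simp: card_Diff_singleton of_nat_diff)
        then show ?thesis by simp
      qed
      finally have "(rs - 1) * N - (rs * rs - 2 * rs + 1) - K * \<delta>N \<le>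
          real (card (V \<inter> nbs E w)) + (rs - 2) * N" using lb by linarith
      moreover have "(rs - 1) * N - (rs - 2) * N = N" by (simp add: algebra_simps)
      ultimately have "N - (rs * rs + 1) - \<gamma> / 2 * N \<le> real (card (V \<inter> nbs E w))"
        using sm\<delta>(2) rs by linarith
      moreover have "card (nonnbs V E w) + card (V \<inter> nbs E w) = card V"
      proof -
        have "nonnbs V E w \<union> (V \<inter> nbs E w) = V" "nonnbs V E w \<inter> (V \<inter> nbs E w) = {}"
          unfolding nonnbs_def nbs_def by auto
        then show ?thesis using card_Un_disjoint[of "nonnbs V E w" "V \<inter> nbs E w"] finnn finV by simp
      qed
      then have "real (card (nonnbs V E w)) + real (card (V \<inter> nbs E w)) = N"
        unfolding N_def by (simp flip: of_nat_add)
      ultimately show ?thesis using big(9) rs rp by linarith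
    qed
    have Pnn: "real (card (nonnbs V E v - P i)) \<le> \<gamma> * N" if "i < p" "v \<in> P i" for i v
    proof -
      have "card (nonnbs V E v - P i) \<le> card (nonnbs V E v - U i)"
        using finnn UP by (intro card_mono) auto
      then show ?thesis using Pmiss(1)[OF that] sm\<delta>(1) by linarith
    qed
    have Psz: "N / rp - \<gamma> * N \<le> real (card (P i))" if "i < p" for i
    proof -
      have "card (U i) \<le> card (P i)" using finP[OF that] UP by (intro card_mono) auto
      then show ?thesis using Ulb[OF that] sm\<epsilon>(5) big(9) rs rp
          mult_nonneg_nonneg[of rs rs] by linarith
    qed
    show "\<exists>W P. W \<subseteq> V \<and> card W = s - 1 \<and> (\<forall>i<p. P i \<subseteq> V - W) \<and> V - W \<subseteq> (\<Union>i<p. P i) \<and>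
       (\<forall>i<p. \<forall>j<p. i \<noteq> j \<longrightarrow> P i \<inter> P j = {}) \<and>
       (\<forall>w\<in>W. real (card (nonnbs V E w)) \<le> \<gamma> * real (card V)) \<and>
       (\<forall>i<p. \<forall>v\<in>P i. real (card (nonnbs V E v - P i)) \<le> \<gamma> * real (card V)) \<and>
       (\<forall>i<p. real (card V) / real p - \<gamma> * real (card V) \<le> real (card (P i)))"
      using WV cW PV Pcover Pdisj Wnn Pnn Psz unfolding N_def rp_def
      by (intro exI[of _ W] exI[of _ P] conjI allI impI ballI) simp_all
  qed
qed

subsection \<open>The constant and the lower bound\<close>

lemma spread_image:
  assumes sp: "spread s t S x b" and S: "S \<subseteq> bip_verts s t" and st: "1 \<le> s" "1 \<le> t"
    and inj: "inj_on \<psi> D" and bD: "\<And>i j. \<lbrakk>i < s; j < t\<rbrakk> \<Longrightarrow> b i j \<subseteq> D"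
  shows "spread s t S (\<psi> \<circ> x) (\<lambda>i j. \<psi> ` b i j)"
proof -
  have xD: "x u \<in> D" if "u \<in> S" for u
  proof -
    have "\<exists>i<s. \<exists>j<t. u \<in> {Inl i, Inr j}"
    proof (cases u)
      case (Inl i) then show ?thesis using that S st by (intro exI[of _ i] conjI exI[of _ 0]) auto
    next
      case (Inr j) then show ?thesis using that S st by (intro exI[of _ 0] conjI exI[of _ j]) auto
    qed
    then show ?thesis using spreadD(2)[OF sp] bD that by blast
  qed
  show ?thesis
    unfolding spread_def
  proof (intro conjI allI impI)
    show "inj_on (\<psi> \<circ> x) S"
      using spreadD(1)[OF sp] xD by (intro comp_inj_on inj_on_subset[OF inj]) auto
    show "(\<psi> \<circ> x) ` ({Inl i, Inr j} \<inter> S) \<subseteq> \<psi> ` b i j" if "i < s" "j < t" for i j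
      using spreadD(2)[OF sp that] by (auto simp: image_comp[symmetric])
    fix i j i' j' assume a: "i < s" "j < t" "i' < s" "j' < t" "(i, j) \<noteq> (i', j')"
    have "\<psi> ` b i j \<inter> \<psi> ` b i' j' = \<psi> ` (b i j \<inter> b i' j')"
      using inj_on_image_Int[OF inj bD[OF a(1,2)] bD[OF a(3,4)]] by simp
    also have "\<dots> \<subseteq> \<psi> ` x ` ({Inl i, Inr j} \<inter> {Inl i', Inr j'} \<inter> S)"
      using spreadD(3)[OF sp a] by (rule image_mono)
    finally show "\<psi> ` b i j \<inter> \<psi> ` b i' j' \<subseteq> (\<psi> \<circ> x) ` ({Inl i, Inr j} \<inter> {Inl i', Inr j'} \<inter> S)"
      by (simp only: image_comp)
  qed
qed

text \<open>A configuration is a graph \<open>B\<close> on \<open>N\<close> vertices, of which the first \<open>s - 1\<close> are also joined to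
  infinitely many further vertices. Its value is the number of edges gained over the complete
  join of \<open>s - 1\<close> vertices with an independent set, and it does not refer to \<open>p\<close>.\<close>

definition config_edges :: "nat \<Rightarrow> nat \<Rightarrow> nat set set \<Rightarrow> nat set set" where
  "config_edges s N B = B \<union> {{w, y} | w y. w < s - 1 \<and> N \<le> y}"

definition config_vals :: "nat \<Rightarrow> nat \<Rightarrow> int set" where
  "config_vals s t = {v. \<exists>N B. s - 1 \<le> N \<and> B \<subseteq> nsets {..<N} 2 \<and> \<not> split_in s t (config_edges s N B) \<and>
     v = int (card B) - int ((s - 1) choose 2) - int ((s - 1) * (N - (s - 1)))}"

text \<open>These are the terms subtracted in \<open>config_vals\<close> and the first two terms of
  \<open>base_count\<close>: the edges at \<open>s - 1\<close> vertices of full degree.\<close>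

lemma card_pairs_meeting:
  assumes fin: "finite A" and W: "W \<subseteq> A"
  shows "card {e \<in> nsets A 2. e \<inter> W \<noteq> {}} = (card W choose 2) + card W * (card A - card W)"
proof -
  have finW: "finite W" using W fin by (rule finite_subset)
  have eq: "{e \<in> nsets A 2. e \<inter> W \<noteq> {}} = nsets W 2 \<union> (\<lambda>(w, y). {w, y}) ` (W \<times> (A - W))"
  proof
    show "{e \<in> nsets A 2. e \<inter> W \<noteq> {}} \<subseteq> nsets W 2 \<union> (\<lambda>(w, y). {w, y}) ` (W \<times> (A - W))"
    proof
      fix e assume "e \<in> {e \<in> nsets A 2. e \<inter> W \<noteq> {}}"
      then have e: "e \<in> nsets A 2" "e \<inter> W \<noteq> {}" by simp_all
      from e(1) obtain u v where uv: "e = {u, v}" "u \<noteq> v" "u \<in> A" "v \<in> A" by (rule nsets_2_E)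
      with e(2) have "u \<in> W \<or> v \<in> W" by blast
      note uv = uv this
      consider "u \<in> W" "v \<in> W" | "u \<in> W" "v \<in> A - W" | "v \<in> W" "u \<in> A - W" using uv by blast
      then show "e \<in> nsets W 2 \<union> (\<lambda>(w, y). {w, y}) ` (W \<times> (A - W))"
      proof cases
        case 1 then show ?thesis using uv by auto
      next
        case 2 then show ?thesis using uv by (intro UnI2 image_eqI[of _ _ "(u, v)"]) auto
      next
        case 3 then show ?thesis using uv by (intro UnI2 image_eqI[of _ _ "(v, u)"]) auto
      qed
    qed
    show "nsets W 2 \<union> (\<lambda>(w, y). {w, y}) ` (W \<times> (A - W)) \<subseteq> {e \<in> nsets A 2. e \<inter> W \<noteq> {}}"
      using W by (auto elim!: nsets_2_E)
  qed
  have inj: "inj_on (\<lambda>(w, y). {w, y}) (W \<times> (A - W))"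
    by (auto simp: inj_on_def doubleton_eq_iff)
  have "nsets W 2 \<inter> (\<lambda>(w, y). {w, y}) ` (W \<times> (A - W)) = {}" by (auto simp: nsets_def)
  then have "card {e \<in> nsets A 2. e \<inter> W \<noteq> {}} = card (nsets W 2) + card ((\<lambda>(w, y). {w, y}) ` (W \<times> (A - W)))"
    unfolding eq using finW fin by (intro card_Un_disjoint) auto
  also have "\<dots> = (card W choose 2) + card W * card (A - W)"
    using card_image[OF inj] finW by (simp add: card_nsets_2 card_cartesian_product)
  finally show ?thesis using W finW by (simp add: card_Diff_subset)
qed

text \<open>The number of edges of the join of \<open>K_{s-1}\<close> and the Turan graph on the
  other \<open>n - (s - 1)\<close> vertices, as an integer so that the excess of a graph over it may
  have either sign.\<close>

definition base_count :: "nat \<Rightarrow> nat \<Rightarrow> nat \<Rightarrow> int" where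
  "base_count p s n = int ((s - 1) choose 2) + int ((s - 1) * (n - (s - 1))) + int (turan_edges p (n - (s - 1)))"

text \<open>For fixed \<open>v\<close> the sets \<open>c i v\<close> form a star with centre
  \<open>z v\<close> or a matching, and different \<open>v\<close> use disjoint vertices, so at
  least \<open>card Q * (card I + 1)\<close> vertices are covered. For \<open>card Q \<ge> 2\<close>
  this is too many. For \<open>card Q = 1\<close> a star stays inside one block of at most
  \<open>t\<close> vertices but has at least \<open>t + 1\<close>, and a matching covers at least
  \<open>2 * t\<close>.\<close>

lemma star_family_bound:
  fixes c :: "nat \<Rightarrow> nat \<Rightarrow> 'a set"
  assumes fin: "finite I" "finite Q" "finite X1" "finite X2"
    and ab: "1 \<le> card I" "1 \<le> card Q" "card Q \<le> t" "t + 1 \<le> card I + card Q"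
    and c2: "\<And>i v. \<lbrakk>i \<in> I; v \<in> Q\<rbrakk> \<Longrightarrow> card (c i v) = 2 \<and> (c i v \<subseteq> X1 \<or> c i v \<subseteq> X2)"
    and dis: "\<And>i i' v v'. \<lbrakk>i \<in> I; i' \<in> I; v \<in> Q; v' \<in> Q; v \<noteq> v'\<rbrakk> \<Longrightarrow> c i v \<inter> c i' v' = {}"
    and alt: "\<And>v. v \<in> Q \<Longrightarrow> (\<forall>i\<in>I. z v \<in> c i v \<and> (\<forall>i'\<in>I. i \<noteq> i' \<longrightarrow> c i v \<inter> c i' v \<subseteq> {z v})) \<or>
        (\<forall>i\<in>I. \<forall>i'\<in>I. i \<noteq> i' \<longrightarrow> c i v \<inter> c i' v = {})"
    and X: "card X1 \<le> t" "card X2 \<le> t" "card (X1 \<union> X2) < 2 * t" "X1 \<inter> X2 = {}"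
  shows False
proof -
  define U where "U v = (\<Union>i\<in>I. c i v)" for v
  have finc: "finite (c i v)" if "i \<in> I" "v \<in> Q" for i v
    using c2[OF that] by (intro card_ge_0_finite) simp
  have finU: "finite (U v)" if "v \<in> Q" for v unfolding U_def using fin(1) finc that by blast
  have UX: "U v \<subseteq> X1 \<union> X2" if "v \<in> Q" for v unfolding U_def using c2 that by blast
  have Ustar: "card I + 1 \<le> card (U v)"
    if v: "v \<in> Q" and st: "\<forall>i\<in>I. z v \<in> c i v \<and> (\<forall>i'\<in>I. i \<noteq> i' \<longrightarrow> c i v \<inter> c i' v \<subseteq> {z v})" for v
  proof -
    have "\<forall>i\<in>I. \<exists>y. y \<in> c i v \<and> y \<noteq> z v"
    proof
      fix i assume "i \<in> I"
      then have "card (c i v) = 2" using c2 v by blast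
      then obtain a b where "c i v = {a, b}" "a \<noteq> b" by (auto simp: card_2_iff)
      then show "\<exists>y. y \<in> c i v \<and> y \<noteq> z v" by blast
    qed
    from bchoice[OF this] obtain g where g: "\<forall>i\<in>I. g i \<in> c i v \<and> g i \<noteq> z v" by (rule exE)
    have "inj_on g I"
    proof (rule inj_onI, rule ccontr)
      fix i i' assume i: "i \<in> I" "i' \<in> I" "g i = g i'" "i \<noteq> i'"
      then have "g i \<in> c i v \<inter> c i' v" using g by auto
      then have "g i = z v" using st i by blast
      then show False using g i(1) by blast
    qed
    have "I \<noteq> {}" using ab(1) by auto
    then have "insert (z v) (g ` I) \<subseteq> U v" unfolding U_def using g st by blast
    then have "card (insert (z v) (g ` I)) \<le> card (U v)" using finU[OF v] by (intro card_mono)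
    moreover have "z v \<notin> g ` I" using g by auto
    ultimately show ?thesis using fin(1) card_image[OF \<open>inj_on g I\<close>] by simp
  qed
  have Udis: "card (U v) = 2 * card I"
    if v: "v \<in> Q" and d: "\<forall>i\<in>I. \<forall>i'\<in>I. i \<noteq> i' \<longrightarrow> c i v \<inter> c i' v = {}" for v
  proof -
    have "card (U v) = (\<Sum>i\<in>I. card (c i v))"
      unfolding U_def using fin(1) finc v d by (intro card_UN_disjoint) auto
    also have "\<dots> = (\<Sum>i\<in>I. 2)" using c2 v by (intro sum.cong) auto
    finally show ?thesis by simp
  qed
  have Ucard: "card I + 1 \<le> card (U v)" if v: "v \<in> Q" for v
    using alt[OF v]
  proof
    assume "\<forall>i\<in>I. z v \<in> c i v \<and> (\<forall>i'\<in>I. i \<noteq> i' \<longrightarrow> c i v \<inter> c i' v \<subseteq> {z v})"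
    then show ?thesis by (rule Ustar[OF v])
  next
    assume "\<forall>i\<in>I. \<forall>i'\<in>I. i \<noteq> i' \<longrightarrow> c i v \<inter> c i' v = {}"
    then show ?thesis using Udis[OF v] ab(1) by simp
  qed
  have "card Q * (card I + 1) = (\<Sum>v\<in>Q. card I + 1)" by simp
  also have "\<dots> \<le> (\<Sum>v\<in>Q. card (U v))" by (intro sum_mono Ucard)
  also have "\<dots> = card (\<Union>v\<in>Q. U v)"
  proof (rule card_UN_disjoint[symmetric])
    show "\<forall>v\<in>Q. \<forall>v'\<in>Q. v \<noteq> v' \<longrightarrow> U v \<inter> U v' = {}" unfolding U_def using dis by blast
  qed (use fin finU in auto)
  also have "\<dots> \<le> card (X1 \<union> X2)" using UX fin by (intro card_mono) auto
  finally have tot: "card Q * (card I + 1) < 2 * t" using X(3) by linarith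
  show False
  proof (cases "card Q = 1")
    case False
    \<comment> \<open>In these variables \<open>(r + 2) * (q + 2) = 2 * t + r * q\<close>.\<close>
    define r where "r = card Q - 2"
    define q where "q = t - card Q"
    have r: "card Q = r + 2" unfolding r_def using False ab(2) by linarith
    have q: "t = card Q + q" unfolding q_def using ab(3) by simp
    have "q + 1 \<le> card I" using ab(4) q by linarith
    then have "(r + 2) * (q + 2) \<le> card Q * (card I + 1)" unfolding r by (intro mult_le_mono) auto
    moreover have "2 * t \<le> (r + 2) * (q + 2)" unfolding q r by (simp add: algebra_simps)
    ultimately show False using tot by linarith
  next
    case True
    then obtain v where v: "Q = {v}" by (rule card_1_singletonE)
    have It: "t \<le> card I" using ab(4) True by simp
    have vQ: "v \<in> Q" using v by simp
    from alt[OF vQ] show False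
    proof (elim disjE)
      assume h: "\<forall>i\<in>I. z v \<in> c i v \<and> (\<forall>i'\<in>I. i \<noteq> i' \<longrightarrow> c i v \<inter> c i' v \<subseteq> {z v})"
      then have "card I + 1 \<le> card (U v)" using v by (intro Ustar) auto
      moreover have "U v \<subseteq> X1 \<or> U v \<subseteq> X2"
      proof (cases "z v \<in> X1")
        case True
        then have "c i v \<subseteq> X1" if "i \<in> I" for i using c2[of i v] h that X(4) v by blast
        then show ?thesis unfolding U_def by blast
      next
        case False
        then have "c i v \<subseteq> X2" if "i \<in> I" for i using c2[of i v] h that v by blast
        then show ?thesis unfolding U_def by blast
      qed
      then have "card (U v) \<le> t" using X(1,2) fin(3,4) card_mono by (meson order_trans)
      ultimately show False using It by linarith
    next
      assume "\<forall>i\<in>I. \<forall>i'\<in>I. i \<noteq> i' \<longrightarrow> c i v \<inter> c i' v = {}"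
      then have "card (U v) = 2 * card I" using v by (intro Udis) auto
      moreover have "card (U v) \<le> card (X1 \<union> X2)" using UX[of v] v fin by (intro card_mono) auto
      ultimately show False using It X(3) by linarith
    qed
  qed
qed

text \<open>If both ends of some edge are placed, the edges at these two ends form a double star, a
  tree on \<open>card I + card Q\<close> vertices inside one block, which is too small. Otherwise
  one whole side is unplaced, and the edges decompose into disjoint stars or matchings indexed by
  the other side, as in \<open>star_family_bound\<close>.\<close>

lemma no_spread_in_two_blocks:
  assumes sp: "spread s t S x b" and S: "S \<subseteq> bip_verts s t"
    and I: "I \<subseteq> {..<s}" and Q: "Q \<subseteq> {..<t}"
    and fX: "finite X1" "finite X2"
    and ab: "1 \<le> card I" "1 \<le> card Q" "card I \<le> t'" "card Q \<le> t'" "t' + 1 \<le> card I + card Q"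
    and b2: "\<And>i j. \<lbrakk>i \<in> I; j \<in> Q\<rbrakk> \<Longrightarrow> card (b i j) = 2 \<and> (b i j \<subseteq> X1 \<or> b i j \<subseteq> X2)"
    and X: "card X1 \<le> t'" "card X2 \<le> t'" "card (X1 \<union> X2) < 2 * t'" "X1 \<inter> X2 = {}"
  shows False
proof -
  have fin: "finite I" "finite Q" using I Q by (auto intro: finite_subset)
  have ij: "i < s" "j < t" if "i \<in> I" "j \<in> Q" for i j using that I Q by auto
  have int: "b i j \<inter> b i' j' \<subseteq> x ` ({Inl i, Inr j} \<inter> {Inl i', Inr j'} \<inter> S)"
    if "i \<in> I" "j \<in> Q" "i' \<in> I" "j' \<in> Q" "(i, j) \<noteq> (i', j')" for i j i' j'
    using spreadD(3)[OF sp ij[OF that(1,2)] ij[OF that(3,4)] that(5)] .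
  have xb: "x (Inl i) \<in> b i j" if "i \<in> I" "j \<in> Q" "Inl i \<in> S" for i j
    using spreadD(2)[OF sp ij[OF that(1,2)]] that(3) by blast
  have xb': "x (Inr j) \<in> b i j" if "i \<in> I" "j \<in> Q" "Inr j \<in> S" for i j
    using spreadD(2)[OF sp ij[OF that(1,2)]] that(3) by blast
  consider (core) u v where "u \<in> I" "v \<in> Q" "Inl u \<in> S" "Inr v \<in> S"
    | (left) "\<forall>i\<in>I. Inl i \<notin> S" | (right) "\<forall>j\<in>Q. Inr j \<notin> S" by blast
  then show False
  proof cases
    case left
    show False
    proof (rule star_family_bound[OF fin fX ab(1,2,4,5), where c = b and z = "\<lambda>v. x (Inr v)"])
      show "b i v \<inter> b i' v' = {}" if "i \<in> I" "i' \<in> I" "v \<in> Q" "v' \<in> Q" "v \<noteq> v'" for i i' v v'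
        using int[of i v i' v'] that left by auto
      fix v assume v: "v \<in> Q"
      show "(\<forall>i\<in>I. x (Inr v) \<in> b i v \<and> (\<forall>i'\<in>I. i \<noteq> i' \<longrightarrow> b i v \<inter> b i' v \<subseteq> {x (Inr v)})) \<or>
        (\<forall>i\<in>I. \<forall>i'\<in>I. i \<noteq> i' \<longrightarrow> b i v \<inter> b i' v = {})"
      proof (cases "Inr v \<in> S")
        case True
        have "b i v \<inter> b i' v \<subseteq> {x (Inr v)}" if "i \<in> I" "i' \<in> I" "i \<noteq> i'" for i i'
          using int[of i v i' v] that v by auto
        then show ?thesis using xb' v True by blast
      next
        case False
        have "b i v \<inter> b i' v = {}" if "i \<in> I" "i' \<in> I" "i \<noteq> i'" for i i'
          using int[of i v i' v] that v False by auto
        then show ?thesis by blast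
      qed
    qed (use b2 X in auto)
  next
    case right
    have ab': "t' + 1 \<le> card Q + card I" using ab(5) by simp
    show False
    proof (rule star_family_bound[OF fin(2,1) fX ab(2,1,3) ab', where c = "\<lambda>j i. b i j" and z = "\<lambda>v. x (Inl v)"])
      show "b v i \<inter> b v' i' = {}" if "i \<in> Q" "i' \<in> Q" "v \<in> I" "v' \<in> I" "v \<noteq> v'" for i i' v v'
        using int[of v i v' i'] that right by auto
      fix v assume v: "v \<in> I"
      show "(\<forall>i\<in>Q. x (Inl v) \<in> b v i \<and> (\<forall>i'\<in>Q. i \<noteq> i' \<longrightarrow> b v i \<inter> b v i' \<subseteq> {x (Inl v)})) \<or>
        (\<forall>i\<in>Q. \<forall>i'\<in>Q. i \<noteq> i' \<longrightarrow> b v i \<inter> b v i' = {})"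
      proof (cases "Inl v \<in> S")
        case True
        have "b v i \<inter> b v i' \<subseteq> {x (Inl v)}" if "i \<in> Q" "i' \<in> Q" "i \<noteq> i'" for i i'
          using int[of v i v i'] that v by auto
        then show ?thesis using xb v True by blast
      next
        case False
        have "b v i \<inter> b v i' = {}" if "i \<in> Q" "i' \<in> Q" "i \<noteq> i'" for i i'
          using int[of v i v i'] that v False by auto
        then show ?thesis by blast
      qed
    qed (use b2 X in auto)
  next
    case core
    have other: "\<exists>y. y \<in> b i j \<and> y \<noteq> z" if "i \<in> I" "j \<in> Q" for i j z
    proof -
      have "card (b i j) = 2" using b2 that by blast
      then show ?thesis by (auto simp: card_2_iff)
    qed
    \<comment> \<open>Far ends of the edges of the double star. On the central edge they are the two
      centres, so \<open>ya\<close> and \<open>yb\<close> together enumerate all vertices of the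
      tree.\<close>
    define yb where "yb j = (SOME y. y \<in> b u j \<and> y \<noteq> x (Inl u))" for j
    define ya where "ya i = (SOME y. y \<in> b i v \<and> y \<noteq> x (Inr v))" for i
    have yb: "yb j \<in> b u j \<and> yb j \<noteq> x (Inl u)" if "j \<in> Q" for j
      unfolding yb_def by (rule someI_ex[OF other[OF core(1) that]])
    have ya: "ya i \<in> b i v \<and> ya i \<noteq> x (Inr v)" if "i \<in> I" for i
      unfolding ya_def by (rule someI_ex[OF other[OF that core(2)]])
    have xne: "x (Inl u) \<noteq> x (Inr v)" using inj_onD[OF spreadD(1)[OF sp], of "Inl u" "Inr v"] core by auto
    have buv: "b u v = {x (Inl u), x (Inr v)}"
    proof -
      have "finite (b u v)" using b2[OF core(1,2)] by (intro card_ge_0_finite) simp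
      moreover have "{x (Inl u), x (Inr v)} \<subseteq> b u v" using xb xb' core by simp
      moreover have "card {x (Inl u), x (Inr v)} = card (b u v)" using b2[OF core(1,2)] xne by simp
      ultimately show ?thesis by (metis card_subset_eq)
    qed
    have yau: "ya u = x (Inl u)" using ya[OF core(1)] buv by auto
    have ybv: "yb v = x (Inr v)" using yb[OF core(2)] buv by auto
    have "\<exists>Y. (Y = X1 \<or> Y = X2) \<and> b u v \<subseteq> Y" using b2[OF core(1,2)] by blast
    then obtain Y where Y: "Y = X1 \<or> Y = X2" "b u v \<subseteq> Y" by blast
    have inY: "b i j \<subseteq> Y" if "i \<in> I" "j \<in> Q" "b i j \<inter> Y \<noteq> {}" for i j
      using b2[OF that(1,2)] that(3) Y(1) X(4) by blast
    have "ya i \<in> Y" if i: "i \<in> I" for i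
    proof -
      have "x (Inr v) \<in> b i v \<inter> Y" using xb'[OF i core(2,4)] buv Y(2) by simp
      then show ?thesis using inY[OF i core(2)] ya[OF i] by blast
    qed
    moreover have "yb j \<in> Y" if j: "j \<in> Q" for j
    proof -
      have "x (Inl u) \<in> b u j \<inter> Y" using xb[OF core(1) j core(3)] buv Y(2) by simp
      then show ?thesis using inY[OF core(1) j] yb[OF j] by blast
    qed
    ultimately have sub: "ya ` I \<union> yb ` Q \<subseteq> Y" by blast
    have "inj_on ya I"
    proof (rule inj_onI, rule ccontr)
      fix i i' assume h: "i \<in> I" "i' \<in> I" "ya i = ya i'" "i \<noteq> i'"
      then have "ya i \<in> b i v \<inter> b i' v" using ya[OF h(1)] ya[OF h(2)] by simp
      then have "ya i = x (Inr v)" using int[OF h(1) core(2) h(2) core(2)] h(4) by auto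
      then show False using ya[OF h(1)] by blast
    qed
    moreover have "inj_on yb Q"
    proof (rule inj_onI, rule ccontr)
      fix i i' assume h: "i \<in> Q" "i' \<in> Q" "yb i = yb i'" "i \<noteq> i'"
      then have "yb i \<in> b u i \<inter> b u i'" using yb[OF h(1)] yb[OF h(2)] by simp
      then have "yb i = x (Inl u)" using int[OF core(1) h(1) core(1) h(2)] h(4) by auto
      then show False using yb[OF h(1)] by blast
    qed
    moreover have "ya i \<noteq> yb j" if h: "i \<in> I" "j \<in> Q" for i j
    proof (cases "i = u \<or> j = v")
      case True then show ?thesis using yau ybv yb[OF h(2)] ya[OF h(1)] by auto
    next
      case False
      then have "b i v \<inter> b u j = {}" using int[OF h(1) core(2) core(1) h(2)] by auto
      then show ?thesis using ya[OF h(1)] yb[OF h(2)] by auto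
    qed
    then have "ya ` I \<inter> yb ` Q = {}" by blast
    ultimately have "card (ya ` I \<union> yb ` Q) = card I + card Q"
      using fin by (simp add: card_Un_disjoint card_image)
    moreover have "card (ya ` I \<union> yb ` Q) \<le> card Y" using sub Y(1) fX by (intro card_mono) auto
    moreover have "card Y \<le> t'" using Y(1) X by auto
    ultimately show False using ab(5) by linarith
  qed
qed

text \<open>The configuration \<open>K\<^sub>t \<union> K\<^sub>t\<^sub>-\<^sub>1\<close> below \<open>s - 1\<close> full vertices. Each of these vertices accounts for the
  edges at a single vertex of the bipartite graph, which leaves a complete bipartite graph on at
  least \<open>t + 1\<close> vertices to be split inside \<open>K\<^sub>t \<union> K\<^sub>t\<^sub>-\<^sub>1\<close>.\<close>

lemma square_in_config_vals:
  assumes st: "1 \<le> s" "s \<le> t"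
  shows "int ((t - 1) * (t - 1)) \<in> config_vals s t"
proof -
  define N where "N = (s - 1) + (2 * t - 1)"
  define W where "W = {..<s - 1}"
  define X1 where "X1 = {s - 1..<s - 1 + t}"
  define X2 where "X2 = {s - 1 + t..<N}"
  define PW where "PW = {e \<in> nsets {..<N} 2. e \<inter> W \<noteq> {}}"
  define B where "B = PW \<union> (nsets X1 2 \<union> nsets X2 2)"
  have t1: "1 \<le> t" using st by simp
  have cX: "card X1 = t" "card X2 = t - 1" unfolding X1_def X2_def N_def using t1 by auto
  have X12: "X1 \<inter> X2 = {}" "X1 \<inter> W = {}" "X2 \<inter> W = {}" unfolding X1_def X2_def W_def by auto
  have fX: "finite X1" "finite X2" unfolding X1_def X2_def by auto
  have BN: "B \<subseteq> nsets {..<N} 2"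
    unfolding B_def PW_def X1_def X2_def N_def using t1 by (auto elim!: nsets_2_E)
  have sub2: "e \<subseteq> A" "e \<noteq> {}" if "e \<in> nsets A 2" for e and A :: "nat set"
    using that by (auto elim!: nsets_2_E)
  have d1: "nsets X1 2 \<inter> nsets X2 2 = {}" using sub2 X12(1) by blast
  have d2: "PW \<inter> (nsets X1 2 \<union> nsets X2 2) = {}" unfolding PW_def using sub2 X12(2,3) by blast
  have "card B = card PW + (card (nsets X1 2) + card (nsets X2 2))"
    unfolding B_def using d1 d2 fX by (simp add: card_Un_disjoint PW_def)
  also have "card PW = ((s - 1) choose 2) + (s - 1) * (N - (s - 1))"
    unfolding PW_def using card_pairs_meeting[of "{..<N}" W] by (simp add: W_def N_def)
  also have "card (nsets X1 2) + card (nsets X2 2) = (t - 1) * (t - 1)"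
  proof -
    obtain r where r: "t = Suc r" using t1 by (cases t) auto
    have "(Suc r choose 2) + (r choose 2) = r * r"
      by (induction r) (auto simp: choose_two_Suc)
    then show ?thesis using cX fX r by (simp add: card_nsets_2)
  qed
  finally have val: "int (card B) - int ((s - 1) choose 2) - int ((s - 1) * (N - (s - 1))) = int ((t - 1) * (t - 1))"
    by simp
  have "\<not> split_in s t (config_edges s N B)"
  proof
    assume "split_in s t (config_edges s N B)"
    then obtain S x b where S: "S \<subseteq> bip_verts s t" and sp: "spread s t S x b"
      and b: "\<And>i j. \<lbrakk>i < s; j < t\<rbrakk> \<Longrightarrow> b i j \<in> config_edges s N B"
      unfolding split_in_def by blast
    have be: "b i j \<inter> W \<noteq> {} \<or> (card (b i j) = 2 \<and> (b i j \<subseteq> X1 \<or> b i j \<subseteq> X2))" if ij: "i < s" "j < t" for i j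
    proof -
      consider "b i j \<in> PW" | "b i j \<in> nsets X1 2" | "b i j \<in> nsets X2 2" | w y where "b i j = {w, y}" "w < s - 1"
        using b[OF ij] unfolding config_edges_def B_def by blast
      then show ?thesis
      proof cases
        case 1 then show ?thesis unfolding PW_def by blast
      next
        case 2 then show ?thesis unfolding nsets_def by blast
      next
        case 3 then show ?thesis unfolding nsets_def by blast
      next
        case 4 then show ?thesis unfolding W_def by blast
      qed
    qed
    \<comment> \<open>A full vertex \<open>w\<close> that is the image of a placed vertex accounts
      for that vertex. Otherwise \<open>w\<close> lies on at most one of the edges, and the left end
      of that edge is given up.\<close>
    define kill where "kill w = (if w \<in> x ` S then the_inv_into S x w
        else Inl (SOME i. i < s \<and> (\<exists>j<t. w \<in> b i j)))" for w
    define K where "K = kill ` W"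
    have finK: "finite K" and cK: "card K \<le> s - 1"
      unfolding K_def W_def using card_image_le[of "{..<s - 1}" kill] by auto
    define I where "I = {i. i < s \<and> Inl i \<notin> K}"
    define Q where "Q = {j. j < t \<and> Inr j \<notin> K}"
    have avoid: "b i j \<inter> W = {}" if i: "i \<in> I" and j: "j \<in> Q" for i j
    proof (rule ccontr)
      assume "b i j \<inter> W \<noteq> {}"
      then obtain w where w: "w \<in> b i j" "w \<in> W" by blast
      have ij: "i < s" "j < t" using i j unfolding I_def Q_def by auto
      have kK: "kill w \<in> K" unfolding K_def using w(2) by blast
      show False
      proof (cases "w \<in> x ` S")
        case True
        then obtain u where u: "u \<in> S" "w = x u" by blast
        then have "kill w = u" unfolding kill_def using spreadD(1)[OF sp] by (simp add: the_inv_into_f_f)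
        moreover have "u \<in> {Inl i, Inr j}" using spread_placed_mem[OF sp S ij u(1)] w(1) u(2) by simp
        ultimately show False using kK i j unfolding I_def Q_def by auto
      next
        case False
        have "\<exists>i. i < s \<and> (\<exists>j<t. w \<in> b i j)" using ij w(1) by blast
        from someI_ex[OF this] obtain i' j' where e: "kill w = Inl i'" "i' < s" "j' < t" "w \<in> b i' j'"
          using False unfolding kill_def by auto
        have "(i, j) = (i', j')"
        proof (rule ccontr)
          assume "(i, j) \<noteq> (i', j')"
          then have "w \<in> x ` ({Inl i, Inr j} \<inter> {Inl i', Inr j'} \<inter> S)"
            using spreadD(3)[OF sp ij e(2,3)] w(1) e(4) by blast
          then show False using False by blast
        qed
        then show False using kK e(1) i unfolding I_def by simp
      qed
    qed
    \<comment> \<open>At most \<open>s - 1\<close> vertices are given up. So both sides keep a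
      vertex, the right one because of \<open>s \<le> t\<close>, and together they keep at least
      \<open>t + 1\<close>.\<close>
    have cIQ: "s + t \<le> card I + card Q + (s - 1)" "s \<le> card I + (s - 1)" "t \<le> card Q + (s - 1)"
    proof -
      define KI where "KI = {i. i < s \<and> Inl i \<in> K}"
      define KQ where "KQ = {j. j < t \<and> Inr j \<in> K}"
      have fKI: "finite KI" "finite KQ" unfolding KI_def KQ_def by auto
      have "card KI + card KQ = card (Inl ` KI \<union> Inr ` KQ :: (nat + nat) set)"
        using fKI by (subst card_Un_disjoint) (auto simp: card_image)
      also have "\<dots> \<le> card K" using finK unfolding KI_def KQ_def by (intro card_mono) auto
      finally have 1: "card KI + card KQ \<le> s - 1" using cK by linarith
      have "card I + card KI = s"
      proof -
        have "card I + card KI = card (I \<union> KI)"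
          unfolding I_def KI_def by (intro card_Un_disjoint[symmetric]) auto
        also have "I \<union> KI = {..<s}" unfolding I_def KI_def by auto
        finally show ?thesis by simp
      qed
      moreover have "card Q + card KQ = t"
      proof -
        have "card Q + card KQ = card (Q \<union> KQ)"
          unfolding Q_def KQ_def by (intro card_Un_disjoint[symmetric]) auto
        also have "Q \<union> KQ = {..<t}" unfolding Q_def KQ_def by auto
        finally show ?thesis by simp
      qed
      ultimately show "s + t \<le> card I + card Q + (s - 1)" "s \<le> card I + (s - 1)" "t \<le> card Q + (s - 1)"
        using 1 by linarith+
    qed
    have IQ: "I \<subseteq> {..<s}" "Q \<subseteq> {..<t}" unfolding I_def Q_def by auto
    have cI: "card I \<le> s" "card Q \<le> t" using card_mono[OF _ IQ(1)] card_mono[OF _ IQ(2)] by auto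
    have b2: "card (b i j) = 2 \<and> (b i j \<subseteq> X1 \<or> b i j \<subseteq> X2)" if "i \<in> I" "j \<in> Q" for i j
      using be[of i j] avoid[OF that] that unfolding I_def Q_def by blast
    have X: "card (X1 \<union> X2) < 2 * t" using cX X12(1) fX t1 by (simp add: card_Un_disjoint)
    show False
    proof (rule no_spread_in_two_blocks[OF sp S IQ fX _ _ _ _ _ b2 _ _ X X12(1)])
      show "1 \<le> card I" "1 \<le> card Q" "card I \<le> t" "card Q \<le> t" "t + 1 \<le> card I + card Q"
        using cIQ cI st by linarith+
    qed (simp_all add: cX)
  qed
  then show ?thesis unfolding config_vals_def using BN val
    by (intro CollectI exI[of _ N] exI[of _ B]) (simp add: N_def)
qed

text \<open>The vertices of a configuration are placed in a single residue class of the Turan graph.\<close>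

lemma config_graph:
  assumes st: "1 \<le> s" "1 \<le> t" and p: "1 \<le> p" and v: "v \<in> config_vals s t"
  shows "\<exists>n0. \<forall>n\<ge>n0. \<exists>E. E \<subseteq> nsets {..<n} 2 \<and> \<not> clique_system (p + 1) s t E \<and>
     int (card E) = base_count p s n + v"
proof -
  obtain N B where N: "s - 1 \<le> N" and B: "B \<subseteq> nsets {..<N} 2" and ns: "\<not> split_in s t (config_edges s N B)"
    and v_eq: "v = int (card B) - int ((s - 1) choose 2) - int ((s - 1) * (N - (s - 1)))"
    using v unfolding config_vals_def by blast
  define a where "a = s - 1"
  \<comment> \<open>The full vertices stay in place, and \<open>a + i\<close> goes to
    \<open>a + i * p\<close>: the rest of the configuration runs through residue class 0 of the
    Turan graph shifted by \<open>a\<close>.\<close>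
  define \<psi> where "\<psi> y = (if y < a then y else a + (y - a) * p)" for y
  have \<psi>_lt: "\<psi> y = y" if "y < a" for y using that unfolding \<psi>_def by simp
  have \<psi>_ge: "a \<le> \<psi> y" "\<psi> y - a = (y - a) * p" if "a \<le> y" for y using that unfolding \<psi>_def by auto
  have \<psi>a: "\<psi> y < a \<longleftrightarrow> y < a" for y unfolding \<psi>_def by auto
  have inj: "inj \<psi>"
  proof (rule injI)
    fix y z assume e: "\<psi> y = \<psi> z"
    show "y = z"
    proof (cases "y < a")
      case True then show ?thesis using e \<psi>a[of y] \<psi>a[of z] \<psi>_lt by metis
    next
      case False
      then have z: "a \<le> z" "a \<le> y" using e \<psi>a[of y] \<psi>a[of z] by auto
      then have "(y - a) * p = (z - a) * p" using \<psi>_ge(2)[of y] \<psi>_ge(2)[of z] unfolding e by metis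
      then show ?thesis using p z by simp
    qed
  qed
  define n0 where "n0 = a + N * p + N"
  have "\<exists>E. E \<subseteq> nsets {..<n} 2 \<and> \<not> clique_system (p + 1) s t E \<and> int (card E) = base_count p s n + v"
    if n: "n0 \<le> n" for n
  proof -
    have \<psi>n: "\<psi> y < n" if "y < N" for y
    proof (cases "y < a")
      case True then show ?thesis using \<psi>_lt[OF True] n that unfolding n0_def by simp
    next
      case False
      have "y - a < N" using that by simp
      then have "(y - a) * p < N * p" using p by (intro mult_strict_right_mono) auto
      moreover have "a + N * p + N \<le> n" using n unfolding n0_def .
      ultimately have "a + (y - a) * p < n" by linarith
      then show ?thesis using False unfolding \<psi>_def by simp
    qed
    \<comment> \<open>\<open>E1\<close> is the shifted Turan graph, \<open>E2\<close> the
      configuration, and \<open>E3\<close> joins the full vertices to everything outside the image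
      of the configuration.\<close>
    define E1 where "E1 = ((`) (\<lambda>u. u + a)) ` edges (turan_graph p (n - a))"
    define E2 where "E2 = ((`) \<psi>) ` B"
    define Yo where "Yo = {a..<n} - \<psi> ` {a..<N}"
    define E3 where "E3 = (\<lambda>(w, y). {w, y}) ` ({..<a} \<times> Yo)"
    define E where "E = E1 \<union> (E2 \<union> E3)"
    have an: "a \<le> n" "N \<le> n" using n unfolding n0_def by auto
    have E1I: "\<exists>u w. e = {u, w} \<and> a \<le> u \<and> a \<le> w \<and> u < n \<and> w < n \<and> (u - a) mod p \<noteq> (w - a) mod p" if eE: "e \<in> E1" for e
    proof -
      obtain d where d: "e = (\<lambda>u. u + a) ` d" "d \<in> edges (turan_graph p (n - a))"
        using eE unfolding E1_def by (rule imageE)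
      from d(2) obtain u w where "d = {u, w}" "u < n - a" "w < n - a" "u mod p \<noteq> w mod p"
        unfolding edges_turan by blast
      note this d(1)
      then show ?thesis by (intro exI[of _ "u + a"] exI[of _ "w + a"]) auto
    qed
    have E2I: "\<exists>d. d \<in> B \<and> e = \<psi> ` d \<and> d \<subseteq> {..<N} \<and> card d = 2" if "e \<in> E2" for e
      using that B unfolding E2_def nsets_def by auto
    have E3I: "\<exists>w y. e = {w, y} \<and> w < a \<and> y \<in> Yo" if "e \<in> E3" for e
      using that unfolding E3_def by auto
    have sub1: "E1 \<subseteq> nsets {..<n} 2"
    proof
      fix e assume "e \<in> E1"
      then obtain u w where "e = {u, w}" "u < n" "w < n" "(u - a) mod p \<noteq> (w - a) mod p" using E1I by blast
      then show "e \<in> nsets {..<n} 2" by auto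
    qed
    have sub2: "E2 \<subseteq> nsets {..<n} 2"
    proof
      fix e assume "e \<in> E2"
      then obtain d where d: "e = \<psi> ` d" "d \<subseteq> {..<N}" "card d = 2" using E2I by blast
      moreover have "card e = 2" using d inj by (simp add: card_image inj_on_subset)
      moreover have "finite e" using \<open>card e = 2\<close> by (intro card_ge_0_finite) simp
      ultimately show "e \<in> nsets {..<n} 2" using \<psi>n unfolding nsets_def by auto
    qed
    have sub3: "E3 \<subseteq> nsets {..<n} 2"
    proof
      fix e assume "e \<in> E3"
      then obtain w y where "e = {w, y}" "w < a" "y \<in> Yo" using E3I by blast
      then show "e \<in> nsets {..<n} 2" unfolding Yo_def by auto
    qed
    have EV: "E \<subseteq> nsets {..<n} 2" unfolding E_def using sub1 sub2 sub3 by blast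
    have fin: "finite E1" "finite E2" "finite E3" using finite_subset[OF sub1] finite_subset[OF sub2] finite_subset[OF sub3] by simp_all
    have dis12: "E1 \<inter> E2 = {}"
    proof -
      have False if e: "e \<in> E1" "e \<in> E2" for e
      proof -
        obtain u w where uw: "e = {u, w}" "a \<le> u" "a \<le> w" "(u - a) mod p \<noteq> (w - a) mod p" using E1I[OF e(1)] by blast
        obtain d where d: "e = \<psi> ` d" using E2I[OF e(2)] by blast
        have "(z - a) mod p = 0" if ze: "z \<in> e" for z
        proof -
          obtain y where "z = \<psi> y" using ze d by blast
          moreover have "a \<le> z" using ze uw by auto
          ultimately have "z - a = (y - a) * p" using \<psi>a[of y] \<psi>_ge(2)[of y] by simp
          then show ?thesis by simp
        qed
        then have "(u - a) mod p = 0" "(w - a) mod p = 0" using uw(1) by blast+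
        then show False using uw(4) by simp
      qed
      then show ?thesis by blast
    qed
    have dis13: "E1 \<inter> E3 = {}"
    proof -
      have False if e: "e \<in> E1" "e \<in> E3" for e
      proof -
        obtain u w where "e = {u, w}" "a \<le> u" "a \<le> w" using E1I[OF e(1)] by blast
        moreover obtain w' y where "e = {w', y}" "w' < a" using E3I[OF e(2)] by blast
        ultimately show False by (auto simp: doubleton_eq_iff)
      qed
      then show ?thesis by blast
    qed
    have dis23: "E2 \<inter> E3 = {}"
    proof -
      have False if e: "e \<in> E2" "e \<in> E3" for e
      proof -
        obtain d where d: "e = \<psi> ` d" "d \<subseteq> {..<N}" using E2I[OF e(1)] by blast
        obtain w y where wy: "e = {w, y}" "y \<in> Yo" using E3I[OF e(2)] by blast
        then obtain z where z: "z \<in> d" "y = \<psi> z" using d(1) by blast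
        have "a \<le> y" using wy(2) unfolding Yo_def by simp
        then have "a \<le> z" using z(2) \<psi>a[of z] by simp
        then have "y \<in> \<psi> ` {a..<N}" using z d(2) by auto
        then show False using wy(2) unfolding Yo_def by blast
      qed
      then show ?thesis by blast
    qed
    have c1: "card E1 = turan_edges p (n - a)"
    proof -
      have "inj_on ((`) (\<lambda>u. u + a)) (edges (turan_graph p (n - a)))"
        by (intro inj_on_subset[OF inj_on_image_Pow, of _ UNIV]) (auto simp: inj_on_def)
      then show ?thesis unfolding E1_def turan_edges_def by (rule card_image)
    qed
    have c2: "card E2 = card B"
    proof -
      have "inj_on ((`) \<psi>) B" using inj by (intro inj_on_subset[OF inj_on_image_Pow, of _ UNIV]) auto
      then show ?thesis unfolding E2_def by (rule card_image)
    qed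
    have "card Yo = (n - a) - (N - a)"
    proof -
      have "\<psi> ` {a..<N} \<subseteq> {a..<n}" using \<psi>n \<psi>_ge(1) by auto
      then show ?thesis unfolding Yo_def using inj by (simp add: card_Diff_subset card_image inj_on_subset)
    qed
    moreover have "inj_on (\<lambda>(w, y). {w, y}) ({..<a} \<times> Yo)"
      unfolding Yo_def by (auto simp: inj_on_def doubleton_eq_iff)
    ultimately have c3: "card E3 = a * ((n - a) - (N - a))"
      unfolding E3_def by (simp add: card_image card_cartesian_product)
    have "card E = turan_edges p (n - a) + (card B + a * ((n - a) - (N - a)))"
      unfolding E_def using fin dis12 dis13 dis23 c1 c2 c3
      by (simp add: card_Un_disjoint Int_Un_distrib)
    moreover have "a * ((n - a) - (N - a)) + a * (N - a) = a * (n - a)"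
    proof -
      have "(n - a) - (N - a) + (N - a) = n - a" using an by simp
      then show ?thesis by (metis distrib_left)
    qed
    then have "int (a * ((n - a) - (N - a))) + int (a * (N - a)) = int (a * (n - a))" by (metis of_nat_add)
    ultimately have cE: "int (card E) = base_count p s n + v"
      unfolding v_eq base_count_def a_def[symmetric] by simp
    \<comment> \<open>The range over all natural numbers, that is, the full vertices and the whole
      of class 0. Two adjacent vertices outside \<open>R\<close> have different nonzero
      residues.\<close>
    define R where "R = range \<psi>"
    have R_lt: "y \<in> R" if "y < a" for y using \<psi>_lt[OF that] unfolding R_def by (metis rangeI)
    have R_mod: "y \<in> R" if y: "a \<le> y" "(y - a) mod p = 0" for y
    proof -
      have "y - a = ((y - a) div p) * p" using y(2) by auto
      then have "\<psi> (a + (y - a) div p) = y" using y(1) unfolding \<psi>_def by simp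
      then show ?thesis unfolding R_def by (metis rangeI)
    qed
    have mod_R: "(y - a) mod p = 0" if y: "y \<in> R" "a \<le> y" for y
    proof -
      obtain z where z: "y = \<psi> z" using y(1) unfolding R_def by blast
      then have "a \<le> z" using y(2) \<psi>a[of z] by simp
      then show ?thesis using \<psi>_ge(2)[of z] z by simp
    qed
    have notR: "(u - a) mod p \<noteq> (w - a) mod p" if uw: "{u, w} \<in> E" "u \<notin> R" "w \<notin> R" for u w
    proof -
      have "{u, w} \<notin> E2" using uw(2) unfolding E2_def R_def by blast
      moreover have "{u, w} \<notin> E3"
        using E3I[of "{u, w}"] R_lt uw(2,3) by (auto simp: doubleton_eq_iff)
      ultimately have "{u, w} \<in> E1" using uw(1) unfolding E_def by blast
      then show ?thesis using E1I[of "{u, w}"] by (auto simp: doubleton_eq_iff)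
    qed
    have pull: "\<exists>d\<in>config_edges s N B. e = \<psi> ` d" if e: "e \<in> E" "e \<subseteq> R" for e
    proof -
      have "e \<notin> E1"
      proof
        assume "e \<in> E1"
        then obtain u w where uw: "e = {u, w}" "a \<le> u" "a \<le> w" "(u - a) mod p \<noteq> (w - a) mod p" using E1I by blast
        then show False using mod_R[of u] mod_R[of w] e(2) by simp
      qed
      then consider "e \<in> E2" | "e \<in> E3" using e(1) unfolding E_def by blast
      then show ?thesis
      proof cases
        case 1 then show ?thesis unfolding E2_def config_edges_def by blast
      next
        case 2
        then obtain w y where wy: "e = {w, y}" "w < a" "y \<in> Yo" using E3I by blast
        then obtain z where z: "y = \<psi> z" using e(2) unfolding R_def by blast
        have "a \<le> y" using wy(3) unfolding Yo_def by simp
        then have "a \<le> z" using z \<psi>a[of z] by simp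
        have "N \<le> z"
        proof (rule ccontr)
          assume "\<not> N \<le> z"
          then have "y \<in> \<psi> ` {a..<N}" using z \<open>a \<le> z\<close> by auto
          then show False using wy(3) unfolding Yo_def by blast
        qed
        then have "{w, z} \<in> config_edges s N B" using wy(2) unfolding config_edges_def a_def by blast
        moreover have "e = \<psi> ` {w, z}" using wy(1,2) z \<psi>_lt by simp
        ultimately show ?thesis by blast
      qed
    qed
    have "\<not> clique_system (p + 1) s t E"
    proof
      assume "clique_system (p + 1) s t E"
      then obtain x K where sp: "spread s t (bip_verts s t) x K"
        and K: "\<And>i j. \<lbrakk>i < s; j < t\<rbrakk> \<Longrightarrow> card (K i j) = p + 1 \<and> nsets (K i j) 2 \<subseteq> E"
        unfolding clique_system_def by blast
      \<comment> \<open>Vertices of \<open>K_{s,t}\<close> that land in \<open>R\<close> stay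
        placed; the others become split. A clique has at most \<open>p - 1\<close> vertices outside
        \<open>R\<close>, one for each nonzero residue, so two of its vertices in \<open>R\<close>,
        among them its placed ends there, can be selected as \<open>b i j\<close>.\<close>
      define S where "S = {u \<in> bip_verts s t. x u \<in> R}"
      have SH: "S \<subseteq> bip_verts s t" unfolding S_def by blast
      have ex: "\<exists>b. card b = 2 \<and> b \<subseteq> K i j \<inter> R \<and> x ` ({Inl i, Inr j} \<inter> S) \<subseteq> b" if ij: "i < s" "j < t" for i j
      proof -
        have finK: "finite (K i j)" using K[OF ij] by (intro card_ge_0_finite) simp
        have "inj_on (\<lambda>u. (u - a) mod p) (K i j - R)"
        proof (rule inj_onI, rule ccontr)
          fix u w assume h: "u \<in> K i j - R" "w \<in> K i j - R" "(u - a) mod p = (w - a) mod p" "u \<noteq> w"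
          then have "{u, w} \<in> nsets (K i j) 2" by simp
          then have "{u, w} \<in> E" using K[OF ij] by blast
          then show False using notR[of u w] h by blast
        qed
        moreover have "(\<lambda>u. (u - a) mod p) ` (K i j - R) \<subseteq> {1..<p}"
        proof
          fix r assume "r \<in> (\<lambda>u. (u - a) mod p) ` (K i j - R)"
          then obtain u where u: "u \<notin> R" "r = (u - a) mod p" by blast
          have "a \<le> u" using R_lt u(1) not_less by blast
          then have "r \<noteq> 0" using R_mod u by blast
          then show "r \<in> {1..<p}" using u(2) p by simp
        qed
        ultimately have "card (K i j - R) \<le> card {1..<p}" by (intro card_inj_on_le) auto
        moreover have "card (K i j) = card (K i j \<inter> R) + card (K i j - R)" using finK by (rule card_Int_Diff)
        ultimately have "2 \<le> card (K i j \<inter> R)" using K[OF ij] p by simp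
        let ?A = "x ` ({Inl i, Inr j} \<inter> S)"
        have "?A \<subseteq> x ` ({Inl i, Inr j} \<inter> bip_verts s t)" using SH by blast
        then have A: "?A \<subseteq> K i j \<inter> R" using spreadD(2)[OF sp ij] unfolding S_def by blast
        have "card ?A \<le> card ({Inl i, Inr j} \<inter> S)" by (rule card_image_le) simp
        also have "\<dots> \<le> card {Inl i, Inr j :: nat + nat}" by (rule card_mono) auto
        finally have "card ?A \<le> 2" by simp
        then obtain b where "?A \<subseteq> b" "b \<subseteq> K i j \<inter> R" "card b = 2"
          using exists_subset_between[OF _ \<open>2 \<le> card (K i j \<inter> R)\<close> A] finK by blast
        then show ?thesis by blast
      qed
      define b where "b i j = (SOME b. card b = 2 \<and> b \<subseteq> K i j \<inter> R \<and> x ` ({Inl i, Inr j} \<inter> S) \<subseteq> b)" for i j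
      have b: "card (b i j) = 2" "b i j \<subseteq> K i j \<inter> R" "x ` ({Inl i, Inr j} \<inter> S) \<subseteq> b i j" if "i < s" "j < t" for i j
        using someI_ex[OF ex[OF that]] unfolding b_def by blast+
      have spb: "spread s t S x b"
        unfolding spread_def
      proof (intro conjI allI impI)
        show "inj_on x S" using spreadD(1)[OF sp] SH by (rule inj_on_subset)
        show "x ` ({Inl i, Inr j} \<inter> S) \<subseteq> b i j" if "i < s" "j < t" for i j using b(3)[OF that] .
        fix i j i' j' assume h: "i < s" "j < t" "i' < s" "j' < t" "(i, j) \<noteq> (i', j')"
        show "b i j \<inter> b i' j' \<subseteq> x ` ({Inl i, Inr j} \<inter> {Inl i', Inr j'} \<inter> S)"
        proof
          fix y assume y: "y \<in> b i j \<inter> b i' j'"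
          then have yR: "y \<in> R" and "y \<in> K i j \<inter> K i' j'" using b(2)[OF h(1,2)] b(2)[OF h(3,4)] by auto
          then have "y \<in> x ` ({Inl i, Inr j} \<inter> {Inl i', Inr j'} \<inter> bip_verts s t)"
            using spreadD(3)[OF sp h] by blast
          then obtain u where u: "y = x u" "u \<in> {Inl i, Inr j} \<inter> {Inl i', Inr j'} \<inter> bip_verts s t"
            by (rule imageE)
          then have "u \<in> S" using yR unfolding S_def by simp
          then show "y \<in> x ` ({Inl i, Inr j} \<inter> {Inl i', Inr j'} \<inter> S)" using u by (intro image_eqI[of _ _ u]) auto
        qed
      qed
      have "spread s t S (inv \<psi> \<circ> x) (\<lambda>i j. inv \<psi> ` b i j)"
      proof (rule spread_image[OF spb SH st, where D = R])
        show "inj_on (inv \<psi>) R" unfolding R_def by (rule inj_on_inv_into) simp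
        show "b i j \<subseteq> R" if "i < s" "j < t" for i j using b(2)[OF that] by blast
      qed
      moreover have "inv \<psi> ` b i j \<in> config_edges s N B" if ij: "i < s" "j < t" for i j
      proof -
        have "finite (b i j)" using b(1)[OF ij] by (intro card_ge_0_finite) simp
        then have "b i j \<in> nsets (K i j) 2" using b[OF ij] unfolding nsets_def by blast
        then have "b i j \<in> E" "b i j \<subseteq> R" using K[OF ij] b(2)[OF ij] by blast+
        then obtain d where d: "d \<in> config_edges s N B" "b i j = \<psi> ` d" using pull by blast
        have "inv \<psi> ` b i j = d" unfolding d(2) using inj by (simp add: image_image)
        then show ?thesis using d(1) by simp
      qed
      ultimately have "split_in s t (config_edges s N B)"
        unfolding split_in_def using SH
        by (intro exI[of _ S] exI[of _ "inv \<psi> \<circ> x"] exI[of _ "\<lambda>i j. inv \<psi> ` b i j"]) blast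
      then show False using ns by blast
    qed
    then show ?thesis using EV cE by blast
  qed
  then show ?thesis by blast
qed

lemma copy_iff_clique_system:
  assumes "E \<subseteq> nsets V 2" "1 \<le> s" "1 \<le> t" "1 \<le> p"
  shows "contains_copy (V, E) (edge_blowup (p + 1) (complete_bipartite s t)) \<longleftrightarrow> clique_system (p + 1) s t E"
  using assms clique_system_imp_copy copy_imp_clique_system by blast

subsection \<open>Counting edges in a nearly partite graph\<close>

lemma edge_cap_le: "edge_cap a b \<le> a * (b + 1)"
  by (simp add: edge_cap_def)

text \<open>Here \<open>k = S + b\<close>. Parts of total matching number \<open>S\<close> are
  counted with the crude factor \<open>k + 1\<close>, and one further part has matching number
  \<open>a\<close> and inner degrees at most \<open>b\<close>. For \<open>b = 1\<close> both sides
  agree, thanks to the sharpened \<open>edge_cap\<close>.\<close>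

lemma lump_bound:
  fixes S a b :: nat
  assumes "1 \<le> a" "a \<le> b" "a \<le> S"
  shows "S * (S + b + 1) + edge_cap a b \<le> (S + b) * (S + b)"
proof (cases "b = 1")
  case True
  then have "a = 1" using assms by simp
  then show ?thesis using True by (simp add: edge_cap_def algebra_simps)
next
  case False
  then have b: "2 \<le> b" using assms by simp
  have 1: "a * b \<le> b * b" using assms by (intro mult_right_mono) auto
  have 2: "S * 2 \<le> S * b" using b by (intro mult_left_mono) auto
  have "edge_cap a b \<le> a * b + a" using edge_cap_le[of a b] by (simp add: algebra_simps)
  then have "S * (S + b + 1) + edge_cap a b \<le> S * S + S * b + (S + a * b + a)" by (simp add: algebra_simps)
  also have "\<dots> \<le> S * S + S * b + (S * b + b * b)" using 1 2 assms(3) by linarith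
  also have "\<dots> = (S + b) * (S + b)" by (simp add: algebra_simps)
  finally show ?thesis .
qed

text \<open>The case in which the smallest matching number \<open>a1\<close> exceeds the remaining
  degree bound \<open>b\<close>. The two smallest parts are counted with their own degree bounds,
  and only the rest, of total matching number \<open>S\<close>, with the crude factor.\<close>

lemma lump_bound2:
  fixes S a1 a2 b :: nat
  assumes "1 \<le> b" "b < a1" "a1 \<le> a2" "a2 \<le> S"
  shows "S * (S + a2 + b + 1) + a2 * (a2 + b + 1) + a1 * (b + 1) \<le> (S + a2 + b) * (S + a2 + b)"
proof -
  have 1: "S * 1 \<le> S * b" "a2 * 1 \<le> a2 * b" using assms by (intro mult_left_mono; simp)+
  have 2: "a1 * (b + 1) \<le> S * a2" using assms by (intro mult_mono) auto
  have "S * (S + a2 + b + 1) + a2 * (a2 + b + 1) + a1 * (b + 1) =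
      S * S + S * a2 + S * b + a2 * a2 + a2 * b + (S + a2 + a1 * (b + 1))" by (simp add: algebra_simps)
  also have "\<dots> \<le> S * S + S * a2 + S * b + a2 * a2 + a2 * b + (S * b + a2 * b + S * a2)"
    using 1 2 by linarith
  also have "\<dots> \<le> (S + a2 + b) * (S + a2 + b)" by (simp add: algebra_simps)
  finally show ?thesis .
qed

text \<open>The parts are treated in increasing order of their matching numbers, each missing edge being
  charged to the earlier of its two parts.\<close>

lemma multi_part_arith:
  fixes nu J :: "nat \<Rightarrow> nat" and miss :: "nat \<Rightarrow> nat set \<Rightarrow> nat"
  assumes fin: "finite Q" and Q2: "2 \<le> card Q" and nu1: "\<And>i. i \<in> Q \<Longrightarrow> 1 \<le> nu i"
    and H1: "\<And>i. i \<in> Q \<Longrightarrow> (\<Sum>j\<in>Q - {i}. nu j) \<le> k"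
    and H2: "card Q = 2 \<Longrightarrow> (\<Sum>j\<in>Q. nu j) \<le> k"
    and B0: "\<And>j. j \<in> Q \<Longrightarrow> J j \<le> nu j * (k + 1)"
    and B1: "\<And>i A. \<lbrakk>i \<in> Q; A \<subseteq> Q - {i}\<rbrakk> \<Longrightarrow> J i \<le> edge_cap (nu i) (k - (\<Sum>j\<in>A. nu j)) + miss i A"
    and R: "\<And>i i' A A'. \<lbrakk>i \<in> Q; A \<subseteq> Q - {i}; i' \<in> A; A' \<subseteq> A - {i'}\<rbrakk> \<Longrightarrow> miss i A + miss i' A' \<le> r"
  shows "(\<Sum>j\<in>Q. J j) \<le> k * k + r"
proof -
  have Qne: "Q \<noteq> {}" using Q2 by auto
  obtain i1 where i1: "i1 \<in> Q" "\<And>j. j \<in> Q \<Longrightarrow> nu i1 \<le> nu j"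
    using ex_min_if_finite[of "nu ` Q"] fin Qne arg_min_if_finite[OF fin Qne, of nu]
    by (metis not_le_imp_less)
  define A1 where "A1 = Q - {i1}"
  have finA1: "finite A1" and A1ne: "A1 \<noteq> {}" using fin Q2 i1(1) unfolding A1_def
    by (auto, metis card.empty card_insert_le_m1 card_le_Suc0_iff_eq empty_iff not_numeral_le_zero
        numeral_2_eq_2 Suc_n_not_le_n insertE insert_Diff le_trans subset_singletonD Diff_eq_empty_iff singletonD)
  obtain i2 where i2: "i2 \<in> A1" "\<And>j. j \<in> A1 \<Longrightarrow> nu i2 \<le> nu j"
    using arg_min_if_finite[OF finA1 A1ne, of nu] by (metis not_le_imp_less)
  define A2 where "A2 = A1 - {i2}"
  have finA2: "finite A2" unfolding A2_def using finA1 by simp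
  have sum1: "(\<Sum>j\<in>Q. f j) = f i1 + (\<Sum>j\<in>A1. f j)" for f :: "nat \<Rightarrow> nat"
    unfolding A1_def using fin i1(1) by (rule sum.remove)
  have sum2: "(\<Sum>j\<in>A1. f j) = f i2 + (\<Sum>j\<in>A2. f j)" for f :: "nat \<Rightarrow> nat"
    unfolding A2_def using finA1 i2(1) by (rule sum.remove)
  define S1 where "S1 = (\<Sum>j\<in>A1. nu j)"
  define S2 where "S2 = (\<Sum>j\<in>A2. nu j)"
  have S1k: "S1 \<le> k" unfolding S1_def A1_def by (rule H1[OF i1(1)])
  have S12: "S1 = nu i2 + S2" unfolding S1_def S2_def by (rule sum2)
  have n12: "nu i1 \<le> nu i2" using i1(2)[of i2] i2(1) unfolding A1_def by auto
  have rest: "(\<Sum>j\<in>A. J j) \<le> (\<Sum>j\<in>A. nu j) * (k + 1)" if "A \<subseteq> Q" for A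
  proof -
    have "(\<Sum>j\<in>A. J j) \<le> (\<Sum>j\<in>A. nu j * (k + 1))" using B0 that by (intro sum_mono) auto
    then show ?thesis by (simp only: sum_distrib_right)
  qed
  have J1: "J i1 \<le> edge_cap (nu i1) (k - S1) + miss i1 A1"
    unfolding S1_def A1_def by (intro B1 i1(1)) auto
  have R1: "miss i1 A1 + miss i2 A2 \<le> r"
    by (rule R[OF i1(1) _ i2(1)]) (auto simp: A1_def A2_def)
  \<comment> \<open>If all matchings together have size at most \<open>k\<close>, only the smallest
    part needs its own degree bound. Otherwise \<open>H2\<close> forces at least three parts, and
    the two smallest are treated individually.\<close>
  show ?thesis
  proof (cases "nu i1 + S1 \<le> k")
    case True
    define b where "b = k - S1"
    have k: "k = S1 + b" unfolding b_def using S1k by simp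
    have "(\<Sum>j\<in>Q. J j) \<le> edge_cap (nu i1) b + miss i1 A1 + S1 * (k + 1)"
      using sum1[of J] J1 rest[of A1] unfolding b_def S1_def A1_def by auto
    moreover have "S1 * (S1 + b + 1) + edge_cap (nu i1) b \<le> (S1 + b) * (S1 + b)"
      using True nu1[OF i1(1)] k n12 S12 by (intro lump_bound) auto
    ultimately show ?thesis using R1 unfolding k by linarith
  next
    case False
    have "card Q \<noteq> 2" using H2 False sum1[of nu] unfolding S1_def by auto
    then have "A2 \<noteq> {}"
      using Q2 fin i1(1) i2(1) unfolding A2_def A1_def
      by (metis Diff_insert2 card.empty card_Diff_singleton One_nat_def diff_diff_left finite_Diff
          Suc_1 add_2_eq_Suc' le_antisym diff_is_0_eq plus_1_eq_Suc)
    then obtain i3 where "i3 \<in> A2" by blast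
    then have "nu i2 \<le> nu i3" "nu i3 \<le> S2"
      using i2(2)[of i3] finA2 unfolding A2_def S2_def by (auto intro: member_le_sum)
    then have n2S: "nu i2 \<le> S2" by linarith
    have J2: "J i2 \<le> edge_cap (nu i2) (k - S2) + miss i2 A2"
      unfolding S2_def using i2(1) by (intro B1) (auto simp: A1_def A2_def)
    have tot: "(\<Sum>j\<in>Q. J j) \<le> J i1 + (J i2 + S2 * (k + 1))"
      using sum1[of J] sum2[of J] rest[of A2] unfolding S2_def A1_def A2_def by auto
    define b where "b = k - S1"
    have k: "k = S2 + nu i2 + b" unfolding b_def using S1k S12 by simp
    have i2Q: "1 \<le> nu i2" using nu1 i2(1) unfolding A1_def by auto
    \<comment> \<open>For \<open>b = 0\<close> the smallest part has degree bound 0, so its edges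
      are all charged to missing pairs, and the second smallest takes over its role in
      \<open>lump_bound\<close>.\<close>
    show ?thesis
    proof (cases "b = 0")
      case True
      have "J i1 \<le> miss i1 A1" using J1 True unfolding b_def by (simp add: edge_cap_def)
      moreover have "S2 * (S2 + nu i2 + 1) + edge_cap (nu i2) (nu i2) \<le> (S2 + nu i2) * (S2 + nu i2)"
        using i2Q n2S by (intro lump_bound) auto
      moreover have "k = S2 + nu i2" using k True by simp
      ultimately show ?thesis using tot J2 R1 by simp
    next
      case nb: False
      have "J i1 \<le> nu i1 * (b + 1) + miss i1 A1" using J1 edge_cap_le[of "nu i1" "k - S1"] unfolding b_def by linarith
      moreover have "J i2 \<le> nu i2 * (nu i2 + b + 1) + miss i2 A2"
        using J2 edge_cap_le[of "nu i2" "k - S2"] k by simp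
      moreover have "S2 * (S2 + nu i2 + b + 1) + nu i2 * (nu i2 + b + 1) + nu i1 * (b + 1)
          \<le> (S2 + nu i2 + b) * (S2 + nu i2 + b)"
        using nb False n12 n2S S1k unfolding b_def by (intro lump_bound2) auto
      ultimately show ?thesis using tot R1 unfolding k by linarith
    qed
  qed
qed

text \<open>The outcome of \<open>ex_near_partite\<close> with an integer error \<open>m\<close>,
  and with parts large enough for the embedding criteria. From here on the argument is finite,
  without asymptotics.\<close>

definition near_partite ::
  "'a set \<Rightarrow> 'a set set \<Rightarrow> nat \<Rightarrow> nat \<Rightarrow> nat \<Rightarrow> nat \<Rightarrow> 'a set \<Rightarrow> (nat \<Rightarrow> 'a set) \<Rightarrow> bool" where
  "near_partite V E p s t m W P \<longleftrightarrow> 1 \<le> s \<and> 1 \<le> t \<and> 3 \<le> p \<and> finite V \<and> E \<subseteq> nsets V 2 \<and>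
     W \<subseteq> V \<and> card W = s - 1 \<and> (\<forall>i<p. P i \<subseteq> V - W) \<and> V - W \<subseteq> (\<Union>i<p. P i) \<and>
     (\<forall>i<p. \<forall>j<p. i \<noteq> j \<longrightarrow> P i \<inter> P j = {}) \<and>
     (\<forall>w\<in>W. card (nonnbs V E w) \<le> m) \<and>
     (\<forall>i<p. \<forall>v\<in>P i. card (nonnbs V E v - P i) \<le> m) \<and>
     (\<forall>i<p. (slack p s t + 2 * s + 2 * t + 3) * (m + 1) \<le> card (P i)) \<and>
     \<not> clique_system (p + 1) s t E"

lemma near_partiteD:
  assumes "near_partite V E p s t m W P"
  shows "1 \<le> s" "1 \<le> t" "3 \<le> p" "finite V" "E \<subseteq> nsets V 2" "W \<subseteq> V" "card W = s - 1"
    and "\<And>i. i < p \<Longrightarrow> P i \<subseteq> V - W" and "V - W \<subseteq> (\<Union>i<p. P i)"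
    and "\<And>i j. \<lbrakk>i < p; j < p; i \<noteq> j\<rbrakk> \<Longrightarrow> P i \<inter> P j = {}"
    and "\<And>w. w \<in> W \<Longrightarrow> card (nonnbs V E w) \<le> m"
    and "\<And>i v. \<lbrakk>i < p; v \<in> P i\<rbrakk> \<Longrightarrow> card (nonnbs V E v - P i) \<le> m"
    and "\<And>i. i < p \<Longrightarrow> (slack p s t + 2 * s + 2 * t + 3) * (m + 1) \<le> card (P i)"
    and "\<not> clique_system (p + 1) s t E"
  using assms unfolding near_partite_def by simp_all

section \<open>Inner edges and missing pairs of a nearly partite graph\<close>

definition inner_edges :: "'a set set \<Rightarrow> (nat \<Rightarrow> 'a set) \<Rightarrow> nat \<Rightarrow> 'a set set" where
  "inner_edges E P i = {e \<in> E. e \<subseteq> P i}"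

definition missing_at :: "'a set \<Rightarrow> 'a set set \<Rightarrow> 'a set \<Rightarrow> 'a set set" where
  "missing_at V E W = {e \<in> nsets V 2. e \<inter> W \<noteq> {} \<and> e \<notin> E}"

definition missing_cross :: "'a set \<Rightarrow> 'a set set \<Rightarrow> nat \<Rightarrow> 'a set \<Rightarrow> (nat \<Rightarrow> 'a set) \<Rightarrow> 'a set set" where
  "missing_cross V E p W P = {e \<in> nsets (V - W) 2. e \<notin> E \<and> (\<forall>i<p. \<not> e \<subseteq> P i)}"

text \<open>Written as a sum over \<open>P i\<close> because each vertex may exceed its degree bound
  by the number of its own missing neighbours, in the form that \<open>trim_degrees\<close>
  expects.\<close>

definition count_missing :: "'a set set \<Rightarrow> (nat \<Rightarrow> 'a set) \<Rightarrow> nat \<Rightarrow> nat set \<Rightarrow> nat" where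
  "count_missing E P i A = (\<Sum>x\<in>P i. card {y \<in> (\<Union>j\<in>A. P j). {x, y} \<notin> E})"

lemma
  assumes near: "near_partite V E p s t m W P"
  notes finV = near_partiteD(4)[OF near] and E2 = near_partiteD(5)[OF near]
    and WV = near_partiteD(6)[OF near] and PV = near_partiteD(8)[OF near]
  shows finW: "finite W" and finP: "i < p \<Longrightarrow> finite (P i)" and finE: "finite E" and finite_inner: "finite (inner_edges E P i)"
proof -
  show "finite W" using WV finV by (rule finite_subset)
  show "finite (P i)" if "i < p" using PV[OF that] finV by (blast intro: finite_subset)
  show "finite E" using finite_subset[OF E2] finV by simp
  then show "finite (inner_edges E P i)" unfolding inner_edges_def by simp
qed

lemma card_inner:
  assumes near: "near_partite V E p s t m W P"
  notes E2 = near_partiteD(5)[OF near]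
  shows "e \<in> inner_edges E P i \<Longrightarrow> card e = 2"
  using E2 unfolding inner_edges_def nsets_def by auto

lemma inner_disjoint:
  assumes near: "near_partite V E p s t m W P"
  notes Pdisj = near_partiteD(10)[OF near]
  assumes "i < p" "j < p" "i \<noteq> j" "e \<in> inner_edges E P i" "f \<in> inner_edges E P j"
  shows "e \<inter> f = {}"
  using Pdisj[OF assms(2-4)] assms(5,6) unfolding inner_edges_def by blast

lemma missP:
  assumes near: "near_partite V E p s t m W P"
  notes finV = near_partiteD(4)[OF near] and PV = near_partiteD(8)[OF near]
    and Pdisj = near_partiteD(10)[OF near] and Pmiss = near_partiteD(12)[OF near]
  shows "\<lbrakk>i < p; l < p; l \<noteq> i; v \<in> P i\<rbrakk> \<Longrightarrow> card {y \<in> P l. {v, y} \<notin> E} \<le> m"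
proof -
  assume a: "i < p" "l < p" "l \<noteq> i" "v \<in> P i"
  have "{y \<in> P l. {v, y} \<notin> E} \<subseteq> nonnbs V E v - P i"
    using PV[OF a(2)] Pdisj[OF a(2,1,3)] unfolding nonnbs_def by blast
  then have "card {y \<in> P l. {v, y} \<notin> E} \<le> card (nonnbs V E v - P i)"
    using finV by (intro card_mono) (auto simp: nonnbs_def)
  then show ?thesis using Pmiss[OF a(1,4)] by linarith
qed

lemma missW:
  assumes near: "near_partite V E p s t m W P"
  notes finV = near_partiteD(4)[OF near] and PV = near_partiteD(8)[OF near]
    and Wmiss = near_partiteD(11)[OF near]
  shows "\<lbrakk>l < p; w \<in> W\<rbrakk> \<Longrightarrow> card {y \<in> P l. {w, y} \<notin> E} \<le> m"
proof -
  assume a: "l < p" "w \<in> W"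
  have "card {y \<in> P l. {w, y} \<notin> E} \<le> card (nonnbs V E w)"
    using finV PV[OF a(1)] by (intro card_mono) (auto simp: nonnbs_def)
  then show ?thesis using Wmiss[OF a(2)] by linarith
qed

lemma bigger:
  assumes near: "near_partite V E p s t m W P"
  notes big = near_partiteD(13)[OF near]
  assumes "i < p" "c \<le> slack p s t + 2 * s + 2 * t + 3"
  shows "c * (m + 1) \<le> card (P i)"
  using big[OF assms(2)] mult_right_mono[OF assms(3), of "m + 1"] by linarith

\<comment> \<open>\<open>?b\<close> becomes \<open>t - 1\<close>. Given \<open>t\<close> edges,
  those at \<open>x\<close> are cores of size 2 and those of \<open>M\<close> form triangles with
  \<open>x\<close>. With \<open>W\<close> supplying the other \<open>s - 1\<close> left vertices,
  \<open>star_embed\<close> would give a copy.\<close>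
schematic_goal star_constraint:
  assumes near: "near_partite V E p s t m W P"
  notes st = near_partiteD(1,2)[OF near] and p = near_partiteD(3)[OF near]
    and cW = near_partiteD(7)[OF near] and PV = near_partiteD(8)[OF near]
    and Pdisj = near_partiteD(10)[OF near] and free = near_partiteD(14)[OF near]
    and finW = finW[OF near] and finP = finP[OF near] and finE = finE[OF near]
    and finite_inner = finite_inner[OF near] and card_inner = card_inner[OF near] and inner_disjoint = inner_disjoint[OF near]
    and missP = missP[OF near] and missW = missW[OF near] and bigger = bigger[OF near]
  assumes i: "i < p" and x: "x \<in> P i" and M: "matching M" "M \<subseteq> (\<Union>j\<in>{..<p} - {i}. inner_edges E P j)"
    and adj: "\<And>e y. \<lbrakk>e \<in> M; y \<in> e\<rbrakk> \<Longrightarrow> {x, y} \<in> E"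
  shows "card {e \<in> inner_edges E P i. x \<in> e} + card M \<le> ?b"
proof -
  have "card {e \<in> inner_edges E P i. x \<in> e} + card M \<le> t - 1"
  proof (rule ccontr)
    assume neg: "\<not> ?thesis"
    define D where "D = {e \<in> inner_edges E P i. x \<in> e}"
    have finD: "finite D" unfolding D_def using finite_inner by simp
    have finM: "finite M" using M(2) by (intro finite_subset[OF _ finE]) (auto simp: inner_edges_def)
    have JP: "e \<subseteq> P j" if "e \<in> inner_edges E P j" for e j using that unfolding inner_edges_def by blast
    have Mpart: "\<exists>j. j < p \<and> j \<noteq> i \<and> e \<in> inner_edges E P j" if "e \<in> M" for e using M(2) that by blast
    have DM: "e \<inter> f = {}" if "e \<in> D" "f \<in> M" for e f
      using Mpart[OF that(2)] inner_disjoint[OF i] that(1) unfolding D_def by blast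
    have Mne: "e \<noteq> {}" if "e \<in> M" for e using Mpart[OF that] card_inner by fastforce
    have "D \<inter> M = {}" using DM Mne by blast
    then have "card (D \<union> M) = card D + card M" using finD finM by (intro card_Un_disjoint) auto
    then have "t \<le> card (D \<union> M)" using neg unfolding D_def by linarith
    then have "\<exists>f. f ` {..<t} \<subseteq> D \<union> M \<and> inj_on f {..<t}" using finD finM by (intro card_le_inj) auto
    then obtain f where f: "f ` {..<t} \<subseteq> D \<union> M" "inj_on f {..<t}" by (elim exE conjE)
    have fDM: "f j \<in> D \<union> M" if "j < t" for j using f(1) that by blast
    obtain w where w: "bij_betw w {..<s - 1} W"
      using cW finW by (metis card_lessThan finite_lessThan finite_same_card_bij)
    define q where "q j = (if f j \<in> D then i else (SOME l. l < p \<and> l \<noteq> i \<and> f j \<in> inner_edges E P l))" for j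
    have q: "q j < p \<and> f j \<in> inner_edges E P (q j)" if "j < t" for j
    proof (cases "f j \<in> D")
      case True then show ?thesis unfolding q_def D_def using i by simp
    next
      case False
      then have "f j \<in> M" using fDM[OF that] by blast
      from someI_ex[OF Mpart[OF this]] show ?thesis using False unfolding q_def by simp
    qed
    have qM: "q j \<noteq> i" if "j < t" "f j \<in> M" for j
    proof -
      have "f j \<notin> D" using that \<open>D \<inter> M = {}\<close> by blast
      then show ?thesis using someI_ex[OF Mpart[OF that(2)]] unfolding q_def by simp
    qed
    define c where "c j = insert x (f j)" for j
    have cP: "c j \<subseteq> P i \<union> P (q j)" if "j < t" for j using JP[of "f j" "q j"] q[OF that] x unfolding c_def by blast
    have xM: "x \<notin> f j" if "j < t" "f j \<in> M" for j
      using JP[of "f j" "q j"] q[OF that(1)] qM[OF that] Pdisj[OF i, of "q j"] x by blast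
    have "clique_system (p + 1) s t E"
    proof (rule star_embed[OF st p i, where w = w and q = q and c = c and xc = x and Y = P and m = m])
      show "inj_on w {..<s - 1}" using w unfolding bij_betw_def by blast
      show "q j < p" if "j < t" for j using q[OF that] by blast
      show "finite (c j) \<and> x \<in> c j \<and> nsets (c j) 2 \<subseteq> E \<and> card (c j) = 1 + card {i, q j}" if j: "j < t" for j
      proof (cases "f j \<in> D")
        case True
        then have c: "c j = f j" "f j \<in> E" "card (f j) = 2" "q j = i"
          using card_inner[of "f j" i] unfolding c_def D_def q_def inner_edges_def by auto
        have "finite (f j)" using c(3) by (intro card_ge_0_finite) simp
        have "e = f j" if "e \<in> nsets (f j) 2" for e
          using that c(3) \<open>finite (f j)\<close> unfolding nsets_def by (simp add: card_subset_eq)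
        then show ?thesis using c \<open>finite (f j)\<close> unfolding c_def by auto
      next
        case False
        then have M': "f j \<in> M" using fDM[OF j] by blast
        have f2: "card (f j) = 2" "f j \<in> E" using q[OF j] card_inner[of "f j" "q j"] unfolding inner_edges_def by auto
        have fin: "finite (f j)" using f2(1) by (intro card_ge_0_finite) simp
        have "e \<in> E" if e: "e \<in> nsets (c j) 2" for e
        proof -
          obtain u v where uv: "e = {u, v}" "u \<noteq> v" "u \<in> c j" "v \<in> c j" using e by (rule nsets_2_E)
          consider "u = x" "v \<in> f j" | "v = x" "u \<in> f j" | "u \<in> f j" "v \<in> f j"
            using uv unfolding c_def by blast
          then show ?thesis
          proof cases
            case 1 then show ?thesis using adj[OF M'] uv by simp
          next
            case 2 then show ?thesis using adj[OF M'] uv by (simp add: insert_commute)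
          next
            case 3
            then have "e \<subseteq> f j" "card e = card (f j)" using uv f2 by auto
            then show ?thesis using f2(2) fin by (metis card_subset_eq)
          qed
        qed
        moreover have "card (c j) = 3" unfolding c_def using xM[OF j M'] fin f2 by simp
        moreover have "card {i, q j} = 2" using qM[OF j M'] by auto
        ultimately show ?thesis using fin unfolding c_def by auto
      qed
      show "c j \<inter> c j' = {x}" if j: "j < t" "j' < t" "j \<noteq> j'" for j j'
      proof -
        have ne: "f j \<noteq> f j'" using inj_onD[OF f(2), of j j'] j by auto
        have "f j \<inter> f j' \<subseteq> {x}"
        proof -
          consider "f j \<in> D" "f j' \<in> D" | "f j \<in> D" "f j' \<in> M" | "f j \<in> M" "f j' \<in> D" | "f j \<in> M" "f j' \<in> M"
            using fDM j by blast
          then show ?thesis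
          proof cases
            case 1
            show ?thesis
            proof
              fix z assume z: "z \<in> f j \<inter> f j'"
              show "z \<in> {x}"
              proof (rule ccontr)
                assume "z \<notin> {x}"
                have "card (f j) = 2" "card (f j') = 2" "x \<in> f j" "x \<in> f j'"
                  using 1 card_inner unfolding D_def by auto
                then have "f j = {x, z}" "f j' = {x, z}"
                  using z \<open>z \<notin> {x}\<close> by (auto simp: card_2_iff)
                then show False using ne by simp
              qed
            qed
          next
            case 2 then show ?thesis using DM by blast
          next
            case 3 then show ?thesis using DM by blast
          next
            case 4 then show ?thesis using M(1) ne unfolding matching_def by blast
          qed
        qed
        then show ?thesis unfolding c_def by blast
      qed
      show "w l \<notin> c j" if "l < s - 1" "j < t" for l j
      proof -
        have "w l \<in> W" using w that unfolding bij_betw_def by blast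
        then show ?thesis using cP[OF that(2)] PV[OF i] PV[of "q j"] q[OF that(2)] by blast
      qed
      show "card {y \<in> P l. {w l', y} \<notin> E} \<le> m" if "l < p" "l' < s - 1" for l l'
      proof (rule missW[OF that(1)])
        show "w l' \<in> W" using w that unfolding bij_betw_def by blast
      qed
      show "card {y \<in> P l. {z, y} \<notin> E} \<le> m" if h: "l < p" "j < t" "l \<noteq> i" "l \<noteq> q j" "z \<in> c j" for l j z
        using cP[OF h(2)] h missP[OF i h(1,3)] missP[of "q j" l z] q[OF h(2)] by blast
      show "(slack p s t + s + 3) * (m + 1) \<le> card (P l)" if "l < p" for l
        by (rule bigger[OF that]) simp
    qed (use finP missP in auto)
    then show False using free by blast
  qed
  then show "card {e \<in> inner_edges E P i. x \<in> e} + card M \<le> t - 1" .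
qed

lemma degree_le:
  assumes near: "near_partite V E p s t m W P"
  notes star_constraint = star_constraint[OF near]
  assumes "i < p"
  shows "card {e \<in> inner_edges E P i. x \<in> e} \<le> t - 1"
proof (cases "x \<in> P i")
  case True
  then show ?thesis using star_constraint[OF assms(2) True, of "{}"] by (simp add: matching_def)
next
  case False
  then have "{e \<in> inner_edges E P i. x \<in> e} = {}" unfolding inner_edges_def by blast
  then show ?thesis by (simp only: card.empty)
qed

text \<open>The \<open>2 * t\<close> ends of \<open>t\<close> disjoint edges outside part
  \<open>i\<close> have a common neighbour in that part, where \<open>star_constraint\<close> is
  violated even if no inner edge is present.\<close>

lemma matching_le:
  assumes near: "near_partite V E p s t m W P"
  notes st = near_partiteD(1,2)[OF near] and finP = finP[OF near] and card_inner = card_inner[OF near]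
    and missP = missP[OF near] and bigger = bigger[OF near]
    and star_constraint = star_constraint[OF near]
  assumes i: "i < p" and M: "matching M" "M \<subseteq> (\<Union>j\<in>{..<p} - {i}. inner_edges E P j)"
  shows "card M \<le> t - 1"
proof (rule ccontr)
  assume neg: "\<not> ?thesis"
  then have "t \<le> card M" by linarith
  then obtain M' where M': "M' \<subseteq> M" "card M' = t" "finite M'"
    by (rule obtain_subset_with_card_n)
  have e2: "card e = 2" if "e \<in> M'" for e using card_inner M(2) M'(1) that by blast
  have fine: "finite e" if "e \<in> M'" for e using e2[OF that] by (intro card_ge_0_finite) simp
  have Q: "card (\<Union>M') \<le> 2 * t" "finite (\<Union>M')"
    using card_Union_matching[OF matching_subset[OF M(1) M'(1)] e2 M'(3)] M'(2,3) fine by auto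
  have "1 \<le> card {y \<in> P i. \<forall>z\<in>\<Union>M'. {z, y} \<in> E}"
  proof (rule card_common_nbs_ge[OF finP[OF i] Q(2) _ Q(1)])
    fix z assume "z \<in> \<Union>M'"
    then obtain j where "j < p" "j \<noteq> i" "z \<in> P j" using M(2) M'(1) unfolding inner_edges_def by blast
    then show "card {y \<in> P i. {z, y} \<notin> E} \<le> m" using missP[of j i z] i by auto
  next
    have "1 + 2 * t * m \<le> (2 * t + 1) * (m + 1)" by (simp add: algebra_simps)
    then show "1 + 2 * t * m \<le> card (P i)" using bigger[OF i, of "2 * t + 1"] by linarith
  qed
  then have "{y \<in> P i. \<forall>z\<in>\<Union>M'. {z, y} \<in> E} \<noteq> {}" by (metis card.empty not_one_le_zero)
  then obtain x where x: "x \<in> P i" "\<And>z. z \<in> \<Union>M' \<Longrightarrow> {z, x} \<in> E" by blast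
  have "card {e \<in> inner_edges E P i. x \<in> e} + card M' \<le> t - 1"
  proof (rule star_constraint[OF i x(1) matching_subset[OF M(1) M'(1)]])
    show "M' \<subseteq> (\<Union>j\<in>{..<p} - {i}. inner_edges E P j)" using M(2) M'(1) by blast
    show "{x, y} \<in> E" if "e \<in> M'" "y \<in> e" for e y using x(2)[of y] that by (auto simp: insert_commute)
  qed
  then show False using M'(2) st by linarith
qed

lemma ex_union_matching:
  assumes near: "near_partite V E p s t m W P"
  notes finite_inner = finite_inner[OF near] and card_inner = card_inner[OF near] and inner_disjoint = inner_disjoint[OF near]
  assumes A: "A \<subseteq> {..<p}"
  shows "\<exists>M. matching M \<and> M \<subseteq> (\<Union>j\<in>A. inner_edges E P j) \<and> card M = (\<Sum>j\<in>A. mnum (inner_edges E P j))"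
proof -
  have "\<forall>j. \<exists>M. M \<subseteq> inner_edges E P j \<and> matching M \<and> card M = mnum (inner_edges E P j)" by (intro allI mnum_props(2) finite_inner)
  from choice[OF this] obtain M where "\<forall>j. M j \<subseteq> inner_edges E P j \<and> matching (M j) \<and> card (M j) = mnum (inner_edges E P j)"
    by (rule exE)
  then have M: "\<And>j. M j \<subseteq> inner_edges E P j" "\<And>j. matching (M j)" "\<And>j. card (M j) = mnum (inner_edges E P j)" by simp_all
  have finA: "finite A" using A by (rule finite_subset) simp
  have "matching (\<Union>j\<in>A. M j)"
    unfolding matching_def
  proof (intro ballI impI)
    fix e f assume ef: "e \<in> (\<Union>j\<in>A. M j)" "f \<in> (\<Union>j\<in>A. M j)" "e \<noteq> f"
    then obtain j l where jl: "j \<in> A" "l \<in> A" "e \<in> M j" "f \<in> M l" by blast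
    show "e \<inter> f = {}"
    proof (cases "j = l")
      case True then show ?thesis using M(2)[of j] jl ef(3) unfolding matching_def by blast
    next
      case False then show ?thesis using inner_disjoint[of j l e f] jl A M(1) by blast
    qed
  qed
  moreover have "card (\<Union>j\<in>A. M j) = (\<Sum>j\<in>A. card (M j))"
  proof (rule card_UN_disjoint[OF finA])
    show "\<forall>j\<in>A. finite (M j)" using M(1) finite_inner by (blast intro: finite_subset)
    show "\<forall>j\<in>A. \<forall>l\<in>A. j \<noteq> l \<longrightarrow> M j \<inter> M l = {}"
    proof (intro ballI impI)
      fix j l assume jl: "j \<in> A" "l \<in> A" "j \<noteq> l"
      have False if "e \<in> M j" "e \<in> M l" for e
      proof -
        have "e \<inter> e = {}" using inner_disjoint[of j l e e] jl A M(1) that by blast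
        then show False using card_inner[of e j] M(1) that by auto
      qed
      then show "M j \<inter> M l = {}" by blast
    qed
  qed
  moreover have "(\<Union>j\<in>A. M j) \<subseteq> (\<Union>j\<in>A. inner_edges E P j)" using M(1) by blast
  ultimately show ?thesis using M(3) by (intro exI[of _ "\<Union>j\<in>A. M j"]) simp
qed

lemma sum_mnum_le:
  assumes near: "near_partite V E p s t m W P"
  notes matching_le = matching_le[OF near] and ex_union_matching = ex_union_matching[OF near]
  assumes "i < p" "A \<subseteq> {..<p} - {i}"
  shows "(\<Sum>j\<in>A. mnum (inner_edges E P j)) \<le> t - 1"
proof -
  obtain M where M: "matching M" "M \<subseteq> (\<Union>j\<in>A. inner_edges E P j)" "card M = (\<Sum>j\<in>A. mnum (inner_edges E P j))"
    using ex_union_matching[of A] assms(3) by blast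
  have "card M \<le> t - 1" by (rule matching_le[OF assms(2) M(1)]) (use M(2) assms(3) in blast)
  then show ?thesis using M(3) by simp
qed

lemma card_J_le:
  assumes near: "near_partite V E p s t m W P"
  notes finite_inner = finite_inner[OF near] and card_inner = card_inner[OF near] and degree_le = degree_le[OF near]
  shows "i < p \<Longrightarrow> card (inner_edges E P i) \<le> mnum (inner_edges E P i) * (t - 1 + 1)"
  by (intro card_edges_le_matching_exact finite_inner card_inner degree_le)

text \<open>At a vertex \<open>x\<close> of part \<open>i\<close>, the edges of a maximum matching
  of the parts in \<open>A\<close> that are fully joined to \<open>x\<close> reduce its degree
  bound. Each other matching edge contains a missing neighbour of \<open>x\<close>, and these are
  distinct. So the reduced bound is exceeded by at most the number of missing neighbours, and
  \<open>trim_degrees\<close> applies.\<close>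

lemma card_J_le_cap:
  assumes near: "near_partite V E p s t m W P"
  notes finP = finP[OF near] and finE = finE[OF near] and finite_inner = finite_inner[OF near]
    and card_inner = card_inner[OF near] and star_constraint = star_constraint[OF near]
    and ex_union_matching = ex_union_matching[OF near]
  assumes i: "i < p" and A: "A \<subseteq> {..<p} - {i}"
  shows "card (inner_edges E P i) \<le> edge_cap (mnum (inner_edges E P i)) (t - 1 - (\<Sum>j\<in>A. mnum (inner_edges E P j))) + count_missing E P i A"
  unfolding count_missing_def
proof (rule trim_degrees[OF finite_inner card_inner _ finP[OF i]])
  show "e \<subseteq> P i" if "e \<in> inner_edges E P i" for e using that unfolding inner_edges_def by blast
  fix x assume x: "x \<in> P i"
  let ?Y = "\<Union>j\<in>A. P j"
  let ?S = "\<Sum>j\<in>A. mnum (inner_edges E P j)"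
  have finY: "finite ?Y" using A finP by (auto intro!: finite_UN_I intro: finite_subset)
  obtain M where M: "matching M" "M \<subseteq> (\<Union>j\<in>A. inner_edges E P j)" "card M = ?S"
    using ex_union_matching[of A] A by blast
  define Mx where "Mx = {e \<in> M. \<forall>y\<in>e. {x, y} \<in> E}"
  have finM: "finite M" using M(2) finE unfolding inner_edges_def by (auto intro: finite_subset)
  have "card {e \<in> inner_edges E P i. x \<in> e} + card Mx \<le> t - 1"
  proof (rule star_constraint[OF i x])
    show "matching Mx" using M(1) unfolding Mx_def by (rule matching_subset) blast
    show "Mx \<subseteq> (\<Union>j\<in>{..<p} - {i}. inner_edges E P j)" using M(2) A unfolding Mx_def by blast
  qed (auto simp: Mx_def)
  moreover have "card (M - Mx) \<le> card {y \<in> ?Y. {x, y} \<notin> E}"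
  proof -
    have "\<forall>e\<in>M - Mx. \<exists>y. y \<in> e \<and> {x, y} \<notin> E" unfolding Mx_def by blast
    from bchoice[OF this] obtain g where g: "\<forall>e\<in>M - Mx. g e \<in> e \<and> {x, g e} \<notin> E" by (rule exE)
    have "inj_on g (M - Mx)"
    proof (rule inj_onI)
      fix e f assume ef: "e \<in> M - Mx" "f \<in> M - Mx" "g e = g f"
      then have "g e \<in> e" "g f \<in> f" using g by blast+
      then show "e = f" using ef by (intro matchingD[OF M(1), of e f "g e"]) simp_all
    qed
    moreover have "g ` (M - Mx) \<subseteq> {y \<in> ?Y. {x, y} \<notin> E}"
      using g M(2) unfolding inner_edges_def by blast
    moreover have "finite {y \<in> ?Y. {x, y} \<notin> E}" by (rule finite_subset[OF _ finY]) blast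
    ultimately show ?thesis by (rule card_inj_on_le)
  qed
  moreover have "card M = card Mx + card (M - Mx)"
    using finM unfolding Mx_def by (simp add: card_Diff_subset card_mono)
  ultimately show "card {e \<in> inner_edges E P i. x \<in> e} \<le> t - 1 - ?S + card {y \<in> ?Y. {x, y} \<notin> E}"
    using M(3) by linarith
qed

lemma
  assumes near: "near_partite V E p s t m W P"
  notes finV = near_partiteD(4)[OF near]
  shows finite_missing_cross: "finite (missing_cross V E p W P)" and finite_missing_at: "finite (missing_at V E W)"
  unfolding missing_cross_def missing_at_def using finV by simp_all

text \<open>A pair counted for \<open>i\<close> has an end in \<open>P i\<close>, whereas a pair
  counted for \<open>i'\<close> runs between parts indexed by \<open>A\<close>, which excludes
  \<open>i\<close>. Hence no missing pair is counted twice.\<close>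

lemma miss_sum_le:
  assumes near: "near_partite V E p s t m W P"
  notes PV = near_partiteD(8)[OF near] and Pdisj = near_partiteD(10)[OF near]
    and finP = finP[OF near] and finite_missing_cross = finite_missing_cross[OF near]
  assumes "i < p" "A \<subseteq> {..<p} - {i}" "i' \<in> A" "A' \<subseteq> A - {i'}"
  shows "count_missing E P i A + count_missing E P i' A' \<le> card (missing_cross V E p W P)"
proof -
  define R where "R i A = (\<lambda>(x, y). {x, y}) ` (SIGMA x : P i. {y \<in> (\<Union>j\<in>A. P j). {x, y} \<notin> E})" for i A
  have dis: "P i \<inter> (\<Union>j\<in>A. P j) = {}" if "i < p" "A \<subseteq> {..<p} - {i}" for i A
    using Pdisj that by blast
  have cR: "card (R i A) = count_missing E P i A" if h: "i < p" "A \<subseteq> {..<p} - {i}" for i A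
  proof -
    have finY: "finite (\<Union>j\<in>A. P j)" using h finP by (auto intro!: finite_UN_I intro: finite_subset)
    have "inj_on (\<lambda>(x, y). {x, y}) (SIGMA x : P i. {y \<in> (\<Union>j\<in>A. P j). {x, y} \<notin> E})"
      using dis[OF h] by (auto simp: inj_on_def doubleton_eq_iff)
    then have "card (R i A) = card (SIGMA x : P i. {y \<in> (\<Union>j\<in>A. P j). {x, y} \<notin> E})"
      unfolding R_def by (rule card_image)
    also have "\<dots> = count_missing E P i A" unfolding count_missing_def
    proof (rule card_SigmaI[OF finP[OF h(1)]], intro ballI)
      show "finite {y \<in> (\<Union>j\<in>A. P j). {x, y} \<notin> E}" for x by (rule finite_subset[OF _ finY]) blast
    qed
    finally show ?thesis .
  qed
  have RRC: "R i A \<subseteq> missing_cross V E p W P" if h: "i < p" "A \<subseteq> {..<p} - {i}" for i A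
  proof
    fix e assume "e \<in> R i A"
    then obtain x y j where e: "e = {x, y}" "x \<in> P i" "y \<in> P j" "j \<in> A" "{x, y} \<notin> E" unfolding R_def by auto
    have j: "j < p" "j \<noteq> i" using e h by auto
    have "x \<noteq> y" using Pdisj[OF h(1) j(1)] j(2) e by blast
    moreover have "\<not> e \<subseteq> P l" if "l < p" for l
      using Pdisj[OF h(1) that] Pdisj[OF j(1) that] e j by blast
    ultimately show "e \<in> missing_cross V E p W P" using e PV[OF h(1)] PV[OF j(1)] unfolding missing_cross_def by auto
  qed
  have i': "i' < p" "A' \<subseteq> {..<p} - {i'}" using assms by auto
  have "R i A \<inter> R i' A' = {}"
  proof -
    have False if eR: "e \<in> R i A" "e \<in> R i' A'" for e
    proof -
      obtain x where "x \<in> P i" "x \<in> e" using eR(1) unfolding R_def by blast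
      moreover have "e \<subseteq> P i' \<union> (\<Union>j\<in>A'. P j)" using eR(2) unfolding R_def by blast
      ultimately have "x \<in> (\<Union>j\<in>A. P j)" using assms(4,5) by blast
      then show False using dis[OF assms(2,3)] \<open>x \<in> P i\<close> by blast
    qed
    then show ?thesis by blast
  qed
  then have "card (R i A) + card (R i' A') = card (R i A \<union> R i' A')"
    using finite_subset[OF RRC[OF assms(2,3)] finite_missing_cross] finite_subset[OF RRC[OF i'] finite_missing_cross]
    by (intro card_Un_disjoint[symmetric]) auto
  also have "\<dots> \<le> card (missing_cross V E p W P)" using RRC[OF assms(2,3)] RRC[OF i'] finite_missing_cross by (intro card_mono) auto
  finally show ?thesis using cR[OF assms(2,3)] cR[OF i'] by simp
qed

text \<open>Only the parts that contain edges enter the arithmetic. If there are exactly two of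
  them, \<open>3 \<le> p\<close> provides a third part, relative to which \<open>sum_mnum_le\<close>
  bounds both matchings at once.\<close>

lemma multi_part:
  assumes near: "near_partite V E p s t m W P"
  notes p = near_partiteD(3)[OF near] and finite_inner = finite_inner[OF near]
    and sum_mnum_le = sum_mnum_le[OF near] and card_J_le = card_J_le[OF near]
    and card_J_le_cap = card_J_le_cap[OF near] and miss_sum_le = miss_sum_le[OF near]
  assumes "i < p" "j < p" "i \<noteq> j" "inner_edges E P i \<noteq> {}" "inner_edges E P j \<noteq> {}"
  shows "(\<Sum>l<p. card (inner_edges E P l)) \<le> (t - 1) * (t - 1) + card (missing_cross V E p W P)"
proof -
  define Q where "Q = {l. l < p \<and> inner_edges E P l \<noteq> {}}"
  have Qp: "Q \<subseteq> {..<p}" and finQ: "finite Q" unfolding Q_def by auto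
  have "{i, j} \<subseteq> Q" using assms unfolding Q_def by auto
  then have "card {i, j} \<le> card Q" using finQ by (rule card_mono[rotated])
  then have cQ: "2 \<le> card Q" using assms(4) by simp
  have "(\<Sum>l<p. card (inner_edges E P l)) = (\<Sum>l\<in>Q. card (inner_edges E P l))"
    using Qp unfolding Q_def by (intro sum.mono_neutral_right) auto
  also have "\<dots> \<le> (t - 1) * (t - 1) + card (missing_cross V E p W P)"
  proof (rule multi_part_arith[OF finQ cQ, where nu = "\<lambda>l. mnum (inner_edges E P l)" and miss = "count_missing E P"])
    show "1 \<le> mnum (inner_edges E P l)" if lQ: "l \<in> Q" for l
    proof -
      obtain e where "e \<in> inner_edges E P l" using lQ unfolding Q_def by blast
      then show ?thesis using mnum_props(1)[OF finite_inner, of "{e}" l] by (simp add: matching_def)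
    qed
    show "(\<Sum>l'\<in>Q - {l}. mnum (inner_edges E P l')) \<le> t - 1" if "l \<in> Q" for l
      using that Qp by (intro sum_mnum_le[of l]) auto
    show "(\<Sum>l\<in>Q. mnum (inner_edges E P l)) \<le> t - 1" if "card Q = 2"
    proof -
      have "\<not> {..<p} \<subseteq> Q" using card_mono[OF finQ, of "{..<p}"] that p by auto
      then obtain l where "l < p" "l \<notin> Q" by auto
      then show ?thesis using Qp by (intro sum_mnum_le[of l]) auto
    qed
    show "card (inner_edges E P l) \<le> mnum (inner_edges E P l) * (t - 1 + 1)" if "l \<in> Q" for l
      using that Qp by (intro card_J_le) auto
    show "card (inner_edges E P l) \<le> edge_cap (mnum (inner_edges E P l)) (t - 1 - (\<Sum>j\<in>A. mnum (inner_edges E P j))) + count_missing E P l A"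
      if "l \<in> Q" "A \<subseteq> Q - {l}" for l A
      using that Qp by (intro card_J_le_cap) auto
    show "count_missing E P l A + count_missing E P l' A' \<le> card (missing_cross V E p W P)" if "l \<in> Q" "A \<subseteq> Q - {l}" "l' \<in> A" "A' \<subseteq> A - {l'}" for l l' A A'
      using that Qp by (intro miss_sum_le) auto
  qed
  finally show ?thesis .
qed

text \<open>The sorting of \<open>card_edges_le_parts\<close> again, but losing nothing: absent
  pairs at \<open>W\<close> and between parts stay on the left, because they have to pay for edges
  inside the parts.\<close>

lemma edge_count:
  assumes near: "near_partite V E p s t m W P"
  notes p = near_partiteD(3)[OF near] and finV = near_partiteD(4)[OF near]
    and E2 = near_partiteD(5)[OF near] and WV = near_partiteD(6)[OF near]
    and cW = near_partiteD(7)[OF near] and PV = near_partiteD(8)[OF near]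
    and cover = near_partiteD(9)[OF near] and Pdisj = near_partiteD(10)[OF near]
    and finW = finW[OF near] and finE = finE[OF near] and finite_inner = finite_inner[OF near]
    and finite_missing_cross = finite_missing_cross[OF near] and finite_missing_at = finite_missing_at[OF near]
  shows "card E + card (missing_at V E W) + card (missing_cross V E p W P) \<le>
     ((s - 1) choose 2) + (s - 1) * (card V - (s - 1)) + turan_edges p (card V - (s - 1)) + (\<Sum>i<p. card (inner_edges E P i))"
proof -
  define part where "part v = (SOME i. i < p \<and> v \<in> P i)" for v
  have part: "part v < p \<and> v \<in> P (part v)" if "v \<in> V - W" for v
    unfolding part_def by (rule someI_ex) (use that cover in blast)
  have part_eq: "part v = i" if "v \<in> P i" "i < p" for v i
  proof (rule ccontr)
    assume "part v \<noteq> i"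
    moreover have "v \<in> V - W" using PV that by blast
    ultimately show False using part Pdisj[of "part v" i] that by blast
  qed
  let ?PW = "{e \<in> nsets V 2. e \<inter> W \<noteq> {}}"
  let ?PC = "{e \<in> nsets (V - W) 2. card (part ` e) = 2}"
  have RCsub: "missing_cross V E p W P \<subseteq> ?PC"
  proof
    fix e assume e: "e \<in> missing_cross V E p W P"
    then have e': "e \<in> nsets (V - W) 2" "\<And>i. i < p \<Longrightarrow> \<not> e \<subseteq> P i" unfolding missing_cross_def by auto
    obtain u v where uv: "e = {u, v}" "u \<noteq> v" "u \<in> V - W" "v \<in> V - W" using e'(1) by (rule nsets_2_E)
    have "part u \<noteq> part v"
    proof
      assume eq: "part u = part v"
      have "u \<in> P (part u)" "v \<in> P (part v)" "part u < p" using part uv by blast+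
      then have "e \<subseteq> P (part u)" using uv(1) eq by simp
      then show False using e'(2) \<open>part u < p\<close> by blast
    qed
    then show "e \<in> ?PC" using e'(1) uv by simp
  qed
  have Esub: "E \<subseteq> (?PW \<inter> E) \<union> ((?PC \<inter> E) \<union> (\<Union>i<p. inner_edges E P i))"
  proof
    fix e assume e: "e \<in> E"
    then obtain u v where uv: "e = {u, v}" "u \<noteq> v" "u \<in> V" "v \<in> V" using E2 by (blast elim: nsets_2_E)
    show "e \<in> (?PW \<inter> E) \<union> ((?PC \<inter> E) \<union> (\<Union>i<p. inner_edges E P i))"
    proof (cases "u \<in> W \<or> v \<in> W")
      case True then show ?thesis using e uv by auto
    next
      case False
      then have VW: "u \<in> V - W" "v \<in> V - W" using uv by auto
      show ?thesis
      proof (cases "part u = part v")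
        case True
        have "u \<in> P (part u)" "v \<in> P (part v)" "part u < p" using part VW by blast+
        then have "e \<in> inner_edges E P (part u)" unfolding inner_edges_def using uv(1) True e by simp
        then show ?thesis using \<open>part u < p\<close> by blast
      next
        case False
        then have "e \<in> ?PC" using uv VW by simp
        then show ?thesis using e by blast
      qed
    qed
  qed
  have "card E \<le> card ((?PW \<inter> E) \<union> ((?PC \<inter> E) \<union> (\<Union>i<p. inner_edges E P i)))"
    using Esub finE finite_inner by (intro card_mono) auto
  also have "\<dots> \<le> card (?PW \<inter> E) + (card (?PC \<inter> E) + card (\<Union>i<p. inner_edges E P i))"
    by (meson add_left_mono card_Un_le order_trans)
  also have "card (\<Union>i<p. inner_edges E P i) \<le> (\<Sum>i<p. card (inner_edges E P i))" by (rule card_UN_le) simp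
  finally have 1: "card E \<le> card (?PW \<inter> E) + card (?PC \<inter> E) + (\<Sum>i<p. card (inner_edges E P i))" by simp
  have "card (?PW \<inter> E) + card (missing_at V E W) = card ?PW"
  proof -
    have "card (?PW \<inter> E) + card (missing_at V E W) = card ((?PW \<inter> E) \<union> missing_at V E W)"
      using finE finite_missing_at by (intro card_Un_disjoint[symmetric]) (auto simp: missing_at_def)
    also have "(?PW \<inter> E) \<union> missing_at V E W = ?PW" unfolding missing_at_def by auto
    finally show ?thesis .
  qed
  also have "card ?PW = ((s - 1) choose 2) + (s - 1) * (card V - (s - 1))"
    using card_pairs_meeting[OF finV WV] cW by simp
  finally have 2: "card (?PW \<inter> E) + card (missing_at V E W) = ((s - 1) choose 2) + (s - 1) * (card V - (s - 1))" .
  have "card (?PC \<inter> E) + card (missing_cross V E p W P) \<le> card ?PC"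
  proof -
    have "card (?PC \<inter> E) + card (missing_cross V E p W P) = card ((?PC \<inter> E) \<union> missing_cross V E p W P)"
      using finE finite_missing_cross by (intro card_Un_disjoint[symmetric]) (auto simp: missing_cross_def)
    also have "\<dots> \<le> card ?PC" using RCsub finV by (intro card_mono) auto
    finally show ?thesis .
  qed
  also have "card ?PC \<le> turan_edges p (card (V - W))"
    using finV part p by (intro card_cross_pairs_le_turan) auto
  also have "card (V - W) = card V - (s - 1)" using WV finW cW by (simp add: card_Diff_subset)
  finally show ?thesis using 1 2 by linarith
qed

section \<open>Edges inside a single part and configurations\<close>

lemma no_split_single:
  assumes near: "near_partite V E p s t m W P"
  notes st = near_partiteD(1,2)[OF near] and p = near_partiteD(3)[OF near]
    and E2 = near_partiteD(5)[OF near] and free = near_partiteD(14)[OF near]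
    and finP = finP[OF near] and missP = missP[OF near] and missW = missW[OF near]
    and bigger = bigger[OF near]
  assumes "i < p"
  shows "\<not> split_in s t {e \<in> E. e \<subseteq> W \<union> P i}"
proof
  assume "split_in s t {e \<in> E. e \<subseteq> W \<union> P i}"
  then have "clique_system (p + 1) s t E"
  \<comment> \<open>The vertices of \<open>W\<close> are nearly joined to all parts, so they can be
    added to the part in which the split is found.\<close>
  proof (rule split_embed[OF st p assms(2), where D = "W \<union> P i" and Y = P and m = m])
    show "{e \<in> E. e \<subseteq> W \<union> P i} \<subseteq> nsets (W \<union> P i) 2" using E2 unfolding nsets_def by auto
    show "card {y \<in> P l. {v, y} \<notin> E} \<le> m" if "l < p" "l \<noteq> i" "v \<in> W \<union> P i" for l v
      using missW missP[OF assms(2)] that by blast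
    show "(slack p s t + 2 * s + 2 * t) * (m + 1) \<le> card (P l)" if "l < p" for l
      by (rule bigger[OF that]) simp
  qed (use finP missP in auto)
  then show False using free by blast
qed

\<comment> \<open>\<open>?b\<close> becomes the number of inner edges. The vertices \<open>X\<close>
  of the part that meet an inner edge or a missing edge at \<open>W\<close> form a configuration
  together with \<open>W\<close>. The other vertices of the part are joined to all of
  \<open>W\<close> and stand for the infinitely many outer vertices, of which a split uses at most
  \<open>2 * (s * t)\<close>.\<close>
schematic_goal single_part:
  assumes near: "near_partite V E p s t m W P"
  notes st = near_partiteD(1,2)[OF near] and finV = near_partiteD(4)[OF near]
    and E2 = near_partiteD(5)[OF near] and WV = near_partiteD(6)[OF near]
    and cW = near_partiteD(7)[OF near] and PV = near_partiteD(8)[OF near] and finW = finW[OF near]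
    and finP = finP[OF near] and finE = finE[OF near] and finite_inner = finite_inner[OF near]
    and card_inner = card_inner[OF near] and finite_missing_at = finite_missing_at[OF near] and no_split_single = no_split_single[OF near]
  assumes i: "i < p" and room: "2 * (card (inner_edges E P i) + card (missing_at V E W)) + 2 * (s * t) \<le> card (P i)"
  shows "\<exists>v\<in>config_vals s t. int (card (inner_edges E P i)) - int (card (missing_at V E W)) \<le> v \<and> v \<le> ?b"
proof -
  have "\<exists>v\<in>config_vals s t. int (card (inner_edges E P i)) - int (card (missing_at V E W)) \<le> v \<and> v \<le> int (card (inner_edges E P i))"
  proof -
    define X where "X = {v \<in> P i. \<exists>e\<in>inner_edges E P i \<union> missing_at V E W. v \<in> e}"
    define Z where "Z = P i - X"
    have finX: "finite X" and finZ: "finite Z" using finP[OF i] unfolding X_def Z_def by auto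
    have XP: "X \<subseteq> P i" unfolding X_def by blast
    have cX: "card X \<le> 2 * (card (inner_edges E P i) + card (missing_at V E W))"
    proof -
      have "X \<subseteq> \<Union>(inner_edges E P i \<union> missing_at V E W)" unfolding X_def by blast
      moreover have "finite (\<Union>(inner_edges E P i \<union> missing_at V E W))"
      proof (rule finite_subset[OF _ finV])
        show "\<Union>(inner_edges E P i \<union> missing_at V E W) \<subseteq> V" using E2 unfolding inner_edges_def missing_at_def nsets_def by blast
      qed
      ultimately have "card X \<le> card (\<Union>(inner_edges E P i \<union> missing_at V E W))" by (intro card_mono)
      also have "\<dots> \<le> (\<Sum>e\<in>inner_edges E P i \<union> missing_at V E W. card e)"
        using card_Union_le_sum_card by blast
      also have "\<dots> = (\<Sum>e\<in>inner_edges E P i \<union> missing_at V E W. 2)"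
        using card_inner unfolding missing_at_def nsets_def by (intro sum.cong) auto
      also have "\<dots> = 2 * card (inner_edges E P i \<union> missing_at V E W)" by simp
      also have "\<dots> \<le> 2 * (card (inner_edges E P i) + card (missing_at V E W))" by (intro mult_left_mono card_Un_le) simp
      finally show ?thesis .
    qed
    have cZ: "2 * (s * t) \<le> card Z"
      unfolding Z_def using room cX XP finX by (simp add: card_Diff_subset)
    have WX: "W \<inter> X = {}" and WPi: "W \<inter> P i = {}" using PV[OF i] XP by blast+
    define N where "N = s - 1 + card X"
    obtain h where h: "bij_betw h {..<s - 1} W"
      using cW finW by (metis card_lessThan finite_lessThan finite_same_card_bij)
    have "card {s - 1..<N} = card X" unfolding N_def by simp
    then obtain h' where h': "bij_betw h' {s - 1..<N} X"
      using finX by (metis finite_atLeastLessThan finite_same_card_bij)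
    define \<psi> where "\<psi> y = (if y < s - 1 then h y else h' y)" for y
    have bW: "bij_betw \<psi> {..<s - 1} W" using h by (rule bij_betw_cong[THEN iffD1, rotated]) (simp add: \<psi>_def)
    have bX: "bij_betw \<psi> {s - 1..<N} X" using h' by (rule bij_betw_cong[THEN iffD1, rotated]) (simp add: \<psi>_def)
    have Nsplit: "{..<N} = {..<s - 1} \<union> {s - 1..<N}" unfolding N_def by auto
    have bN: "bij_betw \<psi> {..<N} (W \<union> X)"
      unfolding Nsplit using bW bX WX by (rule bij_betw_combine)
    have injN: "inj_on \<psi> {..<N}" and imN: "\<psi> ` {..<N} = W \<union> X" using bN unfolding bij_betw_def by auto
    define B where "B = {e \<in> nsets {..<N} 2. \<psi> ` e \<in> E}"
    have "card B = card {e \<in> E. e \<subseteq> W \<union> X}"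
    proof -
      have "bij_betw ((`) \<psi>) B {e \<in> E. e \<subseteq> W \<union> X}"
        unfolding bij_betw_def
      proof
        have "inj_on ((`) \<psi>) (Pow {..<N})" using injN by (rule inj_on_image_Pow)
        then show "inj_on ((`) \<psi>) B" by (rule inj_on_subset) (auto simp: B_def nsets_def)
        show "(`) \<psi> ` B = {e \<in> E. e \<subseteq> W \<union> X}"
        proof
          show "(`) \<psi> ` B \<subseteq> {e \<in> E. e \<subseteq> W \<union> X}" using imN unfolding B_def nsets_def by blast
          show "{e \<in> E. e \<subseteq> W \<union> X} \<subseteq> (`) \<psi> ` B"
          proof
            fix e assume e: "e \<in> {e \<in> E. e \<subseteq> W \<union> X}"
            then have "e \<subseteq> \<psi> ` {..<N}" using imN by simp
            then obtain d where d: "d \<subseteq> {..<N}" "e = \<psi> ` d" by (rule subset_imageE)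
            have "card e = 2" using e E2 unfolding nsets_def by auto
            then have "card d = 2" using card_image[OF inj_on_subset[OF injN d(1)]] d(2) by simp
            moreover have "finite d" using d(1) by (rule finite_subset) simp
            ultimately have "d \<in> B" using d e unfolding B_def nsets_def by auto
            then show "e \<in> (`) \<psi> ` B" using d(2) by blast
          qed
        qed
      qed
      then show ?thesis by (rule bij_betw_same_card)
    qed
    also have "\<dots> = card {e \<in> E. e \<subseteq> W \<union> X \<and> e \<inter> W \<noteq> {}} + card (inner_edges E P i)"
    proof -
      have "{e \<in> E. e \<subseteq> W \<union> X} = {e \<in> E. e \<subseteq> W \<union> X \<and> e \<inter> W \<noteq> {}} \<union> inner_edges E P i"
      proof -
        have "e \<subseteq> X" if "e \<in> inner_edges E P i" for e using that unfolding inner_edges_def X_def by blast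
        moreover have "e \<in> inner_edges E P i" if "e \<in> E" "e \<subseteq> W \<union> X" "e \<inter> W = {}" for e
          using that XP unfolding inner_edges_def by blast
        ultimately show ?thesis unfolding inner_edges_def by blast
      qed
      moreover have "e \<notin> inner_edges E P i" if "e \<inter> W \<noteq> {}" for e using that WPi unfolding inner_edges_def by blast
      ultimately show ?thesis using finE finite_inner by (simp add: card_Un_disjoint disjoint_iff)
    qed
    finally have cB: "card B = card {e \<in> E. e \<subseteq> W \<union> X \<and> e \<inter> W \<noteq> {}} + card (inner_edges E P i)" .
    let ?M = "{e \<in> nsets (W \<union> X) 2. e \<inter> W \<noteq> {}}"
    have XV: "X \<subseteq> V" using XP PV[OF i] by blast
    have "card ?M = card {e \<in> E. e \<subseteq> W \<union> X \<and> e \<inter> W \<noteq> {}} + card (?M - E)"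
    proof -
      have "?M = {e \<in> E. e \<subseteq> W \<union> X \<and> e \<inter> W \<noteq> {}} \<union> (?M - E)"
        using E2 unfolding nsets_def by blast
      moreover have "finite ?M" using finW finX by simp
      ultimately show ?thesis using finE
        by (metis (no_types, lifting) card_Un_disjoint finite_Un Int_Diff_disjoint Diff_disjoint
            disjoint_iff Diff_iff mem_Collect_eq)
    qed
    moreover have "card (?M - E) \<le> card (missing_at V E W)"
      using XV WV finite_missing_at unfolding missing_at_def by (intro card_mono) (auto simp: nsets_def)
    moreover have "card ?M = ((s - 1) choose 2) + (s - 1) * card X"
    proof -
      have "card (W \<union> X) - card W = card X" using WX finW finX by (simp add: card_Un_disjoint)
      then show ?thesis using card_pairs_meeting[of "W \<union> X" W] finW finX cW by simp
    qed
    ultimately have M: "((s - 1) choose 2) + (s - 1) * card X =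
        card {e \<in> E. e \<subseteq> W \<union> X \<and> e \<inter> W \<noteq> {}} + card (?M - E)" "card (?M - E) \<le> card (missing_at V E W)" by simp_all
    have "int (((s - 1) choose 2) + (s - 1) * card X) = int ((s - 1) choose 2) + int ((s - 1) * (N - (s - 1)))"
      unfolding N_def by simp
    with M cB have val: "int (card (inner_edges E P i)) - int (card (missing_at V E W)) \<le> int (card B) - int ((s - 1) choose 2) - int ((s - 1) * (N - (s - 1)))"
      "int (card B) - int ((s - 1) choose 2) - int ((s - 1) * (N - (s - 1))) \<le> int (card (inner_edges E P i))"
      by linarith+
    have nosplit: "\<not> split_in s t (config_edges s N B)"
    proof
      assume "split_in s t (config_edges s N B)"
      then obtain S x b where S: "S \<subseteq> bip_verts s t" and sp: "spread s t S x b"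
        and b: "\<And>i j. \<lbrakk>i < s; j < t\<rbrakk> \<Longrightarrow> b i j \<in> config_edges s N B"
        unfolding split_in_def by blast
      \<comment> \<open>The outer vertices that occur in the split; \<open>cZ\<close> leaves room to
        move them injectively into \<open>Z\<close>.\<close>
      define T where "T = (\<Union>i<s. \<Union>j<t. b i j) - {..<N}"
      have b2: "finite (b i j) \<and> card (b i j) \<le> 2" if "i < s" "j < t" for i j
        using b[OF that] unfolding config_edges_def B_def nsets_def by (auto simp: card_insert_if)
      have finT: "finite T" unfolding T_def using b2 by blast
      have "card T \<le> card (\<Union>i<s. \<Union>j<t. b i j)" unfolding T_def using b2 by (intro card_mono) auto
      also have "\<dots> \<le> (\<Sum>i<s. card (\<Union>j<t. b i j))" by (rule card_UN_le) simp
      also have "\<dots> \<le> (\<Sum>i<s. \<Sum>j<t. card (b i j))" by (intro sum_mono card_UN_le) simp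
      also have "\<dots> \<le> (\<Sum>i<s. \<Sum>j<t. 2)" using b2 by (intro sum_mono) auto
      also have "\<dots> = 2 * (s * t)" by simp
      finally have "card T \<le> card Z" using cZ by linarith
      then have "\<exists>g. g ` T \<subseteq> Z \<and> inj_on g T" using finT finZ by (intro card_le_inj)
      then obtain g where g: "g ` T \<subseteq> Z" "inj_on g T" by (elim exE conjE)
      define \<phi> where "\<phi> y = (if y < N then \<psi> y else g y)" for y
      have \<phi>N: "\<phi> y = \<psi> y" if "y < N" for y using that unfolding \<phi>_def by simp
      have \<phi>T: "\<phi> y = g y" if "y \<in> T" for y using that unfolding \<phi>_def T_def by simp
      have inj: "inj_on \<phi> ({..<N} \<union> T)"
      proof -
        have "inj_on \<phi> {..<N}" using injN \<phi>N by (simp add: inj_on_def)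
        moreover have "inj_on \<phi> T" using g(2) \<phi>T by (simp add: inj_on_def)
        moreover have "\<phi> ` {..<N} = W \<union> X" using imN \<phi>N by simp
        moreover have "\<phi> ` T \<subseteq> Z" using g(1) \<phi>T by auto
        moreover have "(W \<union> X) \<inter> Z = {}" unfolding Z_def using WPi by blast
        ultimately show ?thesis unfolding inj_on_Un by blast
      qed
      have bD: "b i j \<subseteq> {..<N} \<union> T" if "i < s" "j < t" for i j unfolding T_def using that by blast
      have sp': "spread s t S (\<phi> \<circ> x) (\<lambda>i j. \<phi> ` b i j)"
        by (rule spread_image[OF sp S st inj bD])
      have "\<phi> ` b k j \<in> {e \<in> E. e \<subseteq> W \<union> P i}" if kj: "k < s" "j < t" for k j
      proof -
        consider "b k j \<in> B" | w y where "b k j = {w, y}" "w < s - 1" "N \<le> y"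
          using b[OF kj] unfolding config_edges_def by blast
        then show ?thesis
        proof cases
          case 1
          then have "\<phi> ` b k j = \<psi> ` b k j" using \<phi>N unfolding B_def nsets_def by (intro image_cong) auto
          moreover have "\<psi> ` b k j \<subseteq> W \<union> X" using 1 imN unfolding B_def nsets_def by blast
          ultimately show ?thesis using 1 XP unfolding B_def by auto
        next
          case 2
          have "w < N" using 2 unfolding N_def by simp
          then have "\<phi> w = \<psi> w" by (rule \<phi>N)
          then have w: "\<phi> w \<in> W" using bW 2 unfolding bij_betw_def by auto
          have "y \<in> b k j" "y \<notin> {..<N}" using 2 by simp_all
          then have "y \<in> T" unfolding T_def using kj by blast
          then have y: "\<phi> y \<in> Z" using g(1) \<phi>T by auto
          have "{\<phi> w, \<phi> y} \<in> E"
          proof (rule ccontr)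
            assume "{\<phi> w, \<phi> y} \<notin> E"
            moreover have "\<phi> y \<in> P i" using y unfolding Z_def by blast
            moreover have "\<phi> w \<noteq> \<phi> y" using w \<open>\<phi> y \<in> P i\<close> WPi by auto
            ultimately have "{\<phi> w, \<phi> y} \<in> missing_at V E W" unfolding missing_at_def using w WV PV[OF i] by auto
            then have "\<phi> y \<in> X" unfolding X_def using \<open>\<phi> y \<in> P i\<close> by blast
            then show False using y unfolding Z_def by blast
          qed
          then show ?thesis using 2 w y unfolding Z_def by auto
        qed
      qed
      then have "split_in s t {e \<in> E. e \<subseteq> W \<union> P i}"
        unfolding split_in_def using S sp' by (intro exI[of _ S] exI[of _ "\<phi> \<circ> x"] exI[of _ "\<lambda>i j. \<phi> ` b i j"]) blast
      then show False using no_split_single[OF i] by blast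
    qed
    have "int (card B) - int ((s - 1) choose 2) - int ((s - 1) * (N - (s - 1))) \<in> config_vals s t"
      unfolding config_vals_def using nosplit
      by (intro CollectI exI[of _ N] exI[of _ B]) (auto simp: N_def B_def)
    then show ?thesis using val by blast
  qed
  then show "\<exists>v\<in>config_vals s t. int (card (inner_edges E P i)) - int (card (missing_at V E W)) \<le> v \<and> v \<le> int (card (inner_edges E P i))" .
qed

\<comment> \<open>An excess above \<open>c\<close> with edges inside two parts contradicts
  \<open>multi_part\<close> and \<open>c1\<close>. Inside one part there are at most
  \<open>(t - 1) * t\<close> edges, the origin of the cutoff in \<open>c2\<close>; since
  \<open>c \<ge> 0\<close>, no more edges are missing at \<open>W\<close> than are gained, so the
  part is large enough for \<open>single_part\<close>, whose value contradicts \<open>c2\<close>.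
  \<open>?b\<close> becomes the expanded \<open>base_count\<close>.\<close>
schematic_goal near_partite_edges_le:
  fixes c :: int
  assumes near: "near_partite V E p s t m W P"
  notes st = near_partiteD(1,2)[OF near] and p = near_partiteD(3)[OF near]
    and sum_mnum_le = sum_mnum_le[OF near] and card_J_le = card_J_le[OF near]
    and multi_part = multi_part[OF near] and edge_count = edge_count[OF near]
    and single_part = single_part[OF near]
  assumes c1: "int ((t - 1) * (t - 1)) \<le> c"
    and c2: "\<And>v. \<lbrakk>v \<in> config_vals s t; v \<le> int ((t - 1) * t)\<rbrakk> \<Longrightarrow> v \<le> c"
    and room: "\<And>i. i < p \<Longrightarrow> 4 * ((t - 1) * t) + 2 * (s * t) \<le> card (P i)"
  shows "int (card E) \<le> ?b + c"
proof -
  have "int (card E) \<le> int ((s - 1) choose 2) + int ((s - 1) * (card V - (s - 1))) +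
     int (turan_edges p (card V - (s - 1))) + c"
  proof (rule ccontr)
    assume neg: "\<not> ?thesis"
    let ?sJ = "\<Sum>i<p. card (inner_edges E P i)"
    have "int (card E) + int (card (missing_at V E W)) + int (card (missing_cross V E p W P)) \<le> int ((s - 1) choose 2) +
       int ((s - 1) * (card V - (s - 1))) + int (turan_edges p (card V - (s - 1))) + int ?sJ"
      using of_nat_mono[OF edge_count, where ?'a = int] by simp
    then have gain: "c + int (card (missing_at V E W)) + int (card (missing_cross V E p W P)) < int ?sJ" using neg by linarith
    show False
    proof (cases "\<exists>i<p. \<exists>j<p. i \<noteq> j \<and> inner_edges E P i \<noteq> {} \<and> inner_edges E P j \<noteq> {}")
      case True
      then obtain i j where "i < p" "j < p" "i \<noteq> j" "inner_edges E P i \<noteq> {}" "inner_edges E P j \<noteq> {}" by blast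
      then have "?sJ \<le> (t - 1) * (t - 1) + card (missing_cross V E p W P)" by (rule multi_part)
      then have "int ?sJ \<le> int ((t - 1) * (t - 1) + card (missing_cross V E p W P))" by (rule of_nat_mono)
      then show False using gain c1 by simp
    next
      case False
      have "\<exists>i<p. \<forall>j<p. j \<noteq> i \<longrightarrow> inner_edges E P j = {}"
      proof (cases "\<exists>i<p. inner_edges E P i \<noteq> {}")
        case True then show ?thesis using False by blast
      next
        case nf: False
        have "0 < p" using p by simp
        then show ?thesis using nf by blast
      qed
      then obtain i where i: "i < p" "\<And>j. \<lbrakk>j < p; j \<noteq> i\<rbrakk> \<Longrightarrow> inner_edges E P j = {}" by blast
      have "?sJ = card (inner_edges E P i) + (\<Sum>j\<in>{..<p} - {i}. card (inner_edges E P j))" using i(1) by (intro sum.remove) auto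
      also have "(\<Sum>j\<in>{..<p} - {i}. card (inner_edges E P j)) = 0" using i(2) by (intro sum.neutral) auto
      finally have sJ: "?sJ = card (inner_edges E P i)" by simp
      have "\<exists>j<p. j \<noteq> i"
        using p by (intro exI[of _ "if i = 0 then 1 else 0"]) auto
      then obtain j where "j < p" "j \<noteq> i" by blast
      then have "mnum (inner_edges E P i) \<le> t - 1" using sum_mnum_le[of j "{i}"] i(1) by simp
      then have "card (inner_edges E P i) \<le> (t - 1) * (t - 1 + 1)"
        using card_J_le[OF i(1)] mult_right_mono[of "mnum (inner_edges E P i)" "t - 1" "t - 1 + 1"] by linarith
      then have Jt: "card (inner_edges E P i) \<le> (t - 1) * t" using st by simp
      have "c \<ge> 0" using c1 of_nat_0_le_iff by (rule order_trans[rotated])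
      then have "card (missing_at V E W) \<le> card (inner_edges E P i)" using gain sJ by simp
      then have "2 * (card (inner_edges E P i) + card (missing_at V E W)) + 2 * (s * t) \<le> card (P i)"
      proof -
        have "2 * (card (inner_edges E P i) + card (missing_at V E W)) \<le> 4 * card (inner_edges E P i)" using \<open>card (missing_at V E W) \<le> card (inner_edges E P i)\<close> by simp
        also have "\<dots> \<le> 4 * ((t - 1) * t)" using Jt by (rule mult_left_mono) simp
        finally show ?thesis using room[OF i(1)] by (meson add_right_mono order_trans)
      qed
      then obtain v where v: "v \<in> config_vals s t" "int (card (inner_edges E P i)) - int (card (missing_at V E W)) \<le> v" "v \<le> int (card (inner_edges E P i))"
        using single_part[OF i(1)] by blast
      have "int (card (inner_edges E P i)) \<le> int ((t - 1) * t)" using Jt by (rule of_nat_mono)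
      then have "v \<le> c" using v by (intro c2) auto
      then show False using gain sJ v(2) by simp
    qed
  qed
  then show "int (card E) \<le> int ((s - 1) choose 2) + int ((s - 1) * (card V - (s - 1))) +
     int (turan_edges p (card V - (s - 1))) + c" .
qed

subsection \<open>The upper bound\<close>

\<comment> \<open>\<open>?a\<close> becomes \<open>s\<close>. A graph with too few edges for
  \<open>ex_near_partite\<close> obeys the bound because of \<open>c \<ge> 0\<close>; for the
  others, the real error \<open>\<gamma> * N\<close> is rounded down to the \<open>m\<close> of
  \<open>near_partite\<close>.\<close>
schematic_goal dense_upper_bound:
  fixes c :: int
  assumes st: "1 \<le> s" "1 \<le> t" and p: "3 \<le> p"
    and c1: "int ((t - 1) * (t - 1)) \<le> c"
    and c2: "\<And>v. \<lbrakk>v \<in> config_vals s t; v \<le> int ((t - 1) * t)\<rbrakk> \<Longrightarrow> v \<le> c"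
  shows "\<exists>n0. \<forall>(V :: 'a set) E. dense p V E \<longrightarrow> n0 \<le> card V \<longrightarrow> \<not> clique_system (p + 1) s t E \<longrightarrow>
     int (card E) \<le> base_count p ?a (card V) + c"
proof -
  have "\<exists>n0. \<forall>(V :: 'a set) E. dense p V E \<longrightarrow> n0 \<le> card V \<longrightarrow> \<not> clique_system (p + 1) s t E \<longrightarrow>
     int (card E) \<le> base_count p s (card V) + c"
  proof -
    define rp where "rp = real p"
    define Q where "Q = real (slack p s t + 2 * s + 2 * t + 3)"
    define R where "R = real (4 * ((t - 1) * t) + 2 * (s * t))"
    have rp: "rp \<ge> 3" using p unfolding rp_def by simp
    have Q1: "Q \<ge> 1" unfolding Q_def by simp
    obtain \<gamma> where \<gamma>0: "\<gamma> > 0" and \<gamma>: "Q * \<gamma> \<le> 1 / (4 * rp)" "\<gamma> \<le> 1 / (4 * rp)"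
      using ex_small[of "[(Q, 1 / (4 * rp)), (1, 1 / (4 * rp))]"] rp by auto
    obtain n1 where n1: "\<forall>(V :: 'a set) E. dense p V E \<longrightarrow> n1 \<le> card V \<longrightarrow> \<not> clique_system (p + 1) s t E \<longrightarrow>
       (s - 1) * (card V - s + 1) + turan_edges p (card V - s + 1) \<le> card E \<longrightarrow>
       (\<exists>W P. W \<subseteq> V \<and> card W = s - 1 \<and> (\<forall>i<p. P i \<subseteq> V - W) \<and> V - W \<subseteq> (\<Union>i<p. P i) \<and>
         (\<forall>i<p. \<forall>j<p. i \<noteq> j \<longrightarrow> P i \<inter> P j = {}) \<and>
         (\<forall>w\<in>W. real (card (nonnbs V E w)) \<le> \<gamma> * real (card V)) \<and>
         (\<forall>i<p. \<forall>v\<in>P i. real (card (nonnbs V E v - P i)) \<le> \<gamma> * real (card V)) \<and>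
         (\<forall>i<p. real (card V) / real p - \<gamma> * real (card V) \<le> real (card (P i))))"
      using ex_near_partite[OF st p \<gamma>0, where ?'a = 'a] by (rule exE)
    have "\<forall>(c, b)\<in>set [(1 / (4 * rp), Q), (1 / (4 * rp), R)]. (c :: real) > 0" using rp by auto
    from ex_large[OF this] obtain n2 where
      n2: "\<forall>n\<ge>n2. \<forall>(c, b)\<in>set [(1 / (4 * rp), Q), (1 / (4 * rp), R)]. b \<le> c * real n" by (rule exE)
    show ?thesis
    proof (intro exI[of _ "n1 + n2 + s"] allI impI)
      fix V :: "'a set" and E
      assume d: "dense p V E" and n: "n1 + n2 + s \<le> card V" and F: "\<not> clique_system (p + 1) s t E"
      have sn: "card V - s + 1 = card V - (s - 1)" using n st by linarith
      have c0: "c \<ge> 0" using c1 of_nat_0_le_iff by (rule order_trans[rotated])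
      define N where "N = real (card V)"
      have N0: "N \<ge> 0" unfolding N_def by simp
      have big: "Q \<le> N / (4 * rp)" "R \<le> N / (4 * rp)"
        using spec[OF n2, of "card V", THEN mp] n unfolding N_def by auto
      have sm: "Q * (\<gamma> * N) \<le> N / (4 * rp)" "\<gamma> * N \<le> N / (4 * rp)"
        using \<gamma>[THEN mult_right_mono, OF N0] by (simp_all add: mult.assoc)
      show "int (card E) \<le> base_count p s (card V) + c"
      proof (cases "(s - 1) * (card V - s + 1) + turan_edges p (card V - s + 1) \<le> card E")
        case False
        then have "int (card E) \<le> int ((s - 1) * (card V - (s - 1)) + turan_edges p (card V - (s - 1)))"
          unfolding sn by (intro of_nat_mono) simp
        then show ?thesis using c0 unfolding base_count_def by simp
      next
        case True
        have "n1 \<le> card V" using n by simp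
        from n1[rule_format, OF d this F True] obtain W P where WP: "W \<subseteq> V" "card W = s - 1"
          "\<forall>i<p. P i \<subseteq> V - W" "V - W \<subseteq> (\<Union>i<p. P i)" "\<forall>i<p. \<forall>j<p. i \<noteq> j \<longrightarrow> P i \<inter> P j = {}"
          "\<forall>w\<in>W. real (card (nonnbs V E w)) \<le> \<gamma> * N"
          "\<forall>i<p. \<forall>v\<in>P i. real (card (nonnbs V E v - P i)) \<le> \<gamma> * N"
          "\<forall>i<p. N / rp - \<gamma> * N \<le> real (card (P i))"
          unfolding N_def rp_def by (elim exE conjE)
        define m where "m = nat \<lfloor>\<gamma> * N\<rfloor>"
        have m: "real m \<le> \<gamma> * N" unfolding m_def using \<gamma>0 N0 by (intro of_nat_floor) simp
        have m_ge: "x \<le> m" if "real x \<le> \<gamma> * N" for x using that unfolding m_def by (simp add: le_nat_floor)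
        have Nsplit: "N / rp = 4 * (N / (4 * rp))" using rp by simp
        have "near_partite V E p s t m W P"
          unfolding near_partite_def
        proof (intro conjI allI impI ballI)
          show "(slack p s t + 2 * s + 2 * t + 3) * (m + 1) \<le> card (P i)" if "i < p" for i
          proof -
            have "Q * (real m + 1) \<le> Q * (\<gamma> * N + 1)" using m Q1 by (intro mult_left_mono) auto
            also have "\<dots> = Q * (\<gamma> * N) + Q" by (simp add: algebra_simps)
            also have "\<dots> \<le> N / rp - \<gamma> * N"
              using sm big Nsplit divide_nonneg_nonneg[OF N0, of "4 * rp"] rp by linarith
            also have "\<dots> \<le> real (card (P i))" using WP(8) that by blast
            finally have "real ((slack p s t + 2 * s + 2 * t + 3) * (m + 1)) \<le> real (card (P i))"
              unfolding Q_def by (simp only: of_nat_mult of_nat_add of_nat_1)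
            then show ?thesis by (simp only: of_nat_le_iff)
          qed
          show "card (nonnbs V E w) \<le> m" if "w \<in> W" for w using WP(6) that by (intro m_ge) blast
          show "card (nonnbs V E v - P i) \<le> m" if "i < p" "v \<in> P i" for i v
            using WP(7) that by (intro m_ge) blast
        qed (use st p d WP(1-5) F in \<open>simp_all add: dense_def\<close>)
        then have "int (card E) \<le> int ((s - 1) choose 2) + int ((s - 1) * (card V - (s - 1))) +
            int (turan_edges p (card V - (s - 1))) + c"
        proof (rule near_partite_edges_le[OF _ c1])
          show "4 * ((t - 1) * t) + 2 * (s * t) \<le> card (P i)" if "i < p" for i
          proof -
            have "R \<le> N / rp - \<gamma> * N"
              using sm big Nsplit divide_nonneg_nonneg[OF N0, of "4 * rp"] rp by linarith
            also have "\<dots> \<le> real (card (P i))" using WP(8) that by blast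
            finally show ?thesis unfolding R_def by (simp only: of_nat_le_iff)
          qed
        qed (use c2 in auto)
        then show ?thesis unfolding base_count_def .
      qed
    qed
  qed
  then show "\<exists>n0. \<forall>(V :: 'a set) E. dense p V E \<longrightarrow> n0 \<le> card V \<longrightarrow> \<not> clique_system (p + 1) s t E \<longrightarrow>
     int (card E) \<le> base_count p s (card V) + c" .
qed

lemma base_count_Suc:
  assumes "1 \<le> p" "s \<le> n"
  shows "base_count p s (Suc n) = base_count p s n + int (s - 1) + int (n - (s - 1)) - int ((n - (s - 1)) div p)"
proof -
  define r where "r = n - (s - 1)"
  have 1: "Suc n - (s - 1) = Suc r" unfolding r_def using assms by linarith
  have "int (turan_edges p (Suc r)) = int (turan_edges p r) + int r - int (r div p)"
    using of_nat_mono[OF order_refl, where ?'a = int] turan_edges_Suc[OF assms(1), of r]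
    by (metis (no_types) add_diff_cancel_right' of_nat_add)
  moreover have "int ((s - 1) * Suc r) = int ((s - 1) * r) + int (s - 1)" by simp
  ultimately show ?thesis unfolding base_count_def 1 r_def[symmetric] by linarith
qed

text \<open>Deleting a vertex of small degree increases the excess over \<open>base_count\<close>, so graphs with a
  larger excess than \<open>c\<close> cannot keep being non-dense all the way down from a large \<open>n\<close>.\<close>

schematic_goal upper_bound:
  fixes c :: int
  assumes st: "1 \<le> s" "1 \<le> t" and p: "3 \<le> p"
    and c1: "int ((t - 1) * (t - 1)) \<le> c"
    and c2: "\<And>v. \<lbrakk>v \<in> config_vals s t; v \<le> int ((t - 1) * t)\<rbrakk> \<Longrightarrow> v \<le> c"
  shows "\<exists>N. \<forall>(V :: 'a set) E. finite V \<longrightarrow> E \<subseteq> nsets V 2 \<longrightarrow> N \<le> card V \<longrightarrow>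
     \<not> clique_system (p + 1) s t E \<longrightarrow> int (card E) \<le> base_count p ?a (card V) + c"
proof -
  have "\<exists>N. \<forall>(V :: 'a set) E. finite V \<longrightarrow> E \<subseteq> nsets V 2 \<longrightarrow> N \<le> card V \<longrightarrow>
     \<not> clique_system (p + 1) s t E \<longrightarrow> int (card E) \<le> base_count p s (card V) + c"
  proof -
    obtain n1 where n1: "\<forall>(V :: 'a set) E. dense p V E \<longrightarrow> n1 \<le> card V \<longrightarrow> \<not> clique_system (p + 1) s t E \<longrightarrow>
       int (card E) \<le> base_count p s (card V) + c"
      using dense_upper_bound[OF st p c1 c2, where ?'a = 'a] by (rule exE)
    define n0 where "n0 = n1 + s + 1"
    \<comment> \<open>The excess allowed at \<open>n\<close>. It starts from the trivial bound
      \<open>n0 * n0\<close> and falls by one with each vertex until it reaches \<open>c\<close>, in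
      step with the gain of at least one when a vertex is deleted from a non-dense graph.\<close>
    define D where "D n = max c (int (n0 * n0) - (int n - int n0))" for n
    have main: "int (card E) \<le> base_count p s n + D n"
      if "n0 \<le> n" "finite V" "E \<subseteq> nsets V 2" "card V = n" "\<not> clique_system (p + 1) s t E"
      for n and V :: "'a set" and E
      using that
    proof (induction n arbitrary: V E rule: dec_induct)
      case base
      have "card E \<le> card V choose 2"
        using card_mono[OF _ base(2)] base(1) by (simp add: card_nsets_2)
      also have "\<dots> \<le> n0 * n0" unfolding base(3) choose_two by (meson div_le_dividend le_trans diff_le_self mult_le_mono2)
      finally have "int (card E) \<le> int (n0 * n0)" by (rule of_nat_mono)
      moreover have "0 \<le> base_count p s n0" unfolding base_count_def by simp
      ultimately show ?case unfolding D_def by simp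
    next
      case (step n)
      note finV = step.prems(1) and E2 = step.prems(2) and cV = step.prems(3) and F = step.prems(4)
      show ?case
      proof (cases "dense p V E")
        case True
        have "n1 \<le> card V" using step.hyps cV unfolding n0_def by simp
        then have "int (card E) \<le> base_count p s (card V) + c" using n1 True F by blast
        then show ?thesis unfolding cV D_def by simp
      next
        case False
        then obtain v where v: "v \<in> V" "\<not> p * card (nonnbs V E v) \<le> Suc n + p"
          using finV E2 cV unfolding dense_def by auto
        define E' where "E' = {e \<in> E. v \<notin> e}"
        have finE: "finite E" using finite_subset[OF E2] finV by simp
        have E'2: "E' \<subseteq> nsets (V - {v}) 2" using E2 unfolding E'_def nsets_def by blast
        have F': "\<not> clique_system (p + 1) s t E'"
        proof
          assume "clique_system (p + 1) s t E'"
          then have "clique_system (p + 1) s t E" unfolding clique_system_def E'_def by blast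
          then show False using F by blast
        qed
        have "int (card E') \<le> base_count p s n + D n"
          using finV v(1) cV by (intro step.IH[OF _ E'2 _ F']) auto
        moreover have "card E \<le> card E' + card (V \<inter> nbs E v)"
        proof -
          have "E \<subseteq> E' \<union> (\<lambda>u. {v, u}) ` (V \<inter> nbs E v)"
          proof
            fix e assume e: "e \<in> E"
            then obtain a b where ab: "e = {a, b}" "a \<in> V" "b \<in> V" using E2 by (blast elim: nsets_2_E)
            show "e \<in> E' \<union> (\<lambda>u. {v, u}) ` (V \<inter> nbs E v)"
            proof (cases "v \<in> e")
              case True
              then consider "a = v" | "b = v" using ab by blast
              then show ?thesis
              proof cases
                case 1 then show ?thesis using ab e unfolding nbs_def by blast
              next
                case 2
                then have "e = {v, a}" using ab by blast
                then show ?thesis using ab e unfolding nbs_def by blast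
              qed
            next
              case False then show ?thesis using e unfolding E'_def by blast
            qed
          qed
          then have "card E \<le> card (E' \<union> (\<lambda>u. {v, u}) ` (V \<inter> nbs E v))"
            using finE finV unfolding E'_def by (intro card_mono) auto
          also have "\<dots> \<le> card E' + card ((\<lambda>u. {v, u}) ` (V \<inter> nbs E v))" by (rule card_Un_le)
          also have "card ((\<lambda>u. {v, u}) ` (V \<inter> nbs E v)) \<le> card (V \<inter> nbs E v)"
            using finV by (intro card_image_le) auto
          finally show ?thesis by simp
        qed
        moreover have "card (nonnbs V E v) + card (V \<inter> nbs E v) = Suc n"
        proof -
          have "nonnbs V E v \<union> (V \<inter> nbs E v) = V" "nonnbs V E v \<inter> (V \<inter> nbs E v) = {}"
            unfolding nonnbs_def nbs_def by auto
          moreover have "finite (nonnbs V E v)" unfolding nonnbs_def using finV by simp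
          ultimately show ?thesis
            using card_Un_disjoint[of "nonnbs V E v" "V \<inter> nbs E v"] finV cV by simp
        qed
        \<comment> \<open>With so many non-neighbours the degree of \<open>v\<close> is at least one
          below the increase of \<open>base_count\<close> from \<open>n\<close> to
          \<open>Suc n\<close>.\<close>
        moreover have "(n - (s - 1)) div p + 2 \<le> card (nonnbs V E v)"
        proof (rule ccontr)
          assume "\<not> ?thesis"
          then have "card (nonnbs V E v) \<le> (n - (s - 1)) div p + 1" by simp
          then have "p * card (nonnbs V E v) \<le> p * ((n - (s - 1)) div p + 1)" by (rule mult_left_mono) simp
          also have "\<dots> = p * ((n - (s - 1)) div p) + p" by (simp add: algebra_simps)
          also have "\<dots> \<le> (n - (s - 1)) + p" by (rule add_right_mono[OF times_div_less_eq_dividend])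
          finally show False using v(2) by simp
        qed
        moreover have "base_count p s (Suc n) = base_count p s n + int (s - 1) + int (n - (s - 1)) -
            int ((n - (s - 1)) div p)"
          using p step.hyps by (intro base_count_Suc) (auto simp: n0_def)
        moreover have "int (s - 1) + int (n - (s - 1)) = int n"
          using step.hyps by (simp add: n0_def)
        moreover have "D n - 1 \<le> D (Suc n)" unfolding D_def by simp
        ultimately show ?thesis by linarith
      qed
    qed
    have "c \<ge> 0" using c1 of_nat_0_le_iff by (rule order_trans[rotated])
    have "int (card E) \<le> base_count p s (card V) + c"
      if "finite V" "E \<subseteq> nsets V 2" "n0 * n0 + n0 \<le> card V" "\<not> clique_system (p + 1) s t E"
      for V :: "'a set" and E
    proof -
      have "int (n0 * n0 + n0) \<le> int (card V)" using that(3) by (rule of_nat_mono)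
      then have "D (card V) = c" unfolding D_def using \<open>c \<ge> 0\<close> by simp
      then show ?thesis using main[OF _ that(1,2) refl that(4)] that(3) by simp
    qed
    then show ?thesis by blast
  qed
  then show "\<exists>N. \<forall>(V :: 'a set) E. finite V \<longrightarrow> E \<subseteq> nsets V 2 \<longrightarrow> N \<le> card V \<longrightarrow>
     \<not> clique_system (p + 1) s t E \<longrightarrow> int (card E) \<le> base_count p s (card V) + c" .
qed

theorem theorem1p4:
  fixes s t :: nat
  assumes "1 \<le> s" and "s \<le> t"
  shows "\<exists>c :: int. \<forall>p \<ge> 3. \<exists>N. \<forall>n \<ge> N.
    int (ex_num n (edge_blowup (p + 1) (complete_bipartite s t))) =
      int ((s - 1) choose 2) + int ((s - 1) * (n - s + 1)) + int (turan_edges p (n - s + 1)) + c"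
proof -
  have st: "1 \<le> s" "1 \<le> t" using assms by auto
  \<comment> \<open>A finite window of \<open>config_vals\<close>. Its lower end is attained by
    \<open>square_in_config_vals\<close>, so the maximum exists; its upper end is the cutoff from
    \<open>near_partite_edges_le\<close>. Neither depends on \<open>p\<close>, so \<open>c\<close>
    can be fixed before \<open>p\<close>.\<close>
  let ?A = "{v \<in> config_vals s t. int ((t - 1) * (t - 1)) \<le> v \<and> v \<le> int ((t - 1) * t)}"
  have "?A \<subseteq> {int ((t - 1) * (t - 1))..int ((t - 1) * t)}" by auto
  then have finA: "finite ?A" by (rule finite_subset) simp
  have sqA: "int ((t - 1) * (t - 1)) \<in> ?A"
  proof -
    have "(t - 1) * (t - 1) \<le> (t - 1) * t" by (rule mult_left_mono) auto
    then have "int ((t - 1) * (t - 1)) \<le> int ((t - 1) * t)" by (rule of_nat_mono)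
    then show ?thesis using square_in_config_vals[OF assms] by blast
  qed
  define c where "c = Max ?A"
  have cA: "c \<in> ?A" unfolding c_def using finA sqA by (intro Max_in) auto
  have c1: "int ((t - 1) * (t - 1)) \<le> c" using cA by blast
  have c2: "v \<le> c" if "v \<in> config_vals s t" "v \<le> int ((t - 1) * t)" for v
  proof (cases "int ((t - 1) * (t - 1)) \<le> v")
    case True
    then have "v \<in> ?A" using that by blast
    then show ?thesis unfolding c_def by (rule Max_ge[OF finA])
  next
    case False then show ?thesis using c1 by linarith
  qed
  show ?thesis
  proof (intro exI[of _ c] allI impI)
    fix p :: nat assume p: "3 \<le> p"
    then have p1: "1 \<le> p" by simp
    obtain N1 where N1: "\<forall>(V :: nat set) E. finite V \<longrightarrow> E \<subseteq> nsets V 2 \<longrightarrow> N1 \<le> card V \<longrightarrow>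
       \<not> clique_system (p + 1) s t E \<longrightarrow> int (card E) \<le> base_count p s (card V) + c"
      using upper_bound[OF st p c1 c2, where ?'a = nat] by (rule exE)
    obtain N2 where N2: "\<forall>n\<ge>N2. \<exists>E. E \<subseteq> nsets {..<n} 2 \<and> \<not> clique_system (p + 1) s t E \<and>
       int (card E) = base_count p s n + c"
      using config_graph[OF st p1, of c] cA by blast
    let ?F = "edge_blowup (p + 1) (complete_bipartite s t)"
    have "edges ?F \<noteq> {}"
    proof -
      have "{Inl (Inl 0), Inl (Inr 0)} \<in> nsets (blowup_clique (p + 1) {Inl 0, Inr 0}) 2"
        unfolding blowup_clique_def by simp
      moreover have "0 < s" "0 < t" using st by simp_all
      ultimately show ?thesis unfolding edges_edge_blowup by blast
    qed
    show "\<exists>N. \<forall>n\<ge>N. int (ex_num n ?F) =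
      int ((s - 1) choose 2) + int ((s - 1) * (n - s + 1)) + int (turan_edges p (n - s + 1)) + c"
    proof (intro exI[of _ "N1 + N2 + s"] allI impI)
      fix n assume n: "N1 + N2 + s \<le> n"
      let ?C = "{card (edges G) | G :: nat graph. fin_simple_graph G \<and> card (verts G) = n \<and> \<not> contains_copy G ?F}"
      have "N2 \<le> n" using n by simp
      then obtain E where E: "E \<subseteq> nsets {..<n} 2" "\<not> clique_system (p + 1) s t E"
        "int (card E) = base_count p s n + c" using N2 by blast
      have "\<not> contains_copy ({..<n}, E) ?F" using copy_iff_clique_system[OF E(1) st p1] E(2) by blast
      then have "card E \<in> ?C"
        using E(1) by (intro CollectI exI[of _ "({..<n}, E)"]) (simp add: fin_simple_graph_def)
      moreover have "k \<le> card E" if kC: "k \<in> ?C" for k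
      proof -
        from kC obtain G :: "nat graph" where G0: "k = card (edges G)" "fin_simple_graph G"
          "card (verts G) = n" "\<not> contains_copy G ?F" by blast
        obtain V E' where "G = (V, E')" by (rule prod.exhaust)
        with G0 have G: "k = card E'" "finite V" "E' \<subseteq> nsets V 2" "card V = n"
          "\<not> contains_copy (V, E') ?F"
          by (simp_all add: fin_simple_graph_def)
        then have "\<not> clique_system (p + 1) s t E'" using copy_iff_clique_system[OF G(3) st p1] by blast
        moreover have "N1 \<le> card V" using G(4) n by simp
        ultimately have "int (card E') \<le> base_count p s (card V) + c" using N1 G(2,3) by blast
        then show ?thesis using G(1,4) E(3) by simp
      qed
      ultimately have "ex_num n ?F = card E"
        unfolding ex_num_def using ex_candidates(1)[OF \<open>edges ?F \<noteq> {}\<close>, of n] by (intro Max_eqI) auto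
      moreover have "n - s + 1 = n - (s - 1)" using n st by linarith
      ultimately show "int (ex_num n ?F) =
        int ((s - 1) choose 2) + int ((s - 1) * (n - s + 1)) + int (turan_edges p (n - s + 1)) + c"
        using E(3) unfolding base_count_def by simp
    qed
  qed
qed

end
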